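(* Let $K$ be a field of characteristic $p>0$ and let $L/K$ be a finite purely inseparable field extension of exponent $e$. Then $L/K$ is modular if and only if for every integer $i$ with $0<i\le e-1$ the multiplication homomorphism $$L\otimes_{L^{p^i}}\mathcal{A}_{L/K,\,i}\to \mathrm{Diff}^{\,p^i}_K L,\qquad a\otimes D\mapsto aD,$$ is surjective; that is, for each such $i$, $\mathcal{A}_{L/K,\,i}$ spans $\mathrm{Diff}^{\,p^i}_K L$ as an $L$-vector space.
   Context: A finite field extension $L/K$ is called modular if there exist $x_1,\ldots,x_n\in L$ such that $L\cong K(x_1)\otimes_K\cdots\otimes_K K(x_n)$ (via the multiplication map). The exponent of a finite purely inseparable extension $L/K$ is the smallest integer $e\ge 0$ with $L^{p^e}\subseteq K$, where $L^{p^j}=\{x^{p^j}:x\in L\}$. For a commutative ring extension $B/A$, $\mathrm{Diff}_A B\subseteq \mathrm{End}_A B$ denotes the ring of $A$-linear differential operators of $B$ (in the sense of Grothendieck), and $\mathrm{Diff}^n_A B$ denotes those of order $\le n$: an $A$-linear endomorphism $D$ of $B$ has order $\le n$ if $[[\cdots[D,b_0],\ldots],b_n]=0$ for all $b_0,\ldots,b_n\in B$, where elements of $B$ are viewed as multiplication operators. $\mathrm{Diff}^n_A B$ is a $B$-module by left multiplication, $(bD)(x)=b\,D(x)$. When $A$ has prime characteristic $p$, define $$\mathcal{A}_{B/A,\,i}=\{D\in \mathrm{Diff}^{\,p^i}_A B:\ D(B^{p^j})\subseteq B^{p^j}\ \text{for all } 0\le j\le i\}.$$ It is a $B^{p^i}$-submodule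 of $\mathrm{Diff}^{\,p^i}_A B$. *)

theory Defs
  imports
    "HOL-Algebra.Algebraic_Closure_Type"
    "HOL-Algebra.Generated_Fields"
    "HOL-Library.Function_Algebras"
    "HOL-Library.Poly_Mapping"
begin

section \<open>Differential operators\<close>

definition linear_over :: "'a::comm_ring_1 set \<Rightarrow> ('a \<Rightarrow> 'a) \<Rightarrow> bool" where
  "linear_over A D \<longleftrightarrow>
     (\<forall>x y. D (x + y) = D x + D y) \<and> (\<forall>a\<in>A. \<forall>x. D (a * x) = a * D x)"

definition op_commutator :: "('a::comm_ring_1 \<Rightarrow> 'a) \<Rightarrow> 'a \<Rightarrow> 'a \<Rightarrow> 'a" where
  "op_commutator D b = (\<lambda>x. D (b * x) - b * D x)"

text \<open>The ambient ring is the whole type, the base ring is a subset \<open>A\<close> of it.\<close>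

definition diff_ops :: "'a::comm_ring_1 set \<Rightarrow> nat \<Rightarrow> ('a \<Rightarrow> 'a) set" where
  "diff_ops A n = {D. linear_over A D \<and>
     (\<forall>bs. length bs = Suc n \<longrightarrow> foldl op_commutator D bs = (\<lambda>x. 0))}"

definition frob_image :: "nat \<Rightarrow> 'a::comm_ring_1 set" where
  "frob_image j = range (\<lambda>x. x ^ (CHAR('a) ^ j))"

definition frob_diff_ops :: "'a::comm_ring_1 set \<Rightarrow> nat \<Rightarrow> ('a \<Rightarrow> 'a) set" where
  "frob_diff_ops A i =
     {D \<in> diff_ops A (CHAR('a) ^ i). \<forall>j\<le>i. D ` frob_image j \<subseteq> frob_image j}"

definition op_scale :: "'a::comm_ring_1 \<Rightarrow> ('a \<Rightarrow> 'a) \<Rightarrow> 'a \<Rightarrow> 'a" where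
  "op_scale b D = (\<lambda>x. b * D x)"

lemma vector_space_op_scale: "vector_space (op_scale :: 'a::field \<Rightarrow> _)"
  by unfold_locales (auto simp: op_scale_def fun_eq_iff algebra_simps)


section \<open>Tensor products of subspaces of a field\<close>

text \<open>
  For a list \<open>Ms\<close> of \<open>K\<close>-subspaces of a field, the tensor product over \<open>K\<close> is the free
  \<open>K\<close>-module on the tuples in the Cartesian product \<open>listset Ms\<close>, modulo the submodule
  generated by the relations expressing multilinearity.
\<close>

definition free_module :: "'a::field set \<Rightarrow> 'a list set \<Rightarrow> ('a list \<Rightarrow>\<^sub>0 'a) set" where
  "free_module K T = {f. Poly_Mapping.keys f \<subseteq> T \<and> range (Poly_Mapping.lookup f) \<subseteq> K}"

inductive_set tensor_relations :: "'a::field set \<Rightarrow> 'a set list \<Rightarrow> ('a list \<Rightarrow>\<^sub>0 'a) set"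
  for K :: "'a set" and Ms :: "'a set list" where
  slot_add: "\<lbrakk>ts \<in> listset Ms; i < length Ms; a \<in> Ms ! i; b \<in> Ms ! i\<rbrakk> \<Longrightarrow>
    Poly_Mapping.single (ts[i := a + b]) 1
      - Poly_Mapping.single (ts[i := a]) 1 - Poly_Mapping.single (ts[i := b]) 1
      \<in> tensor_relations K Ms"
| slot_scale: "\<lbrakk>ts \<in> listset Ms; i < length Ms; a \<in> Ms ! i; c \<in> K\<rbrakk> \<Longrightarrow>
    Poly_Mapping.single (ts[i := c * a]) 1 - Poly_Mapping.single (ts[i := a]) c
      \<in> tensor_relations K Ms"
| zero: "0 \<in> tensor_relations K Ms"
| add: "\<lbrakk>f \<in> tensor_relations K Ms; g \<in> tensor_relations K Ms\<rbrakk> \<Longrightarrow>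
    f + g \<in> tensor_relations K Ms"
| scale: "\<lbrakk>c \<in> K; f \<in> tensor_relations K Ms\<rbrakk> \<Longrightarrow>
    Poly_Mapping.map ((*) c) f \<in> tensor_relations K Ms"

definition tensor_product ::
    "'a::field set \<Rightarrow> 'a set list \<Rightarrow> ('a list \<Rightarrow>\<^sub>0 'a) set set" where
  "tensor_product K Ms = free_module K (listset Ms) //
     {(f, g). f \<in> free_module K (listset Ms) \<and> g \<in> free_module K (listset Ms) \<and>
              f - g \<in> tensor_relations K Ms}"

definition mult_eval :: "('a::field list \<Rightarrow>\<^sub>0 'a) \<Rightarrow> 'a" where
  "mult_eval f =
     (\<Sum>ts\<in>Poly_Mapping.keys f. Poly_Mapping.lookup f ts * prod_list ts)"

text \<open>
  The multiplication map, sending the class of a tuple to its product.  It is well defined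
  because \<open>mult_eval\<close> vanishes on the relations, see \<open>mult_eval_cong\<close> below.
\<close>

definition tensor_mult :: "('a::field list \<Rightarrow>\<^sub>0 'a) set \<Rightarrow> 'a" where
  "tensor_mult C = the_elem (mult_eval ` C)"

lemma mult_eval_superset:
  assumes "finite S" "Poly_Mapping.keys f \<subseteq> S"
  shows "mult_eval f = (\<Sum>ts\<in>S. Poly_Mapping.lookup f ts * prod_list ts)"
  unfolding mult_eval_def
  by (rule sum.mono_neutral_left) (use assms in \<open>auto simp: in_keys_iff\<close>)

lemma mult_eval_add: "mult_eval (f + g) = mult_eval f + mult_eval g"
proof -
  let ?S = "Poly_Mapping.keys f \<union> Poly_Mapping.keys g"
  have "Poly_Mapping.keys (f + g) \<subseteq> ?S" by (rule Poly_Mapping.keys_add)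
  then show ?thesis
    by (simp add: mult_eval_superset[of ?S] lookup_add sum.distrib distrib_right)
qed

lemma mult_eval_diff: "mult_eval (f - g) = mult_eval f - mult_eval g"
  using mult_eval_add[of "f - g" g] by simp

lemma mult_eval_single [simp]: "mult_eval (Poly_Mapping.single ts c) = c * prod_list ts"
  by (simp add: mult_eval_def)

lemma mult_eval_scale: "mult_eval (Poly_Mapping.map ((*) c) f) = c * mult_eval f"
proof -
  have "Poly_Mapping.keys (Poly_Mapping.map ((*) c) f) \<subseteq> Poly_Mapping.keys f"
    by (auto simp: in_keys_iff map.rep_eq when_def split: if_splits)
  then show ?thesis
    by (auto simp: mult_eval_superset[of "Poly_Mapping.keys f"] map.rep_eq when_def
        sum_distrib_left mult.assoc intro!: sum.cong)
qed

lemma length_listset: "ts \<in> listset Ms \<Longrightarrow> length ts = length Ms"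
  by (induction Ms arbitrary: ts) (auto simp: set_Cons_def)

lemma prod_list_update:
  fixes ts :: "'a::comm_monoid_mult list"
  assumes "i < length ts"
  shows "prod_list (ts[i := a]) = a * prod_list (take i ts @ drop (Suc i) ts)"
  using assms by (simp add: upd_conv_take_nth_drop mult.left_commute)

lemma mult_eval_relations: "f \<in> tensor_relations K Ms \<Longrightarrow> mult_eval f = 0"
proof (induction rule: tensor_relations.induct)
  case zero
  then show ?case by (simp add: mult_eval_def)
qed (simp_all add: mult_eval_add mult_eval_diff mult_eval_scale prod_list_update
      length_listset algebra_simps)

lemma mult_eval_cong: "f - g \<in> tensor_relations K Ms \<Longrightarrow> mult_eval f = mult_eval g"
  using mult_eval_relations[of "f - g"] by (simp add: mult_eval_diff)


section \<open>Purely inseparable and modular extensions\<close>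

text \<open>The extension field is the whole type, the base field is a subset \<open>K\<close> of it.\<close>

definition adjoin :: "'a::field set \<Rightarrow> 'a \<Rightarrow> 'a set" where
  "adjoin K x = generate_field ring_of_type_algebra (insert x K)"

text \<open>
  The multiplication map is always a homomorphism of \<open>K\<close>-algebras, so that it is an
  isomorphism precisely when it is bijective.
\<close>

definition modular :: "'a::field set \<Rightarrow> bool" where
  "modular K \<longleftrightarrow>
     (\<exists>xs. bij_betw tensor_mult (tensor_product K (map (adjoin K) xs)) UNIV)"

definition purely_inseparable :: "'a::field set \<Rightarrow> bool" where
  "purely_inseparable K \<longleftrightarrow> (\<forall>x. \<exists>n. x ^ (CHAR('a) ^ n) \<in> K)"

definition insep_exponent :: "'a::field set \<Rightarrow> nat" where
  "insep_exponent K = (LEAST e. frob_image e \<subseteq> K)"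

end

theory Submission
  imports Defs
begin

text \<open>
  Write \<open>p\<close> for the characteristic, \<open>F j = L ^ p ^ j\<close> and \<open>M j = K (F j)\<close>.

  If \<open>L\<close> is modular, the monomials \<open>x ^ \<beta>\<close> in the generators form a basis, and the diagonal operators
  \<open>x ^ \<beta> \<mapsto> binom(\<beta>, \<alpha>) x ^ \<beta>\<close> have order at most \<open>\<bar>\<alpha>\<bar>\<close> and preserve every \<open>F j\<close>. An operator of order
  at most \<open>n\<close> is determined by its values on monomials of degree at most \<open>n\<close>, which can be matched by
  a combination of diagonal operators.

  Conversely, only \<open>i = e - 1\<close> is needed. A derivation of \<open>M j\<close> over \<open>K\<close> extends to an operator of order
  at most \<open>p ^ j\<close> on \<open>L\<close>, so no element outside \<open>K\<close> is a constant of all operators of order at most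
  \<open>p ^ (e - 1)\<close>, and, by the spanning hypothesis, of all those preserving \<open>F 0, \<dots>, F (e - 1)\<close>.
  Applying these to a shortest relation shows that \<open>K\<close> and \<open>F i\<close> are linearly disjoint for \<open>i \<ge> 1\<close>.
  Now choose a \<open>p\<close>-basis of \<open>{y. y ^ p \<in> K}\<close> adapted to its filtration by the \<open>F j\<close>, with \<open>j\<close> decreasing,
  and write its members as \<open>x ^ p ^ j\<close>, where \<open>j\<close> is as large as possible; the elements \<open>x\<close> generate \<open>L\<close> as
  a tensor product of simple extensions.
\<close>

section \<open>Subrings and subfields\<close>

text \<open>The obstacle in the converse is to extend a derivation of \<open>M j\<close> to
  \<open>L\<close> without letting its order grow. Plain order is too coarse for an induction along
  \<open>M j\<close>, \<open>M (j - 1)\<close>, ..., \<open>L\<close>, so operators carry a weight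
  in which commuting with an element of \<open>M j\<close> costs \<open>p ^ j\<close>. When
  \<open>x\<close> in \<open>M j\<close> is adjoined and an operator is extended coordinatewise
  along \<open>1, ..., x ^ (p - 1)\<close>, commuting with \<open>x\<close> only sees the carry at
  \<open>x ^ p\<close>, which lies in \<open>M (j + 1)\<close>, and
  \<open>p ^ (j + 1) - (p - 1) * p ^ j = p ^ j\<close> keeps the balance. The chosen elements
  generate \<open>L\<close> because linear disjointness moves the coefficients of
  \<open>z ^ p\<close> into \<open>K\<close> and a Frobenius image at once; their
  \<open>p\<close>-th roots are covered by the adapted \<open>p\<close>-basis, so the root of
  \<open>z ^ p\<close> can be taken term by term. In the other direction the diagonal shape is
  essential: monomials are eigenvectors with eigenvalues in the prime field, which Frobenius fixes.
  For \<open>e \<le> 1\<close> the spanning condition is empty, in accordance with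
  \<open>F i \<subseteq> K\<close> for \<open>i \<ge> 1\<close>, which makes the linear disjointness
  automatic.\<close>

lemma type_algebra_ops:
  "carrier ring_of_type_algebra = UNIV"
  "x \<otimes>\<^bsub>ring_of_type_algebra\<^esub> y = x * y" "x \<oplus>\<^bsub>ring_of_type_algebra\<^esub> y = x + y"
  "\<zero>\<^bsub>ring_of_type_algebra\<^esub> = 0" "\<one>\<^bsub>ring_of_type_algebra\<^esub> = 1"
  by (simp_all add: ring_of_type_algebra_def)

lemma type_algebra_a_inv: "\<ominus>\<^bsub>ring_of_type_algebra\<^esub> x = - (x :: 'a::field)"
proof -
  interpret R: field "ring_of_type_algebra :: 'a ring" by (rule field_from_type_algebra)
  show ?thesis by (rule R.minus_equality) (simp_all add: type_algebra_ops)
qed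

lemma type_algebra_m_inv:
  assumes "x \<noteq> 0" shows "inv\<^bsub>ring_of_type_algebra\<^esub> x = inverse (x :: 'a::field)"
proof -
  interpret R: field "ring_of_type_algebra :: 'a ring" by (rule field_from_type_algebra)
  show ?thesis by (rule R.comm_inv_char) (use assms in \<open>simp_all add: type_algebra_ops\<close>)
qed

text \<open>Predicates on plain sets keep the record \<open>ring_of_type_algebra\<close> out of the
  calculations; closure under subtraction yields zero, negatives and sums.\<close>

definition subring_set :: "'a::field set \<Rightarrow> bool" where
  "subring_set N \<longleftrightarrow> 1 \<in> N \<and> (\<forall>x\<in>N. \<forall>y\<in>N. x - y \<in> N \<and> x * y \<in> N)"

text \<open>No element is excepted, since \<open>inverse 0 = 0\<close>.\<close>

definition subfield_set :: "'a::field set \<Rightarrow> bool" where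
  "subfield_set N \<longleftrightarrow> subring_set N \<and> (\<forall>x\<in>N. inverse x \<in> N)"

lemma subring_set_one: "subring_set N \<Longrightarrow> 1 \<in> N"
  and subring_set_diff: "subring_set N \<Longrightarrow> x \<in> N \<Longrightarrow> y \<in> N \<Longrightarrow> x - y \<in> N"
  and subring_set_mult: "subring_set N \<Longrightarrow> x \<in> N \<Longrightarrow> y \<in> N \<Longrightarrow> x * y \<in> N"
  by (auto simp: subring_set_def)

lemma subring_set_zero: "subring_set N \<Longrightarrow> 0 \<in> N"
  using subring_set_diff[of N 1 1] by (simp add: subring_set_one)

lemma subring_set_uminus: "subring_set N \<Longrightarrow> x \<in> N \<Longrightarrow> - x \<in> N"
  using subring_set_diff[of N 0 x] by (simp add: subring_set_zero)

lemma subring_set_add: "subring_set N \<Longrightarrow> x \<in> N \<Longrightarrow> y \<in> N \<Longrightarrow> x + y \<in> N"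
  using subring_set_diff[of N x "- y"] by (simp add: subring_set_uminus)

lemma subring_set_power: "subring_set N \<Longrightarrow> x \<in> N \<Longrightarrow> x ^ n \<in> N"
  by (induction n) (auto simp: subring_set_one subring_set_mult)

lemma subring_set_sum: "subring_set N \<Longrightarrow> (\<And>i. i \<in> I \<Longrightarrow> f i \<in> N) \<Longrightarrow> sum f I \<in> N"
  by (induction I rule: infinite_finite_induct) (auto simp: subring_set_zero subring_set_add)

lemma subring_set_of_nat: "subring_set N \<Longrightarrow> of_nat n \<in> N"
  by (induction n) (auto simp: subring_set_zero subring_set_one subring_set_add)

lemmas subring_set_closed = subring_set_zero subring_set_one subring_set_diff subring_set_mult
  subring_set_uminus subring_set_add subring_set_power subring_set_sum subring_set_of_nat

lemma subfield_set_subring: "subfield_set N \<Longrightarrow> subring_set N"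
  by (simp add: subfield_set_def)

lemma subfield_set_inverse: "subfield_set N \<Longrightarrow> x \<in> N \<Longrightarrow> inverse x \<in> N"
  by (simp add: subfield_set_def)

lemma subfield_set_divide: "subfield_set N \<Longrightarrow> x \<in> N \<Longrightarrow> y \<in> N \<Longrightarrow> x / y \<in> N"
  by (simp add: divide_inverse subfield_set_inverse subfield_set_subring subring_set_mult)

lemma subfield_set_Int: "subfield_set N \<Longrightarrow> subfield_set M \<Longrightarrow> subfield_set (N \<inter> M)"
  by (auto simp: subfield_set_def subring_set_def)

lemma subfield_set_mult_cancel:
  assumes "subfield_set N" "x * y \<in> N" "y \<in> N" "y \<noteq> 0"
  shows "x \<in> N"
  using subfield_set_divide[OF assms(1-3)] assms(4) by simp

text \<open>Inverses are left out: in a purely inseparable extension of a field the generated ring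
  is already a field (\<open>subfield_set_ring_adjoin\<close>), and inductions have only four
  cases.\<close>

inductive_set ring_adjoin :: "'a::field set \<Rightarrow> 'a set \<Rightarrow> 'a set"
  for K :: "'a set" and H :: "'a set" where
  base: "c \<in> K \<Longrightarrow> c \<in> ring_adjoin K H"
| incl: "x \<in> H \<Longrightarrow> x \<in> ring_adjoin K H"
| add: "x \<in> ring_adjoin K H \<Longrightarrow> y \<in> ring_adjoin K H \<Longrightarrow> x + y \<in> ring_adjoin K H"
| mult: "x \<in> ring_adjoin K H \<Longrightarrow> y \<in> ring_adjoin K H \<Longrightarrow> x * y \<in> ring_adjoin K H"

lemma subring_set_ring_adjoin:
  assumes "subring_set K" shows "subring_set (ring_adjoin K H)"
proof -
  have "-1 \<in> ring_adjoin K H"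
    by (intro ring_adjoin.base subring_set_closed assms)
  then have "x + (-1) * y \<in> ring_adjoin K H" if "x \<in> ring_adjoin K H" "y \<in> ring_adjoin K H" for x y
    using that by (intro ring_adjoin.add ring_adjoin.mult)
  then show ?thesis
    using assms by (auto simp: subring_set_def intro: ring_adjoin.intros)
qed

lemma ring_adjoin_subset:
  assumes "subring_set N" "K \<subseteq> N" "H \<subseteq> N" shows "ring_adjoin K H \<subseteq> N"
proof
  fix x assume "x \<in> ring_adjoin K H"
  then show "x \<in> N"
    by induction (use assms in \<open>auto intro: subring_set_closed\<close>)
qed

lemma ring_adjoin_mono: "H \<subseteq> Y \<Longrightarrow> ring_adjoin K H \<subseteq> ring_adjoin K Y"
proof
  fix x assume "x \<in> ring_adjoin K H" "H \<subseteq> Y"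
  then show "x \<in> ring_adjoin K Y"
    by induction (auto intro: ring_adjoin.intros)
qed

lemma ring_adjoin_insert:
  assumes "subring_set K"
  shows "ring_adjoin K (insert x H) = ring_adjoin (ring_adjoin K H) {x}"
proof
  have s: "subring_set (ring_adjoin K Y)" for Y
    using assms by (rule subring_set_ring_adjoin)
  show "ring_adjoin K (insert x H) \<subseteq> ring_adjoin (ring_adjoin K H) {x}"
    by (rule ring_adjoin_subset)
      (use s in \<open>auto intro: ring_adjoin.intros subring_set_ring_adjoin\<close>)
  show "ring_adjoin (ring_adjoin K H) {x} \<subseteq> ring_adjoin K (insert x H)"
    by (rule ring_adjoin_subset)
      (use s ring_adjoin_mono[of H "insert x H" K] in \<open>auto intro: ring_adjoin.intros\<close>)
qed

text \<open>The sums on the right contain \<open>1\<close> and are closed under multiplication by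
  \<open>T\<close> and by \<open>x\<close>, the latter because the top term is carried back through
  \<open>x ^ q \<in> T\<close>.\<close>

lemma ring_adjoin_simple:
  assumes T: "subring_set T" and xq: "x ^ q \<in> T" and q: "q > 0"
  shows "ring_adjoin T {x} = {\<Sum>a<q. c a * x ^ a | c. range c \<subseteq> T}" (is "_ = ?S")
proof
  have add: "u + v \<in> ?S" if uS: "u \<in> ?S" and vS: "v \<in> ?S" for u v
  proof -
    obtain c where "u = (\<Sum>a<q. c a * x ^ a)" "range c \<subseteq> T"
      using uS by auto
    moreover obtain d where "v = (\<Sum>a<q. d a * x ^ a)" "range d \<subseteq> T"
      using vS by auto
    ultimately have "u + v = (\<Sum>a<q. (c a + d a) * x ^ a)" "range (\<lambda>a. c a + d a) \<subseteq> T"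
      using T by (auto simp: sum.distrib algebra_simps intro!: subring_set_add)
    then show ?thesis by (intro CollectI exI[of _ "\<lambda>a. c a + d a"]) auto
  qed
  have scale: "t * u \<in> ?S" if tT: "t \<in> T" and uS: "u \<in> ?S" for t u
  proof -
    obtain c where "u = (\<Sum>a<q. c a * x ^ a)" "range c \<subseteq> T"
      using uS by auto
    then have "t * u = (\<Sum>a<q. (t * c a) * x ^ a)" "range (\<lambda>a. t * c a) \<subseteq> T"
      using T tT by (auto simp: sum_distrib_left algebra_simps intro!: subring_set_mult)
    then show ?thesis by (intro CollectI exI[of _ "\<lambda>a. t * c a"]) auto
  qed
  have shift: "x * u \<in> ?S" if uS: "u \<in> ?S" for u
  proof -
    obtain c where c: "u = (\<Sum>a<q. c a * x ^ a)" "range c \<subseteq> T"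
      using uS by auto
    obtain r where r: "q = Suc r" using q by (cases q) auto
    let ?d = "\<lambda>a. if a = 0 then c r * x ^ q else c (a - 1)"
    have "x * u = (\<Sum>a<r. c a * x ^ Suc a) + c r * x ^ q"
      unfolding c(1) r by (simp add: sum_distrib_left algebra_simps)
    also have "\<dots> = (\<Sum>a<q. ?d a * x ^ a)"
      unfolding r sum.lessThan_Suc_shift by simp
    finally show ?thesis
      using c(2) xq T by (intro CollectI exI[of _ ?d]) (auto intro!: subring_set_mult)
  qed
  have one: "1 \<in> ?S"
  proof (intro CollectI exI[of _ "\<lambda>a. if a = 0 then 1 else 0"] conjI)
    show "1 = (\<Sum>a<q. (if a = 0 then 1 else 0) * x ^ a)"
      using q by (subst sum.remove[of _ 0]) auto
  qed (use T in \<open>auto simp: subring_set_zero subring_set_one\<close>)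
  have zero: "0 \<in> ?S" using scale[OF _ one, of 0] T by (simp add: subring_set_zero)
  have sum: "sum f I \<in> ?S" if "\<And>i. i \<in> I \<Longrightarrow> f i \<in> ?S" for f :: "nat \<Rightarrow> 'a" and I
    using that zero add by (induction I rule: infinite_finite_induct) simp_all
  have pow: "x ^ n * u \<in> ?S" if "u \<in> ?S" for n u
    using that by (induction n) (simp_all only: power_0 mult_1 power_Suc mult.assoc shift)
  have mult: "v * u \<in> ?S" if u: "u \<in> ?S" and v: "v \<in> ?S" for u v
  proof -
    obtain c where c: "v = (\<Sum>a<q. c a * x ^ a)" "range c \<subseteq> T"
      using v by auto
    have "v * u = (\<Sum>a<q. c a * (x ^ a * u))"
      unfolding c(1) by (simp add: sum_distrib_right mult.assoc)
    moreover have "\<dots> \<in> ?S"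
      using c(2) by (intro sum scale pow u) auto
    ultimately show ?thesis by (simp only:)
  qed
  show "ring_adjoin T {x} \<subseteq> ?S"
  proof
    fix y assume "y \<in> ring_adjoin T {x}"
    then show "y \<in> ?S"
    proof induction
      case (base c) then show ?case using scale[OF _ one, of c] by simp
    next
      case (incl y) then show ?case using shift[OF one] by simp
    next
      case add then show ?case using \<open>\<And>u v. u \<in> ?S \<Longrightarrow> v \<in> ?S \<Longrightarrow> u + v \<in> ?S\<close> by blast
    next
      case mult then show ?case using \<open>\<And>u v. u \<in> ?S \<Longrightarrow> v \<in> ?S \<Longrightarrow> v * u \<in> ?S\<close> by blast
    qed
  qed
  show "?S \<subseteq> ring_adjoin T {x}"
    using subring_set_ring_adjoin[OF T, of "{x}"]
    by (auto intro!: subring_set_sum subring_set_mult subring_set_power intro: ring_adjoin.intros)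
qed


section \<open>Purely inseparable extensions\<close>

text \<open>\<open>inverse y\<close> is \<open>y ^ (p ^ n - 1)\<close> divided by
  \<open>y ^ (p ^ n)\<close>, and the divisor lies in \<open>K\<close>.\<close>

lemma subfield_set_intermediate:
  fixes K :: "'a::field set"
  assumes "subfield_set K" "purely_inseparable K" "CHAR('a) > 0" "subring_set N" "K \<subseteq> N"
  shows "subfield_set N"
proof -
  have "inverse y \<in> N" if y: "y \<in> N" for y
  proof (cases "y = 0")
    case False
    obtain n where n: "y ^ (CHAR('a) ^ n) \<in> K"
      using assms(2) by (auto simp: purely_inseparable_def)
    define m where "m = CHAR('a) ^ n - 1"
    have m: "CHAR('a) ^ n = Suc m" using assms(3) by (simp add: m_def)
    have "inverse y = y ^ m * inverse (y ^ Suc m)" using False by (simp add: field_simps)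
    also have "\<dots> \<in> N"
      using n assms(1,5) unfolding m
      by (intro subring_set_mult subring_set_power assms(4) y) (use subfield_set_inverse in blast)
    finally show ?thesis .
  qed (use y in simp)
  then show ?thesis using assms by (simp add: subfield_set_def)
qed

lemma subfield_set_ring_adjoin:
  fixes K :: "'a::field set"
  assumes "subfield_set K" "purely_inseparable K" "CHAR('a) > 0"
  shows "subfield_set (ring_adjoin K H)"
  by (rule subfield_set_intermediate[OF assms])
    (use assms in \<open>auto intro: ring_adjoin.base subring_set_ring_adjoin subfield_set_subring\<close>)

lemma frobenius_add:
  fixes x y :: "'a::field"
  assumes "CHAR('a) > 0" shows "(x + y) ^ (CHAR('a) ^ n) = x ^ (CHAR('a) ^ n) + y ^ (CHAR('a) ^ n)"
  by (rule freshmans_dream') (use assms prime_CHAR_semidom in auto)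

lemma frobenius_diff:
  fixes x y :: "'a::field"
  assumes "CHAR('a) > 0" shows "(x - y) ^ (CHAR('a) ^ n) = x ^ (CHAR('a) ^ n) - y ^ (CHAR('a) ^ n)"
  using frobenius_add[OF assms, of "x - y" y n] by simp

lemma frobenius_sum:
  fixes f :: "'b \<Rightarrow> 'a::field"
  assumes "CHAR('a) > 0" shows "(\<Sum>i\<in>I. f i) ^ (CHAR('a) ^ n) = (\<Sum>i\<in>I. f i ^ (CHAR('a) ^ n))"
  by (rule freshmans_dream_sum') (use assms prime_CHAR_semidom in auto)

lemma frobenius_inj:
  fixes x y :: "'a::field"
  assumes "CHAR('a) > 0" "x ^ (CHAR('a) ^ n) = y ^ (CHAR('a) ^ n)"
  shows "x = y"
  using frobenius_diff[OF assms(1), of x y n] assms by simp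

lemma frobenius_of_nat:
  assumes "CHAR('a::field) > 0"
  shows "(of_nat m :: 'a) ^ (CHAR('a) ^ n) = of_nat m"
proof (induction m)
  case (Suc m)
  then show ?case by (simp add: frobenius_add[OF assms])
qed (use assms in simp)

lemma subfield_set_frob_image:
  assumes "CHAR('a::field) > 0" shows "subfield_set (frob_image j :: 'a set)"
proof -
  let ?F = "frob_image j :: 'a set"
  have F: "u ^ (CHAR('a) ^ j) \<in> ?F" for u by (auto simp: frob_image_def)
  have "x - y \<in> ?F" "x * y \<in> ?F" "inverse x \<in> ?F" if xy: "x \<in> ?F" "y \<in> ?F" for x y
  proof -
    obtain u v where uv: "x = u ^ (CHAR('a) ^ j)" "y = v ^ (CHAR('a) ^ j)"
      using xy by (auto simp: frob_image_def)
    show "x - y \<in> ?F" "x * y \<in> ?F" "inverse x \<in> ?F"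
      using F[of "u - v"] F[of "u * v"] F[of "inverse u"]
      by (simp_all add: uv frobenius_diff[OF assms] power_mult_distrib power_inverse)
  qed
  moreover have "1 \<in> ?F" using F[of 1] by simp
  ultimately show ?thesis by (simp add: subfield_set_def subring_set_def)
qed

lemma frob_image_0 [simp]: "frob_image 0 = UNIV"
  by (simp add: frob_image_def)

lemma frob_image_antimono: "i \<le> j \<Longrightarrow> (frob_image j :: 'a::field set) \<subseteq> frob_image i"
proof -
  assume "i \<le> j"
  then have "CHAR('a) ^ j = CHAR('a) ^ (j - i) * CHAR('a) ^ i" by (simp add: power_add[symmetric])
  then show ?thesis by (auto simp: frob_image_def power_mult)
qed

lemma power_in_frob_image:
  fixes x :: "'a::field"
  assumes "x \<in> frob_image j" shows "x ^ (CHAR('a) ^ i) \<in> frob_image (i + j)"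
  using assms by (auto simp: frob_image_def power_add power_mult mult.commute simp flip: power_mult)

text \<open>If \<open>g * u = (X - x) ^ (n + 1)\<close>, then \<open>g\<close> or \<open>u\<close>
  vanishes at \<open>x\<close>, and a factor \<open>X - x\<close> is cancelled from that
  one.\<close>

lemma dvd_linear_power:
  fixes x :: "'a::field"
  assumes "g dvd [:- x, 1:] ^ n"
  shows "\<exists>c k. g = smult c ([:- x, 1:] ^ k)"
  using assms
proof (induction n arbitrary: g)
  case 0
  then obtain c where "g = [:c:]" by (auto simp: is_unit_poly_iff)
  then have "g = smult c ([:- x, 1:] ^ 0)" by simp
  then show ?case by blast
next
  case (Suc n)
  then obtain u where u: "[:- x, 1:] * [:- x, 1:] ^ n = g * u"
    unfolding dvd_def power_Suc by blast
  then have "poly (g * u) x = 0" by (metis dvd_triv_left poly_eq_0_iff_dvd)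
  then have "poly g x = 0 \<or> poly u x = 0" by simp
  then show ?case
  proof
    assume "poly g x = 0"
    then obtain g' where g': "g = [:- x, 1:] * g'" unfolding poly_eq_0_iff_dvd dvd_def by blast
    then have "[:- x, 1:] * [:- x, 1:] ^ n = [:- x, 1:] * (g' * u)" using u by (simp only: mult.assoc)
    then have "[:- x, 1:] ^ n = g' * u"
      by (metis mult_left_cancel pCons_eq_0_iff zero_neq_one)
    then obtain c k where "g' = smult c ([:- x, 1:] ^ k)" using Suc.IH[of g'] by auto
    then have "g = smult c ([:- x, 1:] ^ Suc k)" using g' by simp
    then show ?case by blast
  next
    assume "poly u x = 0"
    then obtain u' where u': "u = [:- x, 1:] * u'" unfolding poly_eq_0_iff_dvd dvd_def by blast
    then have "[:- x, 1:] * [:- x, 1:] ^ n = [:- x, 1:] * (g * u')" using u by (simp only: mult_ac)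
    then have "[:- x, 1:] ^ n = g * u'"
      by (metis mult_left_cancel pCons_eq_0_iff zero_neq_one)
    then show ?case using Suc.IH[of g] by auto
  qed
qed

text \<open>
  A monic polynomial of minimal degree \<open>m\<close> over \<open>N\<close> with root \<open>x\<close> divides \<open>(X - x) ^ p ^ Suc f\<close>,
  hence equals \<open>(X - x) ^ m\<close>, so that \<open>x ^ m\<close> and then \<open>x ^ gcd m (p ^ Suc f)\<close> lie in \<open>N\<close>.
\<close>

lemma powers_independent:
  fixes x :: "'a::field"
  assumes N: "subfield_set N" and char: "CHAR('a) > 0"
    and notin: "x ^ (CHAR('a) ^ f) \<notin> N" and "x ^ (CHAR('a) ^ Suc f) \<in> N"
    and c: "\<And>a. a < CHAR('a) ^ Suc f \<Longrightarrow> c a \<in> N"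
    and zero: "(\<Sum>a<CHAR('a) ^ Suc f. c a * x ^ a) = 0"
    and a: "a < CHAR('a) ^ Suc f"
  shows "c a = 0"
proof (rule ccontr)
  assume "c a \<noteq> 0"
  define q where "q = CHAR('a) ^ Suc f"
  have prime: "prime CHAR('a)" using char by (rule prime_CHAR_semidom)
  define P where "P = {h. (\<forall>i. poly.coeff h i \<in> N) \<and> poly h x = 0}"
  note R = subfield_set_subring[OF N]
  define h where "h = (\<Sum>a<q. Polynomial.monom (c a) a)"
  have ch: "poly.coeff h i = (if i < q then c i else 0)" for i
    by (simp add: h_def coeff_sum)
  have "h \<in> P"
    using c zero by (auto simp: P_def ch q_def subring_set_zero[OF R]) (simp add: h_def poly_sum poly_monom q_def)
  moreover have "h \<noteq> 0" using ch[of a] a \<open>c a \<noteq> 0\<close> by (auto simp: q_def)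
  moreover have "degree h < q"
    by (rule degree_lessI) (use \<open>h \<noteq> 0\<close> ch in auto)
  ultimately have ex: "\<exists>m. \<exists>g\<in>P. g \<noteq> 0 \<and> degree g = m" and exq: "\<exists>g\<in>P. g \<noteq> 0 \<and> degree g < q"
    by auto
  define m where "m = (LEAST m. \<exists>g\<in>P. g \<noteq> 0 \<and> degree g = m)"
  obtain g0 where g0: "g0 \<in> P" "g0 \<noteq> 0" "degree g0 = m"
    using LeastI_ex[OF ex] unfolding m_def by blast
  have min: "m \<le> degree g" if "g \<in> P" "g \<noteq> 0" for g
    unfolding m_def by (rule Least_le) (use that in blast)
  have mq: "m < q" using exq min by (meson le_less_trans)
  define g where "g = smult (inverse (lead_coeff g0)) g0"
  have g: "g \<in> P" "degree g = m" "lead_coeff g = 1"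
    using g0 N by (auto simp: P_def g_def intro!: subring_set_mult[OF R] subfield_set_inverse[OF N])
  \<comment> \<open>Long division by hand, since \<open>N\<close> is a set and not a type:
    \<open>g\<close> is monic, so cancelling the leading term keeps the coefficients in
    \<open>N\<close>.\<close>
  have dvd: "g dvd u" if "u \<in> P" for u
    using that
  proof (induction "degree u" arbitrary: u rule: less_induct)
    case less
    show ?case
    proof (cases "u = 0")
      case False
      then have "m \<le> degree u" using less min by blast
      define v where "v = u - Polynomial.monom (lead_coeff u) (degree u - m) * g"
      have cg: "poly.coeff g i \<in> N" and cu: "poly.coeff u i \<in> N" for i using g less by (auto simp: P_def)
      have "v \<in> P"
        using g less by (auto simp: P_def v_def coeff_monom_mult intro!: subring_set_closed[OF R])
      show ?thesis
      proof (cases "v = 0")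
        case True
        then show ?thesis by (metis v_def dvd_triv_right eq_iff_diff_eq_0)
      next
        case v: False
        have "poly.coeff v i = 0" if "i \<ge> degree u" for i
        proof (cases "i = degree u")
          case True
          then show ?thesis using g \<open>m \<le> degree u\<close> by (simp add: v_def coeff_monom_mult)
        next
          case False
          then have "i > degree u" using that by simp
          then have "poly.coeff u i = 0" "poly.coeff g (i - (degree u - m)) = 0"
            using g \<open>m \<le> degree u\<close> by (auto intro!: coeff_eq_0)
          then show ?thesis using \<open>i > degree u\<close> by (simp add: v_def coeff_monom_mult)
        qed
        then have "degree v < degree u" using v by (intro degree_lessI) auto
        then have "g dvd v" using less \<open>v \<in> P\<close> by blast
        moreover have "u = v + Polynomial.monom (lead_coeff u) (degree u - m) * g" by (simp add: v_def)
        ultimately show ?thesis by (metis dvd_add dvd_triv_right)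
      qed
    qed simp
  qed
  have "Polynomial.monom 1 q - [:x ^ q:] \<in> P"
    using assms(4) by (auto simp: P_def q_def poly_monom coeff_pCons subring_set_closed[OF R] split: nat.splits)
  then have "g dvd Polynomial.monom 1 q - [:x ^ q:]" by (rule dvd)
  also have "Polynomial.monom 1 q - [:x ^ q:] = [:- x, 1:] ^ q"
  proof -
    have "([:- x, 1:] + [:x:]) ^ q = [:- x, 1:] ^ q + [:x:] ^ q"
      unfolding q_def by (rule freshmans_dream'[of _ "Suc f"]) (simp_all add: prime)
    moreover have "[:- x, 1:] + [:x:] = [:0, 1:]" by simp
    ultimately show ?thesis
      by (simp add: monom_altdef poly_const_pow algebra_simps)
  qed
  finally have "g dvd [:- x, 1:] ^ q" .
  then obtain d k where "g = smult d ([:- x, 1:] ^ k)"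
    using dvd_linear_power by blast
  moreover have "lead_coeff ([:- x, 1:] ^ k) = 1" by (subst lead_coeff_power) simp
  ultimately have "d = 1" using g(3) by (simp only: lead_coeff_smult mult_1_right)
  then have gk: "g = [:- x, 1:] ^ k" using \<open>g = smult d _\<close> by simp
  then have "k = m" using g(2) by (simp add: degree_linear_power)
  then have "poly.coeff g 0 = (- x) ^ m"
    by (simp add: gk coeff_0_power)
  moreover have "poly.coeff g 0 \<in> N" using g by (auto simp: P_def)
  ultimately have "(- x) ^ m \<in> N" by simp
  then have "(-1) ^ m * (- x) ^ m \<in> N"
    by (rule subring_set_mult[OF R subring_set_power[OF R subring_set_uminus[OF R subring_set_one[OF R]]]])
  then have xm: "x ^ m \<in> N" by (simp add: power_mult_distrib[symmetric])
  have "m > 0" using g by (cases "m = 0") (auto simp: P_def elim!: degree_eq_zeroE)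
  have x0: "x \<noteq> 0" using notin char subring_set_zero[OF R] by (auto simp: power_0_left)
  obtain u v where uv: "m * u = q * v + gcd m q"
    using bezout_nat[of m q] \<open>m > 0\<close> by auto
  have "x ^ gcd m q * (x ^ q) ^ v \<in> N"
    using subring_set_power[OF R xm, of u] uv by (metis add.commute power_add power_mult)
  then have "x ^ gcd m q \<in> N"
  proof (rule subfield_set_mult_cancel[OF N])
    show "(x ^ q) ^ v \<in> N"
      using assms(4) unfolding q_def by (rule subring_set_power[OF R])
  qed (use x0 in simp)
  moreover obtain i where i: "gcd m q = CHAR('a) ^ i" "i \<le> Suc f"
    using divides_primepow_nat[OF prime, of "gcd m q" "Suc f"] by (auto simp: q_def)
  \<comment> \<open>The gcd is a proper divisor of \<open>q\<close>, because
    \<open>0 < m < q\<close>.\<close>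
  moreover have "i \<le> f"
  proof (rule ccontr)
    assume "\<not> i \<le> f"
    then have "gcd m q = q" using i by (simp add: q_def le_Suc_eq)
    then have "q dvd m" by (metis gcd_dvd1)
    then show False using mq \<open>m > 0\<close> by (auto dest: dvd_imp_le)
  qed
  ultimately have "(x ^ (CHAR('a) ^ i)) ^ (CHAR('a) ^ (f - i)) \<in> N"
    by (metis subring_set_power[OF R])
  then show False
    using notin \<open>i \<le> f\<close> by (simp add: power_mult[symmetric] power_add[symmetric])
qed

section \<open>Operators of bounded order\<close>

text \<open>Shifted by one against the order: \<open>order_less (Suc n)\<close> means order at most
  \<open>n\<close>, so that the recursion starts at the zero operator.\<close>

fun order_less :: "nat \<Rightarrow> ('a::comm_ring_1 \<Rightarrow> 'a) \<Rightarrow> bool" where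
  "order_less 0 D \<longleftrightarrow> (\<forall>x. D x = 0)"
| "order_less (Suc n) D \<longleftrightarrow> (\<forall>b. order_less n (op_commutator D b))"

lemma order_less_iff_foldl:
  "order_less n D \<longleftrightarrow> (\<forall>bs. length bs = n \<longrightarrow> foldl op_commutator D bs = (\<lambda>x. 0))"
proof (induction n arbitrary: D)
  case 0
  show ?case by (auto simp: fun_eq_iff)
next
  case (Suc n)
  show ?case by (simp add: Suc.IH) (metis length_Suc_conv foldl_Cons)
qed

lemma diff_ops_iff: "D \<in> diff_ops A n \<longleftrightarrow> linear_over A D \<and> order_less (Suc n) D"
  by (simp only: diff_ops_def order_less_iff_foldl mem_Collect_eq)

lemma order_less_zero: "order_less n (\<lambda>x. 0)"
  by (induction n) (simp_all add: op_commutator_def)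

lemma order_less_mono: "order_less m D \<Longrightarrow> m \<le> n \<Longrightarrow> order_less n D"
proof (induction m arbitrary: D n)
  case 0
  then have "D = (\<lambda>x. 0)" by auto
  then show ?case by (simp add: order_less_zero)
next
  case (Suc m)
  then show ?case by (cases n) auto
qed

lemma order_less_add: "order_less n D \<Longrightarrow> order_less n E \<Longrightarrow> order_less n (\<lambda>x. D x + E x)"
proof (induction n arbitrary: D E)
  case (Suc n)
  have "op_commutator (\<lambda>x. D x + E x) b = (\<lambda>x. op_commutator D b x + op_commutator E b x)" for b
    by (simp add: op_commutator_def algebra_simps)
  then show ?case using Suc by simp
qed simp

lemma order_less_scale: "order_less n D \<Longrightarrow> order_less n (\<lambda>x. c * D x)"
proof (induction n arbitrary: D)
  case (Suc n)
  have "op_commutator (\<lambda>x. c * D x) b = (\<lambda>x. c * op_commutator D b x)" for b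
    by (simp add: op_commutator_def algebra_simps)
  then show ?case using Suc by simp
qed simp

lemma order_less_comp_mult: "order_less n D \<Longrightarrow> order_less n (\<lambda>x. D (c * x))"
proof (induction n arbitrary: D)
  case (Suc n)
  have "op_commutator (\<lambda>x. D (c * x)) b = (\<lambda>x. op_commutator D b (c * x))" for b
    by (simp add: op_commutator_def mult.left_commute)
  then show ?case using Suc by simp
qed simp

text \<open>\<open>[D, b]\<close> vanishes for \<open>b \<in> K\<close>, is additive in
  \<open>b\<close>, and satisfies \<open>[D, x y] = [D, x] y + x [D, y]\<close>; so a bound on
  generators spreads to the generated ring.\<close>

lemma order_less_gen:
  assumes D: "linear_over K D" and gen: "\<And>x. x \<in> S \<Longrightarrow> order_less n (op_commutator D x)"
    and b: "b \<in> ring_adjoin K S"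
  shows "order_less n (op_commutator D b)"
  using b
proof induction
  case (base c)
  then have "op_commutator D c = (\<lambda>x. 0)" using D by (simp add: linear_over_def op_commutator_def)
  then show ?case by (simp add: order_less_zero)
next
  case (incl x)
  then show ?case by (rule gen)
next
  case (add x y)
  have "op_commutator D (x + y) = (\<lambda>z. op_commutator D x z + op_commutator D y z)"
    using D by (simp add: op_commutator_def linear_over_def algebra_simps)
  then show ?case using add by (simp add: order_less_add)
next
  case (mult x y)
  have "op_commutator D (x * y) = (\<lambda>z. op_commutator D x (y * z) + x * op_commutator D y z)"
    by (simp add: op_commutator_def algebra_simps)
  then show ?case
    using order_less_add[OF order_less_comp_mult[OF mult.IH(1)] order_less_scale[OF mult.IH(2)]]
    by simp
qed

lemma linear_over_add: "linear_over A D \<Longrightarrow> D (x + y) = D x + D y"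
  and linear_over_scale: "linear_over A D \<Longrightarrow> a \<in> A \<Longrightarrow> D (a * x) = a * D x"
  by (auto simp: linear_over_def)

lemma linear_over_zero: "linear_over A D \<Longrightarrow> D 0 = 0"
  using linear_over_add[of A D 0 0] by simp

lemma linear_over_sum: "linear_over A D \<Longrightarrow> D (sum f I) = (\<Sum>i\<in>I. D (f i))"
  by (induction I rule: infinite_finite_induct) (auto simp: linear_over_zero linear_over_add)

interpretation op: vector_space "op_scale :: 'a::field \<Rightarrow> ('a \<Rightarrow> 'a) \<Rightarrow> 'a \<Rightarrow> 'a"
  by (rule vector_space_op_scale)

lemma subspace_diff_ops: "op.subspace (diff_ops A n :: ('a::field \<Rightarrow> 'a) set)"
proof (rule op.subspaceI)
  show "0 \<in> diff_ops A n"
    using order_less_zero[of "Suc n"] by (simp add: diff_ops_iff linear_over_def zero_fun_def)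
  show "D + E \<in> diff_ops A n" if "D \<in> diff_ops A n" "E \<in> diff_ops A n" for D E
    using that order_less_add[of "Suc n" D E]
    by (simp add: diff_ops_iff linear_over_def plus_fun_def algebra_simps del: order_less.simps)
  show "op_scale c D \<in> diff_ops A n" if "D \<in> diff_ops A n" for c D
    using that order_less_scale[of "Suc n" D c]
    by (simp add: diff_ops_iff linear_over_def op_scale_def algebra_simps del: order_less.simps)
qed

lemma span_frob_diff_ops_subset:
  "op.span (frob_diff_ops A i) \<subseteq> (diff_ops A (CHAR('a::field) ^ i) :: ('a \<Rightarrow> 'a) set)"
  by (rule op.span_minimal) (auto simp: frob_diff_ops_def subspace_diff_ops)

section \<open>Extending operators along a tower\<close>

text \<open>
  Operators \<open>N \<rightarrow> L\<close>, where commutation with an element of \<open>M j\<close> lowers the order by \<open>p ^ j\<close>; below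
  \<open>M j\<close> is the compositum of \<open>K\<close> and \<open>L ^ p ^ j\<close>.
\<close>

inductive weighted_less :: "(nat \<Rightarrow> 'a::field set) \<Rightarrow> 'a set \<Rightarrow> nat \<Rightarrow> ('a \<Rightarrow> 'a) \<Rightarrow> bool"
  for M :: "nat \<Rightarrow> 'a set" and N :: "'a set" where
  zero: "(\<And>x. x \<in> N \<Longrightarrow> D x = 0) \<Longrightarrow> weighted_less M N s D"
| step: "0 < s \<Longrightarrow>
    (\<And>j b. b \<in> N \<Longrightarrow> b \<in> M j \<Longrightarrow> weighted_less M N (s - CHAR('a) ^ j) (op_commutator D b)) \<Longrightarrow>
    weighted_less M N s D"

text \<open>Subtraction on \<open>nat\<close> stops at \<open>0\<close>, so a commutator that costs
  at least the whole weight has to vanish; the condition \<open>0 < s\<close> in \<open>step\<close>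
  secures this.\<close>

lemma weighted_less_0D: "weighted_less M N 0 D \<Longrightarrow> x \<in> N \<Longrightarrow> D x = 0"
  by (erule weighted_less.cases) auto

lemma weighted_less_cong:
  "weighted_less M N s D \<Longrightarrow> subring_set N \<Longrightarrow> (\<And>x. x \<in> N \<Longrightarrow> D x = E x) \<Longrightarrow> weighted_less M N s E"
proof (induction arbitrary: E rule: weighted_less.induct)
  case (zero D s)
  then show ?case by (auto intro!: weighted_less.zero)
next
  case (step s D)
  show ?case
  proof (rule weighted_less.step)
    fix j b assume "b \<in> N" "b \<in> M j"
    then show "weighted_less M N (s - CHAR('a) ^ j) (op_commutator E b)"
      using step.prems by (intro step.IH) (auto simp: op_commutator_def subring_set_mult)
  qed (rule step)
qed

lemma weighted_less_mono: "weighted_less M N s D \<Longrightarrow> s \<le> t \<Longrightarrow> weighted_less M N t D"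
proof (induction arbitrary: t rule: weighted_less.induct)
  case (step s D)
  show ?case
    by (rule weighted_less.step) (use step in \<open>auto simp: diff_le_mono\<close>)
qed (auto intro: weighted_less.zero)

lemma weighted_less_commutator:
  assumes "weighted_less M N s (D :: 'a::field \<Rightarrow> 'a)" "subring_set N" "b \<in> N" "b \<in> M j"
  shows "weighted_less M N (s - CHAR('a) ^ j) (op_commutator D b)"
  using assms(1)
proof cases
  case zero
  then show ?thesis
    using assms by (auto intro!: weighted_less.zero simp: op_commutator_def subring_set_mult)
next
  case step
  then show ?thesis using assms by blast
qed

lemma weighted_less_add:
  "weighted_less M N s D \<Longrightarrow> subring_set N \<Longrightarrow> weighted_less M N s E \<Longrightarrow>
    weighted_less M N s (\<lambda>x. D x + E x)"
proof (induction arbitrary: E rule: weighted_less.induct)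
  case (zero D s)
  show ?case by (rule weighted_less_cong[OF zero(3,2)]) (use zero in simp)
next
  case (step s D)
  show ?case
  proof (rule weighted_less.step)
    fix j b assume b: "b \<in> N" "b \<in> M j"
    have "op_commutator (\<lambda>x. D x + E x) b = (\<lambda>x. op_commutator D b x + op_commutator E b x)"
      by (simp add: op_commutator_def algebra_simps)
    then show "weighted_less M N (s - CHAR('a) ^ j) (op_commutator (\<lambda>x. D x + E x) b)"
      using step b weighted_less_commutator[OF step.prems(2) step.prems(1) b] by simp
  qed (rule step)
qed

lemma weighted_less_scale: "weighted_less M N s D \<Longrightarrow> weighted_less M N s (\<lambda>x. c * D x)"
proof (induction rule: weighted_less.induct)
  case (step s D)
  have "op_commutator (\<lambda>x. c * D x) b = (\<lambda>x. c * op_commutator D b x)" for b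
    by (simp add: op_commutator_def algebra_simps)
  with step show ?case by - (rule weighted_less.step, auto)
qed (auto intro: weighted_less.zero)

lemma weighted_less_comp_mult:
  "weighted_less M N s D \<Longrightarrow> subring_set N \<Longrightarrow> c \<in> N \<Longrightarrow> weighted_less M N s (\<lambda>x. D (c * x))"
proof (induction rule: weighted_less.induct)
  case (step s D)
  have "op_commutator (\<lambda>x. D (c * x)) b = (\<lambda>x. op_commutator D b (c * x))" for b
    by (simp add: op_commutator_def mult.left_commute)
  with step show ?case by - (rule weighted_less.step, auto)
qed (auto intro!: weighted_less.zero simp: subring_set_mult)

text \<open>Every element lies in \<open>M 0\<close>, where a commutator costs
  \<open>p ^ 0 = 1\<close>.\<close>

lemma weighted_less_imp_order_less:
  "weighted_less M UNIV s D \<Longrightarrow> M 0 = UNIV \<Longrightarrow> order_less s D"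
proof (induction rule: weighted_less.induct)
  case (zero D s)
  then have "D = (\<lambda>x. 0)" by auto
  then show ?case by (simp add: order_less_zero)
next
  case (step s D)
  then show ?case using step.IH[of _ 0] by (cases s) auto
qed

text \<open>The product rule for commutators again. \<open>D\<close> is merely additive on
  \<open>N'\<close>, so the elements of \<open>N\<close> have to be treated as generators
  too.\<close>

lemma weighted_less_gen:
  assumes sub: "subring_set N'" "subring_set N" and N': "N' = ring_adjoin N {x}"
    and add: "\<And>u v. u \<in> N' \<Longrightarrow> v \<in> N' \<Longrightarrow> D (u + v) = D u + D v"
    and N: "\<And>b. b \<in> N \<Longrightarrow> weighted_less M N' t (op_commutator D b)"
    and x: "weighted_less M N' t (op_commutator D x)"
    and b: "b \<in> N'"
  shows "weighted_less M N' t (op_commutator D b)"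
  using b unfolding N'
proof induction
  case (add u v)
  note uv = add.hyps[folded N']
  have "weighted_less M N' t (\<lambda>z. op_commutator D u z + op_commutator D v z)"
    using add.IH sub(1) by (intro weighted_less_add) (auto simp: N')
  then show ?case unfolding N'[symmetric]
    by (rule weighted_less_cong[OF _ sub(1)])
      (use uv in \<open>auto simp: op_commutator_def algebra_simps assms(4) subring_set_mult[OF sub(1)]\<close>)
next
  case (mult u v)
  have "op_commutator D (u * v) = (\<lambda>z. op_commutator D u (v * z) + u * op_commutator D v z)"
    by (simp add: op_commutator_def algebra_simps)
  then show ?case using mult sub(1) unfolding N'[symmetric]
    by (auto intro!: weighted_less_add weighted_less_comp_mult weighted_less_scale)
qed (use N x in \<open>auto simp: N'\<close>)

text \<open>
  \<open>adjoin_ext N x G a\<close> sends \<open>n * x ^ k\<close>, where \<open>k < p\<close>, to \<open>G n\<close> times the \<open>a\<close>-th divided derivative of \<open>x ^ k\<close>.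
\<close>

definition adjoin_coord :: "'a::field set \<Rightarrow> 'a \<Rightarrow> 'a \<Rightarrow> nat \<Rightarrow> 'a" where
  "adjoin_coord N x y = (SOME c. range c \<subseteq> N \<and> y = (\<Sum>k<CHAR('a). c k * x ^ k))"

definition adjoin_ext :: "'a::field set \<Rightarrow> 'a \<Rightarrow> ('a \<Rightarrow> 'a) \<Rightarrow> nat \<Rightarrow> 'a \<Rightarrow> 'a" where
  "adjoin_ext N x G a y =
     (\<Sum>k<CHAR('a). of_nat (k choose a) * G (adjoin_coord N x y k) * x ^ (k - a))"

text \<open>A step of degree \<open>p\<close>: by \<open>powers_independent\<close> with
  \<open>f = 0\<close> the powers \<open>1, ..., x ^ (p - 1)\<close> form an \<open>N\<close>-basis
  of \<open>N'\<close>.\<close>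

locale simple_step =
  fixes N :: "'a::field set" and x :: 'a
  assumes char: "CHAR('a) > 0" and N: "subfield_set N" and notin: "x \<notin> N"
    and xp: "x ^ CHAR('a) \<in> N"
begin

abbreviation "N' \<equiv> ring_adjoin N {x}"

lemma prime: "prime CHAR('a)" using char by (rule prime_CHAR_semidom)

lemma R: "subring_set N" using N by (rule subfield_set_subring)

lemma R': "subring_set N'" using R by (rule subring_set_ring_adjoin)

lemma N'E:
  assumes "y \<in> N'" obtains c where "range c \<subseteq> N" "y = (\<Sum>k<CHAR('a). c k * x ^ k)"
proof -
  have "y \<in> {\<Sum>a<CHAR('a). c a * x ^ a | c. range c \<subseteq> N}"
    using ring_adjoin_simple[OF R xp char] assms by simp
  then show ?thesis using that by blast
qed

lemma coord_eq:
  assumes c: "range c \<subseteq> N" and k: "k < CHAR('a)"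
  shows "adjoin_coord N x (\<Sum>k<CHAR('a). c k * x ^ k) k = c k"
proof -
  let ?d = "adjoin_coord N x (\<Sum>k<CHAR('a). c k * x ^ k)"
  have d: "range ?d \<subseteq> N \<and> (\<Sum>k<CHAR('a). c k * x ^ k) = (\<Sum>k<CHAR('a). ?d k * x ^ k)"
    unfolding adjoin_coord_def by (rule someI[of _ c]) (use c in simp)
  have "?d k - c k = 0"
  proof (rule powers_independent[OF N char, of x 0])
    show "(\<Sum>a<CHAR('a) ^ Suc 0. (?d a - c a) * x ^ a) = 0"
      using d by (simp add: left_diff_distrib sum_subtractf)
  qed (use d c k notin xp R in \<open>auto intro!: subring_set_diff\<close>)
  then show ?thesis by simp
qed

lemma ext_eq:
  assumes "range c \<subseteq> N"
  shows "adjoin_ext N x G a (\<Sum>k<CHAR('a). c k * x ^ k) = (\<Sum>k<CHAR('a). of_nat (k choose a) * G (c k) * x ^ (k - a))"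
  unfolding adjoin_ext_def by (intro sum.cong) (auto simp: coord_eq[OF assms])

lemma ext_add:
  assumes G: "\<And>u v. u \<in> N \<Longrightarrow> v \<in> N \<Longrightarrow> G (u + v) = G u + G v" and uv: "u \<in> N'" "v \<in> N'"
  shows "adjoin_ext N x G a (u + v) = adjoin_ext N x G a u + adjoin_ext N x G a v"
proof -
  obtain c where c: "range c \<subseteq> N" "u = (\<Sum>k<CHAR('a). c k * x ^ k)" using uv(1) by (rule N'E)
  obtain d where d: "range d \<subseteq> N" "v = (\<Sum>k<CHAR('a). d k * x ^ k)" using uv(2) by (rule N'E)
  have e: "u + v = (\<Sum>k<CHAR('a). (c k + d k) * x ^ k)" by (simp add: c d algebra_simps sum.distrib)
  have cd: "range (\<lambda>k. c k + d k) \<subseteq> N" using c d R by (auto intro!: subring_set_add)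
  have "G (c k + d k) = G (c k) + G (d k)" for k using c d by (intro G) auto
  then show ?thesis
    unfolding e ext_eq[OF cd] unfolding c(2) d(2) ext_eq[OF c(1)] ext_eq[OF d(1)]
    by (simp add: algebra_simps sum.distrib)
qed

lemma ext_base_mult:
  assumes b: "b \<in> N" and y: "y \<in> N'"
  shows "adjoin_ext N x G a (b * y) = adjoin_ext N x (\<lambda>z. G (b * z)) a y"
proof -
  obtain c where c: "range c \<subseteq> N" "y = (\<Sum>k<CHAR('a). c k * x ^ k)" using y by (rule N'E)
  have "b * y = (\<Sum>k<CHAR('a). (b * c k) * x ^ k)" by (simp add: c sum_distrib_left algebra_simps)
  moreover have "range (\<lambda>k. b * c k) \<subseteq> N" using b c R by (auto intro!: subring_set_mult)
  ultimately show ?thesis by (simp add: ext_eq c)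
qed

lemma ext_commutator_base:
  assumes b: "b \<in> N" and y: "y \<in> N'"
  shows "op_commutator (adjoin_ext N x G a) b y = adjoin_ext N x (op_commutator G b) a y"
  unfolding op_commutator_def ext_base_mult[OF assms]
  by (simp add: adjoin_ext_def sum_distrib_left sum_subtractf algebra_simps)

text \<open>Multiplication by \<open>x\<close> shifts the coordinates, and the top one,
  \<open>c r\<close>, returns to position \<open>0\<close> with the factor
  \<open>x ^ p\<close>.\<close>

lemma ext_gen_mult:
  assumes c: "range c \<subseteq> N" and r: "CHAR('a) = Suc r"
  shows "adjoin_ext N x G a (x * (\<Sum>k<CHAR('a). c k * x ^ k)) =
    of_nat (0 choose a) * G (x ^ CHAR('a) * c r) + (\<Sum>k<r. of_nat (Suc k choose a) * G (c k) * x ^ (Suc k - a))"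
proof -
  let ?d = "\<lambda>k. if k = 0 then x ^ CHAR('a) * c r else c (k - 1)"
  have "x * (\<Sum>k<CHAR('a). c k * x ^ k) = (\<Sum>k<r. c k * x ^ Suc k) + x ^ CHAR('a) * c r"
    unfolding r by (simp add: sum_distrib_left algebra_simps)
  also have "\<dots> = (\<Sum>k<CHAR('a). ?d k * x ^ k)"
    unfolding r sum.lessThan_Suc_shift by simp
  finally have "x * (\<Sum>k<CHAR('a). c k * x ^ k) = (\<Sum>k<CHAR('a). ?d k * x ^ k)" .
  moreover have "range ?d \<subseteq> N" using c xp R by (auto intro!: subring_set_mult)
  ultimately have "adjoin_ext N x G a (x * (\<Sum>k<CHAR('a). c k * x ^ k)) =
      (\<Sum>k<CHAR('a). of_nat (k choose a) * G (?d k) * x ^ (k - a))"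
    by (simp only: ext_eq)
  also have "\<dots> = of_nat (0 choose a) * G (x ^ CHAR('a) * c r) + (\<Sum>k<r. of_nat (Suc k choose a) * G (c k) * x ^ (Suc k - a))"
    unfolding r sum.lessThan_Suc_shift by simp
  finally show ?thesis .
qed

text \<open>Coordinatewise extension commutes with \<open>x\<close> except in the carry, which
  leaves \<open>G (x ^ p * c) - x ^ p * G c\<close> for the top coordinate \<open>c\<close>.
  Extension with index \<open>p - 1\<close> is the operation that picks out this coordinate.\<close>

lemma ext_commutator_gen_0:
  assumes y: "y \<in> N'"
  shows "op_commutator (adjoin_ext N x G 0) x y = adjoin_ext N x (op_commutator G (x ^ CHAR('a))) (CHAR('a) - 1) y"
proof -
  obtain c where c: "range c \<subseteq> N" "y = (\<Sum>k<CHAR('a). c k * x ^ k)" using y by (rule N'E)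
  obtain r where r: "CHAR('a) = Suc r" using char by (cases "CHAR('a)") auto
  have "op_commutator (adjoin_ext N x G 0) x y =
      G (x ^ CHAR('a) * c r) + (\<Sum>k<r. G (c k) * x ^ Suc k) - x * (\<Sum>k<CHAR('a). G (c k) * x ^ k)"
    unfolding op_commutator_def c(2) ext_gen_mult[OF c(1) r] ext_eq[OF c(1)] by simp
  also have "\<dots> = op_commutator G (x ^ CHAR('a)) (c r)"
    unfolding r by (simp add: op_commutator_def sum_distrib_left algebra_simps)
  also have "\<dots> = adjoin_ext N x (op_commutator G (x ^ CHAR('a))) (CHAR('a) - 1) y"
    unfolding c(2) ext_eq[OF c(1)] unfolding r
    by (simp add: binomial_eq_0 del: power_Suc)
  finally show ?thesis .
qed

text \<open>Pascal's rule in each coordinate. The carry contributes nothing, as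
  \<open>0 choose Suc a = 0\<close>, and the rule survives at the top because \<open>p\<close>
  divides \<open>p choose Suc a\<close>.\<close>

lemma ext_commutator_gen_Suc:
  assumes y: "y \<in> N'" and a: "Suc a < CHAR('a)"
  shows "op_commutator (adjoin_ext N x G (Suc a)) x y = adjoin_ext N x G a y"
proof -
  obtain c where c: "range c \<subseteq> N" "y = (\<Sum>k<CHAR('a). c k * x ^ k)" using y by (rule N'E)
  obtain r where r: "CHAR('a) = Suc r" using char by (cases "CHAR('a)") auto
  have shift: "of_nat (k choose Suc a) * G (c k) * (x * x ^ (k - Suc a)) =
      of_nat (k choose Suc a) * G (c k) * x ^ (k - a)" for k
  proof (cases "k < Suc a")
    case False
    then have "k - a = Suc (k - Suc a)" by simp
    then show ?thesis by simp
  qed (simp add: binomial_eq_0)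
  have "CHAR('a) dvd (CHAR('a) choose Suc a)"
    using prime a by (intro dvd_choose_prime) auto
  then have "(of_nat (Suc r choose Suc a) :: 'a) = 0"
    unfolding r[symmetric] by (simp add: of_nat_eq_0_iff_char_dvd)
  then have last: "(of_nat (r choose Suc a) :: 'a) = - of_nat (r choose a)"
    by (simp add: eq_neg_iff_add_eq_0 add.commute)
  have "op_commutator (adjoin_ext N x G (Suc a)) x y =
      (\<Sum>k<r. of_nat (Suc k choose Suc a) * G (c k) * x ^ (k - a))
       - (\<Sum>k<CHAR('a). of_nat (k choose Suc a) * G (c k) * (x * x ^ (k - Suc a)))"
    unfolding op_commutator_def c(2) ext_gen_mult[OF c(1) r] ext_eq[OF c(1)]
    by (simp add: sum_distrib_left algebra_simps)
  also have "\<dots> = (\<Sum>k<r. of_nat (k choose a) * G (c k) * x ^ (k - a))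
      + of_nat (r choose a) * G (c r) * x ^ (r - a)"
    unfolding shift unfolding r by (simp add: last sum.distrib algebra_simps)
  also have "\<dots> = adjoin_ext N x G a y"
    unfolding c(2) ext_eq[OF c(1)] unfolding r by simp
  finally show ?thesis .
qed

lemma ext_zero:
  assumes "\<And>z. z \<in> N \<Longrightarrow> G z = 0" "y \<in> N'"
  shows "adjoin_ext N x G a y = 0"
proof -
  obtain c where c: "range c \<subseteq> N" "y = (\<Sum>k<CHAR('a). c k * x ^ k)" using assms(2) by (rule N'E)
  then have "G (c k) = 0" for k by (intro assms(1)) auto
  then show ?thesis unfolding c(2) ext_eq[OF c(1)] by simp
qed

lemma ext_pow:
  assumes "n \<in> N" "k < CHAR('a)" and 0: "G 0 = 0"
  shows "adjoin_ext N x G a (n * x ^ k) = of_nat (k choose a) * G n * x ^ (k - a)"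
proof -
  let ?c = "\<lambda>i. if i = k then n else 0"
  have "n * x ^ k = (\<Sum>i<CHAR('a). ?c i * x ^ i)"
    using assms(2) by (subst sum.remove[of _ k]) auto
  moreover have "range ?c \<subseteq> N" using assms R by (auto simp: subring_set_zero)
  ultimately have "adjoin_ext N x G a (n * x ^ k) = (\<Sum>i<CHAR('a). of_nat (i choose a) * G (?c i) * x ^ (i - a))"
    using ext_eq[of ?c G a] by simp
  also have "\<dots> = of_nat (k choose a) * G n * x ^ (k - a)"
    using assms(2) by (subst sum.remove[of _ k]) (auto simp: 0)
  finally show ?thesis .
qed

text \<open>Induction on the weight of \<open>G\<close>, then on \<open>a\<close>. Commuting with
  \<open>b \<in> N\<close> acts on \<open>G\<close>. Commuting with \<open>x\<close> lowers
  \<open>a\<close> by one, hence the weight by \<open>p ^ j\<close>; at \<open>a = 0\<close> it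
  turns \<open>G\<close> into \<open>[G, x ^ p]\<close> and \<open>a\<close> into
  \<open>p - 1\<close>, of weight \<open>s - p ^ (j + 1) + (p - 1) * p ^ j = s - p ^ j\<close>.
  Members of \<open>M l\<close> with \<open>l > j\<close> lie in \<open>N\<close>; for
  \<open>l \<le> j\<close> the loss \<open>p ^ j\<close> is at least the required
  \<open>p ^ l\<close>.\<close>

lemma weighted_less_ext:
  assumes "weighted_less M N s G"
    and add: "\<And>u v. u \<in> N \<Longrightarrow> v \<in> N \<Longrightarrow> G (u + v) = G u + G v"
    and M: "N' \<subseteq> M j" "\<And>l. j < l \<Longrightarrow> M l \<subseteq> N" "x ^ CHAR('a) \<in> M (Suc j)" and a: "a < CHAR('a)"
  shows "weighted_less M N' (s + a * CHAR('a) ^ j) (adjoin_ext N x G a)"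
  using assms(1) add a
proof (induction arbitrary: a rule: weighted_less.induct)
  case (zero G s)
  then show ?case by (intro weighted_less.zero ext_zero) auto
next
  case (step s G)
  have add_commutator: "op_commutator G b (u + v) = op_commutator G b u + op_commutator G b v"
    if "b \<in> N" "u \<in> N" "v \<in> N" for b u v
    using that by (simp add: op_commutator_def distrib_left step.prems subring_set_mult[OF R])
  have base: "weighted_less M N' (s + a * CHAR('a) ^ j - CHAR('a) ^ l) (op_commutator (adjoin_ext N x G a) b)"
    if b: "b \<in> N" "b \<in> M l" and a: "a < CHAR('a)" for a b l
  proof -
    \<comment> \<open>Truncation matters: for \<open>s < p ^ l\<close> the commutator
      \<open>[G, b]\<close> has weight \<open>0\<close> and vanishes, whereas the truncated
      \<open>s - p ^ l + a * p ^ j\<close> could exceed the required bound.\<close>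
    have "weighted_less M N' (s + a * CHAR('a) ^ j - CHAR('a) ^ l) (adjoin_ext N x (op_commutator G b) a)"
    proof (cases "s < CHAR('a) ^ l")
      case True
      then have "op_commutator G b z = 0" if "z \<in> N" for z
        using weighted_less_0D[OF _ that] step.hyps(2)[OF b] by simp
      then show ?thesis by (intro weighted_less.zero ext_zero)
    next
      case False
      then have "s + a * CHAR('a) ^ j - CHAR('a) ^ l = s - CHAR('a) ^ l + a * CHAR('a) ^ j" by simp
      then show ?thesis
        using step.IH[OF b add_commutator[OF b(1)] a] by simp
    qed
    then show ?thesis
      by (rule weighted_less_cong[OF _ R']) (simp add: ext_commutator_base b)
  qed
  have pj: "CHAR('a) ^ l \<le> CHAR('a) ^ j" if "l \<le> j" for l
    using that char by (intro power_increasing) auto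
  have top: "weighted_less M N' (s + a * CHAR('a) ^ j - CHAR('a) ^ j) (op_commutator (adjoin_ext N x G a) b)"
    if gen: "weighted_less M N' (s + a * CHAR('a) ^ j - CHAR('a) ^ j) (op_commutator (adjoin_ext N x G a) x)"
      and b: "b \<in> N'" and a: "a < CHAR('a)" for a b
  proof (rule weighted_less_gen[OF R' R refl _ _ gen b])
    show "adjoin_ext N x G a (u + v) = adjoin_ext N x G a u + adjoin_ext N x G a v"
      if "u \<in> N'" "v \<in> N'" for u v
      using that step.prems(1) by (intro ext_add)
    show "weighted_less M N' (s + a * CHAR('a) ^ j - CHAR('a) ^ j) (op_commutator (adjoin_ext N x G a) b)"
      if "b \<in> N" for b
      using that M(1) a by (intro base) (auto intro: ring_adjoin.base)
  qed
  have main: "weighted_less M N' (s + a * CHAR('a) ^ j) (adjoin_ext N x G a)"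
    if gen: "weighted_less M N' (s + a * CHAR('a) ^ j - CHAR('a) ^ j) (op_commutator (adjoin_ext N x G a) x)"
      and a: "a < CHAR('a)" for a
  proof (rule weighted_less.step)
    fix l b assume b: "b \<in> N'" "b \<in> M l"
    show "weighted_less M N' (s + a * CHAR('a) ^ j - CHAR('a) ^ l) (op_commutator (adjoin_ext N x G a) b)"
    proof (cases "l \<le> j")
      case True
      show ?thesis
        by (rule weighted_less_mono[OF top[OF gen b(1) a]]) (use pj[OF True] in simp)
    next
      case False
      then show ?thesis using M(2)[of l] b a by (intro base) auto
    qed
  qed (use step.hyps in simp)
  from \<open>a < CHAR('a)\<close> show ?case
  proof (induction a)
    case 0
    have "weighted_less M N' (s - CHAR('a) ^ j) (adjoin_ext N x (op_commutator G (x ^ CHAR('a))) (CHAR('a) - 1))"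
    proof (cases "s < CHAR('a) ^ Suc j")
      case True
      then have "op_commutator G (x ^ CHAR('a)) z = 0" if "z \<in> N" for z
        using weighted_less_0D[OF _ that] step.hyps(2)[OF xp M(3)] by simp
      then show ?thesis by (intro weighted_less.zero ext_zero)
    next
      case False
      obtain r where r: "CHAR('a) = Suc r" using char by (cases "CHAR('a)") auto
      have eq: "s - CHAR('a) ^ Suc j + (CHAR('a) - 1) * CHAR('a) ^ j = s - CHAR('a) ^ j"
        using False unfolding r by simp
      have "weighted_less M N' (s - CHAR('a) ^ Suc j + (CHAR('a) - 1) * CHAR('a) ^ j) (adjoin_ext N x (op_commutator G (x ^ CHAR('a))) (CHAR('a) - 1))"
        using char by (intro step.IH[OF xp M(3) add_commutator[OF xp]]) auto
      then show ?thesis unfolding eq .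
    qed
    then have "weighted_less M N' (s - CHAR('a) ^ j) (op_commutator (adjoin_ext N x G 0) x)"
      by (rule weighted_less_cong[OF _ R']) (simp add: ext_commutator_gen_0)
    then show ?case using char by (intro main) auto
  next
    case (Suc a)
    then have "weighted_less M N' (s + a * CHAR('a) ^ j) (adjoin_ext N x G a)" by simp
    then have "weighted_less M N' (s + a * CHAR('a) ^ j) (op_commutator (adjoin_ext N x G (Suc a)) x)"
      by (rule weighted_less_cong[OF _ R']) (use Suc.prems in \<open>simp add: ext_commutator_gen_Suc\<close>)
    then show ?case using Suc.prems by (intro main) auto
  qed
qed

end

section \<open>Operators separating an element from the base field\<close>

locale insep_extension =
  fixes K :: "'a::field set"
  assumes char: "CHAR('a) > 0" and K: "subfield_set K" and insep: "purely_inseparable K"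
begin

lemma KR: "subring_set K" using K by (rule subfield_set_subring)

lemma subring_adjoin: "subring_set (ring_adjoin K H)"
  using KR by (rule subring_set_ring_adjoin)

lemma subfield_adjoin: "subfield_set (ring_adjoin K H)"
  using K insep char by (rule subfield_set_ring_adjoin)

definition compositum :: "nat \<Rightarrow> 'a set" where
  "compositum j = ring_adjoin K (frob_image j)"

lemma compositum_0: "compositum 0 = UNIV"
  by (auto simp: compositum_def intro: ring_adjoin.incl)

lemma compositum_antimono: "i \<le> j \<Longrightarrow> compositum j \<subseteq> compositum i"
  unfolding compositum_def by (intro ring_adjoin_mono frob_image_antimono)

lemma compositum_frobenius: "x \<in> compositum j \<Longrightarrow> x ^ CHAR('a) \<in> compositum (Suc j)"
  unfolding compositum_def
proof (induction rule: ring_adjoin.induct)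
  case (base c)
  then show ?case by (intro ring_adjoin.base subring_set_power[OF KR])
next
  case (incl x)
  then show ?case using power_in_frob_image[of x j 1] by (auto intro: ring_adjoin.incl)
next
  case (add x y)
  then show ?case using frobenius_add[OF char, of x y 1] by (auto intro: ring_adjoin.add)
next
  case (mult x y)
  then show ?case by (auto simp: power_mult_distrib intro: ring_adjoin.mult)
qed

text \<open>Frobenius is additive, so a generating set of \<open>L\<close> can be raised to the
  power \<open>p ^ j\<close>. Passing from \<open>compositum (Suc j)\<close> to
  \<open>compositum j\<close> thus takes finitely many simple steps when \<open>B\<close> is
  finite.\<close>

lemma compositum_generated:
  assumes "ring_adjoin K B = UNIV"
  shows "compositum j = ring_adjoin K ((\<lambda>b. b ^ (CHAR('a) ^ j)) ` B)" (is "_ = ?R")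
proof
  have "x ^ (CHAR('a) ^ j) \<in> ?R" for x
  proof -
    have "x \<in> ring_adjoin K B" using assms by simp
    then show ?thesis
    proof induction
      case (base c)
      then show ?case by (intro ring_adjoin.base subring_set_power[OF KR])
    qed (auto simp: frobenius_add[OF char] power_mult_distrib intro: ring_adjoin.intros)
  qed
  then show "compositum j \<subseteq> ?R"
    unfolding compositum_def
    by (intro ring_adjoin_subset subring_adjoin) (auto simp: frob_image_def intro: ring_adjoin.base)
  show "?R \<subseteq> compositum j"
    unfolding compositum_def by (rule ring_adjoin_mono) (auto simp: frob_image_def)
qed

text \<open>A witness that \<open>y\<close> is not a constant of the operators of weight
  \<open>s\<close> on \<open>N\<close>; the values \<open>0\<close> and \<open>1\<close> are
  preserved when \<open>G\<close> is extended to larger rings.\<close>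

definition separated_by :: "nat \<Rightarrow> 'a \<Rightarrow> 'a set \<Rightarrow> bool" where
  "separated_by s y N \<longleftrightarrow> subring_set N \<and> K \<subseteq> N \<and> y \<in> N \<and>
    (\<exists>G. (\<forall>u\<in>N. \<forall>v\<in>N. G (u + v) = G u + G v) \<and> (\<forall>c\<in>K. \<forall>u\<in>N. G (c * u) = c * G u) \<and>
      G 1 = 0 \<and> G y = 1 \<and> weighted_less compositum N s G)"

text \<open>\<open>adjoin_ext\<close> with index \<open>0\<close> agrees with \<open>G\<close> on
  \<open>N\<close> and adds only \<open>0 * p ^ j\<close> to the weight.\<close>

lemma separated_by_adjoin:
  assumes sep: "separated_by s y N" and NM: "compositum (Suc j) \<subseteq> N" "N \<subseteq> compositum j"
    and x: "x \<in> compositum j"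
  shows "\<exists>N'. insert x N \<subseteq> N' \<and> N' \<subseteq> compositum j \<and> separated_by s y N'"
proof (cases "x \<in> N")
  case True
  then show ?thesis using assms by blast
next
  case False
  obtain G where RN: "subring_set N" and KN: "K \<subseteq> N" and y: "y \<in> N"
    and G: "\<And>u v. u \<in> N \<Longrightarrow> v \<in> N \<Longrightarrow> G (u + v) = G u + G v"
      "\<And>c u. c \<in> K \<Longrightarrow> u \<in> N \<Longrightarrow> G (c * u) = c * G u" "G 1 = 0" "G y = 1"
      "weighted_less compositum N s G"
    using sep unfolding separated_by_def by blast
  have xpM: "x ^ CHAR('a) \<in> compositum (Suc j)" using x by (rule compositum_frobenius)
  interpret simple_step N x
    by unfold_locales
      (use char subfield_set_intermediate[OF K insep char RN KN] False xpM NM in auto)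
  have sub: "N' \<subseteq> compositum j"
    using NM(2) x unfolding compositum_def by (intro ring_adjoin_subset[OF subring_adjoin]) auto
  have NN': "N \<subseteq> N'" by (auto intro: ring_adjoin.base)
  have G0: "G 0 = 0" using G(2)[of 0 0] subring_set_zero[OF RN] subring_set_zero[OF KR] by simp
  let ?G = "adjoin_ext N x G 0"
  have "compositum l \<subseteq> N" if "j < l" for l
    using compositum_antimono[of "Suc j" l] that NM by auto
  then have "weighted_less compositum N' (s + 0 * CHAR('a) ^ j) ?G"
    using sub xpM char by (intro weighted_less_ext[OF G(5)]) (auto intro: G(1))
  moreover have "?G (u + v) = ?G u + ?G v" if "u \<in> N'" "v \<in> N'" for u v
    using that by (intro ext_add) (auto intro: G(1))
  moreover have "?G (c * u) = c * ?G u" if "c \<in> K" "u \<in> N'" for c u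
  proof -
    obtain d where d: "range d \<subseteq> N" "u = (\<Sum>k<CHAR('a). d k * x ^ k)" using \<open>u \<in> N'\<close> by (rule N'E)
    have "G (c * d k) = c * G (d k)" for k using d that by (intro G) auto
    then have "adjoin_ext N x (\<lambda>z. G (c * z)) 0 u = c * ?G u"
      unfolding d(2) ext_eq[OF d(1)] by (simp add: sum_distrib_left algebra_simps)
    then show ?thesis using that KN by (subst ext_base_mult) auto
  qed
  moreover have "?G n = G n" if "n \<in> N" for n
    using ext_pow[of n 0 G 0] that char G0 by simp
  ultimately have "separated_by s y N'"
    unfolding separated_by_def using R' NN' KN y G(3,4) subring_set_one[OF RN]
    by (intro conjI exI[of _ ?G]) auto
  moreover have "x \<in> N'" by (simp add: ring_adjoin.incl)
  ultimately show ?thesis using sub NN' by (intro exI[of _ N']) auto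
qed

lemma separated_by_adjoin_finite:
  assumes "finite Z" "Z \<subseteq> compositum j" "separated_by s y N" "compositum (Suc j) \<subseteq> N" "N \<subseteq> compositum j"
  shows "\<exists>N'. Z \<union> N \<subseteq> N' \<and> N' \<subseteq> compositum j \<and> separated_by s y N'"
  using assms
proof (induction Z)
  case (insert z Z)
  then obtain N' where "Z \<union> N \<subseteq> N'" "N' \<subseteq> compositum j" "separated_by s y N'" by auto
  moreover have "z \<in> compositum j" "compositum (Suc j) \<subseteq> N'"
    using insert.prems \<open>Z \<union> N \<subseteq> N'\<close> by auto
  ultimately obtain N'' where "insert z N' \<subseteq> N''" "N'' \<subseteq> compositum j" "separated_by s y N''"
    using separated_by_adjoin[of s y N' j z] by blast
  with \<open>Z \<union> N \<subseteq> N'\<close> show ?case by (intro exI[of _ N'']) auto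
qed auto

lemma separated_by_compositum:
  assumes B: "finite B" "ring_adjoin K B = UNIV"
    and N: "separated_by s y N" "compositum (Suc j) \<subseteq> N" "N \<subseteq> compositum j"
  shows "separated_by s y (compositum j)"
proof -
  let ?Z = "(\<lambda>b. b ^ (CHAR('a) ^ j)) ` B"
  have "?Z \<subseteq> compositum j" unfolding compositum_generated[OF B(2)] by (auto intro: ring_adjoin.incl)
  then obtain N' where N': "?Z \<union> N \<subseteq> N'" "N' \<subseteq> compositum j" "separated_by s y N'"
    using separated_by_adjoin_finite[of ?Z j s y N] B N by auto
  have "compositum j \<subseteq> N'"
    unfolding compositum_generated[OF B(2)]
    by (rule ring_adjoin_subset) (use N' in \<open>auto simp: separated_by_def\<close>)
  then show ?thesis using N' by auto
qed

text \<open>The witness climbs through \<open>compositum i\<close>,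
  \<open>compositum (i - 1)\<close>, ..., \<open>compositum 0 = UNIV\<close>, always with the same
  \<open>s\<close>.\<close>

lemma separated_by_UNIV:
  assumes B: "finite B" "ring_adjoin K B = UNIV"
    and N: "separated_by s y N" "compositum (Suc i) \<subseteq> N" "N \<subseteq> compositum i"
  shows "separated_by s y UNIV"
proof -
  have "j \<le> i \<Longrightarrow> separated_by s y (compositum (i - j))" for j
  proof (induction j)
    case 0
    then show ?case using separated_by_compositum[OF B N] by simp
  next
    case (Suc j)
    then have "Suc (i - Suc j) = i - j" by simp
    then show ?case
      using separated_by_compositum[OF B, of s y "compositum (i - j)" "i - Suc j"] Suc
        compositum_antimono[of "i - Suc j" "i - j"] by simp
  qed
  from this[of i] show ?thesis by (simp add: compositum_0)
qed

lemma separating_diff_op: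
  assumes B: "finite B" "ring_adjoin K B = UNIV" and e: "frob_image e \<subseteq> K" and y: "y \<notin> K"
  obtains E where "E \<in> diff_ops K (CHAR('a) ^ (e - 1))" "E 1 = 0" "E y \<noteq> 0"
proof -
  have "compositum e \<subseteq> K"
    unfolding compositum_def using e by (intro ring_adjoin_subset KR) auto
  then have ex: "y \<notin> compositum e" using y by auto
  \<comment> \<open>\<open>compositum 0\<close> is everything, so the least index missing
    \<open>y\<close> is positive; subtracting one puts \<open>y\<close> into
    \<open>compositum i\<close> but not into \<open>compositum (Suc i)\<close>. Since
    \<open>compositum e \<subseteq> K\<close>, this \<open>i\<close> is at most
    \<open>e - 1\<close>.\<close>
  define i where "i = (LEAST i. y \<notin> compositum i) - 1"
  have "y \<notin> compositum (LEAST i. y \<notin> compositum i)" "(LEAST i. y \<notin> compositum i) \<le> e"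
    using LeastI[of "\<lambda>i. y \<notin> compositum i", OF ex] Least_le[of "\<lambda>i. y \<notin> compositum i", OF ex] by auto
  moreover from this have "(LEAST i. y \<notin> compositum i) \<noteq> 0"
    by (metis compositum_0 UNIV_I)
  ultimately have i: "y \<notin> compositum (Suc i)" "i \<le> e - 1" and "i < (LEAST i. y \<notin> compositum i)"
    by (auto simp: i_def)
  then have yi: "y \<in> compositum i" using not_less_Least by blast
  let ?N = "compositum (Suc i)"
  have RN: "subring_set ?N" and KN: "K \<subseteq> ?N"
    using subring_adjoin by (auto simp: compositum_def intro: ring_adjoin.base)
  interpret simple_step ?N y
    by unfold_locales
      (use char subfield_adjoin i compositum_frobenius[OF yi] in \<open>auto simp: compositum_def\<close>)
  have sub: "N' \<subseteq> compositum i"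
    unfolding compositum_def
    by (rule ring_adjoin_subset[OF subring_adjoin])
      (use compositum_antimono[of i "Suc i"] yi in \<open>auto simp: compositum_def intro: ring_adjoin.base\<close>)
  \<comment> \<open>Differentiation with respect to \<open>y\<close> over \<open>?N\<close>. The
    identity commutes with multiplications and so has weight \<open>1\<close>; index
    \<open>1\<close> adds \<open>p ^ i\<close>, and weight \<open>1 + p ^ i\<close> means order at
    most \<open>p ^ i\<close>.\<close>
  let ?G = "adjoin_ext ?N y (\<lambda>z. z) 1"
  have p: "1 < CHAR('a)" using prime by (rule prime_gt_1_nat)
  have "weighted_less compositum ?N 1 (\<lambda>z. z)"
    by (rule weighted_less.step) (auto simp: op_commutator_def intro: weighted_less.zero)
  then have "weighted_less compositum N' (1 + 1 * CHAR('a) ^ i) ?G"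
  proof (rule weighted_less_ext)
    show "compositum l \<subseteq> ?N" if "i < l" for l
      using compositum_antimono[of "Suc i" l] that by auto
  qed (use sub compositum_frobenius[OF yi] p in auto)
  moreover have "?G (u + v) = ?G u + ?G v" if "u \<in> N'" "v \<in> N'" for u v
    using that by (intro ext_add) auto
  moreover have "?G (c * u) = c * ?G u" if "c \<in> K" "u \<in> N'" for c u
    using that KN by (subst ext_base_mult) (auto simp: adjoin_ext_def sum_distrib_left algebra_simps)
  moreover have "?G 1 = 0"
    using ext_pow[of 1 0 "\<lambda>z. z" 1] char subring_set_one[OF RN] by simp
  moreover have "?G y = 1"
    using ext_pow[of 1 1 "\<lambda>z. z" 1] p subring_set_one[OF RN] by simp
  moreover have "y \<in> N'" "K \<subseteq> N'" using KN by (auto intro: ring_adjoin.intros)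
  ultimately have "separated_by (Suc (CHAR('a) ^ i)) y N'"
    unfolding separated_by_def using R' by (intro conjI exI[of _ ?G]) auto
  then have "separated_by (Suc (CHAR('a) ^ i)) y UNIV"
    using sub by (intro separated_by_UNIV[OF B, where i = i]) (auto intro: ring_adjoin.base)
  then obtain E where E: "linear_over K E" "E 1 = 0" "E y = 1"
      "weighted_less compositum UNIV (Suc (CHAR('a) ^ i)) E"
    unfolding separated_by_def linear_over_def by auto
  then have "order_less (Suc (CHAR('a) ^ i)) E"
    by (intro weighted_less_imp_order_less[of compositum, OF _ compositum_0])
  moreover have "CHAR('a) ^ i \<le> CHAR('a) ^ (e - 1)"
    using i char by (intro power_increasing) auto
  ultimately have "E \<in> diff_ops K (CHAR('a) ^ (e - 1))"
    using E(1) unfolding diff_ops_iff by (auto intro: order_less_mono simp del: order_less.simps)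
  then show ?thesis using that E by simp
qed


section \<open>Linear disjointness from the Frobenius images\<close>

text \<open>Induction on the number of nonzero coefficients. One of them is scaled to
  \<open>1\<close>; if some \<open>z k1\<close> is then outside \<open>K\<close>, there is a
  \<open>D\<close> with \<open>D (z k1) \<noteq> D 1 * z k1\<close>. The new coefficients
  \<open>D (z k) - D 1 * z k\<close> stay in \<open>frob_image i\<close>, are nonzero at
  \<open>k1\<close> and vanish at \<open>k0\<close>, so the relation is shorter.\<close>

lemma rational_relation:
  fixes m y :: "'b \<Rightarrow> 'a"
  assumes B: "finite B" "ring_adjoin K B = UNIV" and e: "frob_image e \<subseteq> K"
    and span: "1 \<le> e - 1 \<Longrightarrow> op.span (frob_diff_ops K (e - 1)) = diff_ops K (CHAR('a) ^ (e - 1))"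
    and i: "1 \<le> i" and J: "finite J" and m: "m ` J \<subseteq> K"
    and y: "y ` J \<subseteq> frob_image i" "(\<Sum>k\<in>J. y k * m k) = 0" "\<exists>k\<in>J. y k \<noteq> 0"
  shows "\<exists>d. d ` J \<subseteq> K \<inter> frob_image i \<and> (\<Sum>k\<in>J. d k * m k) = 0 \<and> (\<exists>k\<in>J. d k \<noteq> 0)"
  using y
proof (induction "card {k \<in> J. y k \<noteq> 0}" arbitrary: y rule: less_induct)
  case less
  have F: "subfield_set (frob_image i :: 'a set)" using char by (rule subfield_set_frob_image)
  note FR = subfield_set_subring[OF F]
  obtain k0 where k0: "k0 \<in> J" "y k0 \<noteq> 0" using less.prems by auto
  define z where "z k = y k / y k0" for k
  have z: "z ` J \<subseteq> frob_image i"
    using less.prems k0 by (auto simp: z_def intro!: subfield_set_divide[OF F])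
  have zsum: "(\<Sum>k\<in>J. z k * m k) = 0"
    using less.prems by (simp add: z_def sum_divide_distrib[symmetric])
  show ?case
  proof (cases "z ` J \<subseteq> K")
    case True
    have "z k0 \<noteq> 0" using k0 by (simp add: z_def)
    then show ?thesis using True z zsum k0 by (intro exI[of _ z]) auto
  next
    case False
    then obtain k1 where k1: "k1 \<in> J" "z k1 \<notin> K" by auto
    \<comment> \<open>For \<open>i \<ge> e\<close> all coefficients would lie in \<open>K\<close>.
      Hence \<open>1 \<le> i \<le> e - 1\<close>, so that \<open>span\<close> applies and the
      operator \<open>D\<close> chosen below preserves \<open>frob_image i\<close>.\<close>
    have "i < e"
    proof (rule ccontr)
      assume "\<not> i < e"
      then have "frob_image i \<subseteq> K" using frob_image_antimono[of e i] e by auto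
      then show False using z k1 by auto
    qed
    obtain E where E: "E \<in> diff_ops K (CHAR('a) ^ (e - 1))" "E 1 = 0" "E (z k1) \<noteq> 0"
      using separating_diff_op[OF B e k1(2)] .
    \<comment> \<open>Equality defines an \<open>L\<close>-subspace of operators; if it held on the
      spanning set it would hold for \<open>E\<close>, which kills \<open>1\<close> but not
      \<open>z k1\<close>.\<close>
    have "\<exists>D\<in>frob_diff_ops K (e - 1). D (z k1) \<noteq> D 1 * z k1"
    proof (rule ccontr)
      assume "\<not> ?thesis"
      then have "frob_diff_ops K (e - 1) \<subseteq> {D. D (z k1) = D 1 * z k1}" by auto
      moreover have "op.subspace {D. D (z k1) = D 1 * z k1}"
        by (rule op.subspaceI) (auto simp: op_scale_def algebra_simps)
      ultimately have "op.span (frob_diff_ops K (e - 1)) \<subseteq> {D. D (z k1) = D 1 * z k1}"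
        by (rule op.span_minimal)
      then have "E (z k1) = E 1 * z k1" using E(1) span \<open>i < e\<close> i by auto
      then show False using E by simp
    qed
    then obtain D where D: "D \<in> frob_diff_ops K (e - 1)" "D (z k1) \<noteq> D 1 * z k1" by blast
    then have lin: "linear_over K D" and pres: "D ` frob_image i \<subseteq> frob_image i"
      using \<open>i < e\<close> by (auto simp: frob_diff_ops_def diff_ops_iff)
    define w where "w k = D (z k) - D 1 * z k" for k
    have "D 1 \<in> frob_image i" using pres subring_set_one[OF FR] by auto
    then have w: "w ` J \<subseteq> frob_image i"
      using z pres by (auto simp: w_def intro!: subring_set_diff[OF FR] subring_set_mult[OF FR])
    have "D (\<Sum>k\<in>J. m k * z k) = (\<Sum>k\<in>J. m k * D (z k))"
      using m by (subst linear_over_sum[OF lin]) (auto intro!: sum.cong linear_over_scale[OF lin])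
    moreover have "(\<Sum>k\<in>J. m k * z k) = 0" using zsum by (simp add: mult.commute)
    ultimately have "(\<Sum>k\<in>J. m k * D (z k)) = 0" by (simp add: linear_over_zero[OF lin])
    moreover have "(\<Sum>k\<in>J. w k * m k) = (\<Sum>k\<in>J. m k * D (z k)) - D 1 * (\<Sum>k\<in>J. z k * m k)"
      by (simp add: w_def algebra_simps sum_subtractf sum_distrib_left)
    ultimately have wsum: "(\<Sum>k\<in>J. w k * m k) = 0" using zsum by simp
    have wk1: "w k1 \<noteq> 0" using D by (simp add: w_def)
    have "w k = 0" if "y k = 0" for k
      using that by (simp add: w_def z_def linear_over_zero[OF lin])
    moreover have "w k0 = 0" using k0 by (simp add: w_def z_def)
    ultimately have "{k \<in> J. w k \<noteq> 0} \<subset> {k \<in> J. y k \<noteq> 0}" using k0 by auto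
    then have "card {k \<in> J. w k \<noteq> 0} < card {k \<in> J. y k \<noteq> 0}"
      using J by (intro psubset_card_mono) auto
    then show ?thesis using less.hyps[OF _ w wsum] wk1 k1 by blast
  qed
qed

text \<open>Linear disjointness as a descent of coefficients. A relation over
  \<open>K \<inter> frob_image i\<close> between \<open>1\<close> and the \<open>m k\<close>
  eliminates one \<open>m w\<close>, which leaves \<open>z + q0 * v w\<close> as a combination with
  one term fewer. The index type \<open>'b option\<close> makes room for the coefficient
  \<open>1\<close> at \<open>None\<close>.\<close>

lemma rational_combination:
  fixes m v :: "'b \<Rightarrow> 'a"
  assumes rel: "\<And>(m :: 'b option \<Rightarrow> 'a) y J. finite J \<Longrightarrow> m ` J \<subseteq> K \<Longrightarrow> y ` J \<subseteq> frob_image i \<Longrightarrow>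
      (\<Sum>k\<in>J. y k * m k) = 0 \<Longrightarrow> \<exists>k\<in>J. y k \<noteq> 0 \<Longrightarrow>
      \<exists>d. d ` J \<subseteq> K \<inter> frob_image i \<and> (\<Sum>k\<in>J. d k * m k) = 0 \<and> (\<exists>k\<in>J. d k \<noteq> 0)"
    and I: "finite I" and m: "m ` I \<subseteq> K" and v: "v ` I \<subseteq> frob_image i" "z \<in> frob_image i"
    and z: "z = (\<Sum>k\<in>I. m k * v k)"
  shows "\<exists>c. c ` I \<subseteq> K \<inter> frob_image i \<and> z = (\<Sum>k\<in>I. c k * v k)"
  using I m v z
proof (induction "card I" arbitrary: I v z rule: less_induct)
  case less
  have F: "subfield_set (frob_image i :: 'a set)" using char by (rule subfield_set_frob_image)
  have C: "subfield_set (K \<inter> frob_image i)" using K F by (rule subfield_set_Int)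
  note CR = subfield_set_subring[OF C] and FR = subfield_set_subring[OF F]
  show ?case
  proof (cases "\<forall>k\<in>I. v k = 0")
    case True
    then show ?thesis using less.prems subring_set_zero[OF CR]
      by (intro exI[of _ "\<lambda>_. 0"]) auto
  next
    case False
    let ?J = "insert None (Some ` I)"
    let ?m = "case_option 1 m" and ?y = "case_option (- z) v"
    have opt: "(\<Sum>k\<in>?J. f k) = f None + (\<Sum>k\<in>I. f (Some k))" for f :: "'b option \<Rightarrow> 'a"
      using less.prems by (simp add: sum.reindex)
    have "(\<Sum>k\<in>?J. ?y k * ?m k) = 0"
      unfolding opt using less.prems by (simp add: mult.commute)
    moreover have "?m ` ?J \<subseteq> K" "?y ` ?J \<subseteq> frob_image i" "\<exists>k\<in>?J. ?y k \<noteq> 0" "finite ?J"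
      using less.prems False by (auto intro: subring_set_one[OF KR] subring_set_uminus[OF FR])
    ultimately obtain d where d: "d ` ?J \<subseteq> K \<inter> frob_image i" "(\<Sum>k\<in>?J. d k * ?m k) = 0" "\<exists>k\<in>?J. d k \<noteq> 0"
      using rel[of ?J ?m ?y] by blast
    define d' where "d' k = d (Some k)" for k
    have dsum: "d None + (\<Sum>k\<in>I. d' k * m k) = 0" using d(2) unfolding opt by (simp add: d'_def)
    have d': "d' ` I \<subseteq> K \<inter> frob_image i" "d None \<in> K \<inter> frob_image i" using d(1) by (auto simp: d'_def)
    \<comment> \<open>If only \<open>d None\<close> were nonzero, the relation would read
      \<open>d None = 0\<close>.\<close>
    have "\<exists>w\<in>I. d' w \<noteq> 0"
    proof (rule ccontr)
      assume "\<not> ?thesis"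
      then have "\<forall>k\<in>I. d' k = 0" by blast
      then have "d None = 0" using dsum by simp
      then show False using d(3) \<open>\<forall>k\<in>I. d' k = 0\<close> by (auto simp: d'_def)
    qed
    then obtain w where w: "w \<in> I" "d' w \<noteq> 0" by blast
    define q where "q k = d' k / d' w" for k
    define q0 where "q0 = d None / d' w"
    have q: "q ` I \<subseteq> K \<inter> frob_image i" "q0 \<in> K \<inter> frob_image i"
      unfolding q_def q0_def image_subset_iff
      using d' w by (auto simp del: Int_iff intro!: subfield_set_divide[OF C])
    let ?I = "I - {w}"
    have split: "(\<Sum>k\<in>I. f k) = f w + (\<Sum>k\<in>?I. f k)" for f :: "'b \<Rightarrow> 'a"
      using w less.prems by (intro sum.remove) auto
    have "d None / d' w + (d' w * m w + (\<Sum>k\<in>?I. d' k * m k)) / d' w = 0"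
      using dsum unfolding split by (simp add: add_divide_distrib[symmetric])
    then have mw: "m w = - q0 - (\<Sum>k\<in>?I. q k * m k)"
      using w by (simp add: q_def q0_def add_divide_distrib sum_divide_distrib algebra_simps eq_neg_iff_add_eq_0)
    define v' where "v' k = v k - q k * v w" for k
    have "z + q0 * v w = (\<Sum>k\<in>?I. m k * v' k)"
      using less.prems(5) unfolding split mw
      by (simp add: v'_def algebra_simps sum_subtractf sum_distrib_left sum_distrib_right)
    moreover have "v' ` ?I \<subseteq> frob_image i" "z + q0 * v w \<in> frob_image i" "m ` ?I \<subseteq> K" "finite ?I"
      using less.prems q w
      by (auto simp: v'_def intro!: subring_set_add[OF FR] subring_set_diff[OF FR] subring_set_mult[OF FR])
    moreover have "card ?I < card I" using w less.prems by (intro psubset_card_mono) auto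
    ultimately obtain c where c: "c ` ?I \<subseteq> K \<inter> frob_image i" "z + q0 * v w = (\<Sum>k\<in>?I. c k * v' k)"
      using less.hyps[of ?I v' "z + q0 * v w"] by blast
    let ?cw = "- q0 - (\<Sum>k\<in>?I. c k * q k)"
    let ?c = "c(w := ?cw)"
    have "(\<Sum>k\<in>I. ?c k * v k) = ?cw * v w + (\<Sum>k\<in>?I. c k * v k)"
      unfolding split by (auto intro!: sum.cong)
    also have "\<dots> = (\<Sum>k\<in>?I. c k * v' k) - q0 * v w"
      by (simp add: v'_def algebra_simps sum_subtractf sum_distrib_left sum_distrib_right)
    also have "\<dots> = z" using c(2) by (simp add: algebra_simps)
    finally have "z = (\<Sum>k\<in>I. ?c k * v k)" ..
    moreover have "?cw \<in> K \<inter> frob_image i"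
      using c q by (intro subring_set_diff[OF CR] subring_set_uminus[OF CR] subring_set_sum[OF CR]
          subring_set_mult[OF CR]) auto
    ultimately show ?thesis using c(1) by (intro exI[of _ ?c]) auto
  qed
qed

end

section \<open>Monomials\<close>

fun monomial :: "'a::comm_monoid_mult list \<Rightarrow> nat list \<Rightarrow> 'a" where
  "monomial (x # xs) (a # as) = x ^ a * monomial xs as"
| "monomial [] as = 1"
| "monomial xs [] = 1"

abbreviation box :: "nat list \<Rightarrow> nat list set" where
  "box qs \<equiv> listset (map lessThan qs)"

lemma set_Cons_eq: "set_Cons A T = (\<lambda>(a, as). a # as) ` (A \<times> T)"
  by (auto simp: set_Cons_def)

lemma finite_box: "finite (box qs)"
  by (induction qs) (auto simp: set_Cons_eq)

lemma sum_box_Cons: "(\<Sum>\<alpha>\<in>box (q # qs). f \<alpha>) = (\<Sum>a<q. \<Sum>\<alpha>\<in>box qs. f (a # \<alpha>))"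
proof -
  have "inj_on (\<lambda>(a, as). a # as) ({..<q} \<times> box qs)" by (auto simp: inj_on_def)
  then have "(\<Sum>\<alpha>\<in>box (q # qs). f \<alpha>) = (\<Sum>z\<in>{..<q} \<times> box qs. f (case z of (a, as) \<Rightarrow> a # as))"
    by (simp add: set_Cons_eq sum.reindex[unfolded o_def] del: case_prod_conv)
  also have "\<dots> = (\<Sum>a<q. \<Sum>\<alpha>\<in>box qs. f (a # \<alpha>))"
    by (simp add: sum.cartesian_product case_prod_beta)
  finally show ?thesis .
qed

lemma Cons_in_box_iff: "a # \<alpha> \<in> box (q # qs) \<longleftrightarrow> a < q \<and> \<alpha> \<in> box qs"
  by (auto simp: set_Cons_def)

lemma monomial_in: "subring_set N \<Longrightarrow> set xs \<subseteq> N \<Longrightarrow> monomial xs \<alpha> \<in> N"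
  by (induction xs \<alpha> rule: monomial.induct) (auto intro!: subring_set_closed)

lemma monomial_zeros: "monomial xs (map (\<lambda>_. 0) fs) = 1"
  by (induction xs "map (\<lambda>_. 0::nat) fs" arbitrary: fs rule: monomial.induct) (auto simp: Cons_eq_map_conv)

lemma monomial_power: "monomial xs \<alpha> ^ n = monomial xs (map ((*) n) \<alpha>)"
  by (induction xs \<alpha> rule: monomial.induct) (auto simp: power_mult_distrib mult.commute simp flip: power_mult)

lemma monomial_map_power: "monomial (map (\<lambda>x. x ^ n) xs) \<alpha> = monomial xs \<alpha> ^ n"
  by (induction xs \<alpha> rule: monomial.induct) (auto simp: power_mult_distrib mult.commute simp flip: power_mult)

text \<open>Coefficients are indexed by exponents, so equal monomials with different exponents count
  as dependent.\<close>

definition box_independent :: "'a::field set \<Rightarrow> 'a list \<Rightarrow> nat list \<Rightarrow> bool" where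
  "box_independent K xs qs \<longleftrightarrow>
    (\<forall>c. c ` box qs \<subseteq> K \<longrightarrow> (\<Sum>\<alpha>\<in>box qs. c \<alpha> * monomial xs \<alpha>) = 0 \<longrightarrow> (\<forall>\<alpha>\<in>box qs. c \<alpha> = 0))"

text \<open>One generator at a time by \<open>ring_adjoin_simple\<close>. The base is an arbitrary
  subring, since \<open>tower_socle\<close> expands over a ring larger than
  \<open>K\<close>.\<close>

lemma box_span:
  assumes T: "subring_set T" and q: "list_all2 (\<lambda>x q. 0 < q \<and> x ^ q \<in> T) xs qs"
    and z: "z \<in> ring_adjoin T (set xs)"
  shows "\<exists>c. range c \<subseteq> T \<and> z = (\<Sum>\<alpha>\<in>box qs. c \<alpha> * monomial xs \<alpha>)"
  using q z
proof (induction arbitrary: z rule: list_all2_induct)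
  case Nil
  then have "z \<in> T" using ring_adjoin_subset[OF T, of T "{}"] by auto
  then show ?case by (intro exI[of _ "\<lambda>_. z"]) auto
next
  case (Cons x xs q qs)
  have sub: "T \<subseteq> ring_adjoin T (set xs)" by (auto intro: ring_adjoin.base)
  have "z \<in> ring_adjoin (ring_adjoin T (set xs)) {x}"
    using Cons.prems by (simp add: ring_adjoin_insert[OF T])
  then have "z \<in> {\<Sum>a<q. c a * x ^ a | c. range c \<subseteq> ring_adjoin T (set xs)}"
    using ring_adjoin_simple[of "ring_adjoin T (set xs)" x q] subring_set_ring_adjoin[OF T] Cons.hyps sub by auto
  then obtain d where d: "range d \<subseteq> ring_adjoin T (set xs)" "z = (\<Sum>a<q. d a * x ^ a)" by auto
  have "\<forall>a. \<exists>c. range c \<subseteq> T \<and> d a = (\<Sum>\<alpha>\<in>box qs. c \<alpha> * monomial xs \<alpha>)"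
    using d by (intro allI Cons.IH) auto
  then obtain c where c: "\<And>a. range (c a) \<subseteq> T" "\<And>a. d a = (\<Sum>\<alpha>\<in>box qs. c a \<alpha> * monomial xs \<alpha>)"
    by metis
  let ?c = "\<lambda>\<alpha>. c (hd \<alpha>) (tl \<alpha>)"
  have "z = (\<Sum>\<alpha>\<in>box (q # qs). ?c \<alpha> * monomial (x # xs) \<alpha>)"
    unfolding sum_box_Cons d(2) c(2) by (simp add: sum_distrib_left algebra_simps)
  moreover have "range ?c \<subseteq> T" using c(1) by blast
  ultimately show ?case by blast
qed

text \<open>
  The field is built up from the tail of the list, and \<open>f\<close> is one less than the exponent of \<open>x\<close>: the last
  condition says that \<open>x\<close> still has exponent \<open>Suc f\<close> over the field generated by the tail.
\<close>

fun tower :: "'a::field set \<Rightarrow> 'a list \<Rightarrow> nat list \<Rightarrow> bool" where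
  "tower K [] [] \<longleftrightarrow> True"
| "tower K (x # xs) (f # fs) \<longleftrightarrow> tower K xs fs \<and> x ^ (CHAR('a) ^ Suc f) \<in> K \<and>
     x ^ (CHAR('a) ^ f) \<notin> ring_adjoin K (set xs)"
| "tower K _ _ \<longleftrightarrow> False"

lemma tower_list_all2:
  "tower K xs fs \<Longrightarrow> list_all2 (\<lambda>x f. (x :: 'a::field) ^ (CHAR('a) ^ Suc f) \<in> K) xs fs"
  by (induction K xs fs rule: tower.induct) auto

context insep_extension
begin

text \<open>Sorted by powers of the head, the coefficients lie in the ring generated by the tail,
  over which \<open>powers_independent\<close> applies to the head; the vanishing coefficients are
  then relations for the tail.\<close>

lemma tower_independent:
  "tower K xs fs \<Longrightarrow> box_independent K xs (map (\<lambda>f. CHAR('a) ^ Suc f) fs)"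
proof (induction xs fs rule: list_induct2')
  case 1
  then show ?case by (auto simp: box_independent_def)
next
  case (4 x xs f fs)
  let ?q = "CHAR('a) ^ Suc f" and ?qs = "map (\<lambda>f. CHAR('a) ^ Suc f) fs"
  have IH: "box_independent K xs ?qs" using 4 by simp
  show ?case
    unfolding box_independent_def
  proof (intro allI impI)
    fix c assume c: "c ` box (map (\<lambda>f. CHAR('a) ^ Suc f) (f # fs)) \<subseteq> K"
      and zero: "(\<Sum>\<alpha>\<in>box (map (\<lambda>f. CHAR('a) ^ Suc f) (f # fs)). c \<alpha> * monomial (x # xs) \<alpha>) = 0"
    have cK: "c (a # \<alpha>) \<in> K" if "a < ?q" "\<alpha> \<in> box ?qs" for a \<alpha>
      using c that Cons_in_box_iff[of a \<alpha> ?q ?qs] by (auto simp: image_subset_iff simp del: listset.simps)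
    define d where "d a = (\<Sum>\<alpha>\<in>box ?qs. c (a # \<alpha>) * monomial xs \<alpha>)" for a
    have dsum: "(\<Sum>a<?q. d a * x ^ a) = 0"
    proof -
      have "(\<Sum>\<alpha>\<in>box (?q # ?qs). c \<alpha> * monomial (x # xs) \<alpha>) = 0" using zero by simp
      then show ?thesis
        unfolding sum_box_Cons d_def by (simp add: sum_distrib_left sum_distrib_right algebra_simps del: power_Suc)
    qed
    have dN: "d a \<in> ring_adjoin K (set xs)" if "a < ?q" for a
      unfolding d_def using cK[OF that]
      by (intro subring_set_sum subring_set_mult subring_adjoin monomial_in)
        (auto intro: ring_adjoin.base ring_adjoin.incl)
    have "d a = 0" if "a < ?q" for a
      by (rule powers_independent[OF subfield_adjoin char _ _ dN dsum that])
        (use 4 in \<open>auto intro: ring_adjoin.base\<close>)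
    then have "c (a # \<alpha>) = 0" if "a < ?q" "\<alpha> \<in> box ?qs" for a \<alpha>
      using IH[unfolded box_independent_def, rule_format, of "\<lambda>\<alpha>. c (a # \<alpha>)"] that cK
      by (auto simp: d_def)
    then show "\<forall>\<alpha>\<in>box (map (\<lambda>f. CHAR('a) ^ Suc f) (f # fs)). c \<alpha> = 0"
      by (auto simp: set_Cons_def)
  qed
qed auto

section \<open>Elements with \<open>p\<close>-th power in the base field\<close>

lemma map_mult_box: "\<gamma> \<in> box (map (\<lambda>f. CHAR('a) ^ f) fs) \<Longrightarrow>
    map ((*) CHAR('a)) \<gamma> \<in> box (map (\<lambda>f. CHAR('a) ^ Suc f) fs)"
  using char by (induction fs arbitrary: \<gamma>) (auto simp: set_Cons_def)

lemma zeros_box: "map (\<lambda>_. 0) fs \<in> box (map (\<lambda>f. CHAR('a) ^ f) fs)"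
  using char by (induction fs) (auto simp: set_Cons_def)

text \<open>Expand \<open>z\<close> in monomials with exponents \<gamma> below \<open>p ^ f\<close>,
  with coefficients \<open>s \<gamma>\<close> in \<open>?T\<close>; all \<open>p\<close>-th powers
  of \<open>?T\<close> lie in \<open>K\<close>. Then \<open>z ^ p\<close> is the sum of the
  \<open>s \<gamma> ^ p\<close> times the monomials of \<open>p * \<gamma>\<close>, which stay in
  the box of \<open>tower_independent\<close>. As \<open>z ^ p \<in> K\<close>, only the zero
  exponent survives, and \<open>z\<close> equals its coefficient there.\<close>

lemma tower_socle:
  assumes tower: "tower K xs fs" and z: "z \<in> ring_adjoin K (set xs)" "z ^ CHAR('a) \<in> K"
  shows "z \<in> ring_adjoin K (set (map2 (\<lambda>x f. x ^ (CHAR('a) ^ f)) xs fs))"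
proof -
  let ?ys = "map2 (\<lambda>x f. x ^ (CHAR('a) ^ f)) xs fs"
  let ?T = "ring_adjoin K (set ?ys)"
  let ?qs = "map (\<lambda>f. CHAR('a) ^ f) fs" and ?Q = "map (\<lambda>f. CHAR('a) ^ Suc f) fs"
  let ?z = "map (\<lambda>_. 0) fs :: nat list"
  have len: "length xs = length fs" using tower_list_all2[OF tower] by (rule list_all2_lengthD)
  have ys: "y ^ CHAR('a) \<in> K" if "y \<in> set ?ys" for y
  proof -
    obtain k where k: "k < length xs" "y = (xs ! k) ^ (CHAR('a) ^ (fs ! k))"
      using \<open>y \<in> set ?ys\<close> len by (auto simp: in_set_conv_nth)
    then have "(xs ! k) ^ (CHAR('a) ^ Suc (fs ! k)) \<in> K"
      using tower_list_all2[OF tower] by (auto dest: list_all2_nthD)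
    then show ?thesis using k by (simp add: power_mult[symmetric] mult.commute)
  qed
  have T: "t ^ CHAR('a) \<in> K" if "t \<in> ?T" for t
    using that
  proof (induction rule: ring_adjoin.induct)
    case (add x y)
    then show ?case using frobenius_add[OF char, of x y 1] by (simp add: subring_set_add[OF KR])
  qed (use ys in \<open>auto simp: power_mult_distrib intro: subring_set_mult[OF KR] subring_set_power[OF KR]\<close>)
  have "list_all2 (\<lambda>x q. 0 < q \<and> x ^ q \<in> ?T) xs ?qs"
    using len char by (force simp: list_all2_conv_all_nth in_set_conv_nth intro: ring_adjoin.incl)
  moreover have "ring_adjoin K (set xs) \<subseteq> ring_adjoin ?T (set xs)"
    by (rule ring_adjoin_subset) (auto intro: ring_adjoin.intros subring_set_ring_adjoin subring_adjoin)
  ultimately obtain s where s: "range s \<subseteq> ?T" "z = (\<Sum>\<gamma>\<in>box ?qs. s \<gamma> * monomial xs \<gamma>)"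
    using box_span[OF subring_adjoin, of "set ?ys" xs ?qs z] z by auto
  let ?h = "map ((*) CHAR('a))"
  have inj: "inj ?h" using char by (intro inj_mapI) (auto simp: inj_def)
  define g where "g = map (\<lambda>n. n div CHAR('a))"
  have gh: "g (?h \<gamma>) = \<gamma>" for \<gamma> using char by (simp add: g_def o_def)
  \<comment> \<open>The expansion of \<open>z ^ p\<close> minus the constant \<open>z ^ p\<close>,
    as a coefficient function on the larger box; \<open>g\<close> recovers \<gamma> from
    \<open>p * \<gamma>\<close>.\<close>
  define c where "c \<beta> = (if \<beta> \<in> ?h ` box ?qs then s (g \<beta>) ^ CHAR('a) else 0)
      - (if \<beta> = ?z then z ^ CHAR('a) else 0)" for \<beta>
  have zh: "?h ?z = ?z" by simp
  have zQ: "?z \<in> box ?Q" using map_mult_box[OF zeros_box[of fs]] unfolding zh .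
  have sK: "s \<gamma> ^ CHAR('a) \<in> K" for \<gamma> using s by (intro T) auto
  have "(\<Sum>\<beta>\<in>box ?Q. (if \<beta> \<in> ?h ` box ?qs then s (g \<beta>) ^ CHAR('a) else 0) * monomial xs \<beta>)
      = (\<Sum>\<beta>\<in>?h ` box ?qs. s (g \<beta>) ^ CHAR('a) * monomial xs \<beta>)"
    using map_mult_box by (intro sum.mono_neutral_cong_right finite_box) auto
  also have "\<dots> = (\<Sum>\<gamma>\<in>box ?qs. s \<gamma> ^ CHAR('a) * monomial xs (?h \<gamma>))"
    using inj by (subst sum.reindex) (auto simp: gh intro: inj_on_subset)
  also have "\<dots> = z ^ CHAR('a)"
    using frobenius_sum[OF char, of "\<lambda>\<gamma>. s \<gamma> * monomial xs \<gamma>" "box ?qs" 1]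
    by (simp add: s(2) power_mult_distrib monomial_power)
  finally have "(\<Sum>\<beta>\<in>box ?Q. (if \<beta> \<in> ?h ` box ?qs then s (g \<beta>) ^ CHAR('a) else 0) * monomial xs \<beta>)
      = z ^ CHAR('a)" .
  moreover have "(\<Sum>\<beta>\<in>box ?Q. (if \<beta> = ?z then z ^ CHAR('a) else 0) * monomial xs \<beta>) = z ^ CHAR('a)"
    using zQ by (subst sum.remove[OF finite_box zQ]) (auto simp: monomial_zeros intro!: sum.neutral)
  ultimately have "(\<Sum>\<beta>\<in>box ?Q. c \<beta> * monomial xs \<beta>) = 0"
    unfolding c_def left_diff_distrib sum_subtractf by simp
  moreover have "c ` box ?Q \<subseteq> K"
    using sK z(2) by (auto simp: c_def intro!: subring_set_diff[OF KR] subring_set_zero[OF KR])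
  ultimately have c0: "c \<beta> = 0" if "\<beta> \<in> box ?Q" for \<beta>
    using tower_independent[OF tower] that unfolding box_independent_def by blast
  have "s \<gamma> = 0" if "\<gamma> \<in> box ?qs" "\<gamma> \<noteq> ?z" for \<gamma>
  proof -
    have "?h \<gamma> \<noteq> ?z" using that zh gh by metis
    then have "s \<gamma> ^ CHAR('a) = 0"
      using c0[OF map_mult_box[OF that(1)]] that by (simp add: c_def gh)
    then show ?thesis by simp
  qed
  then have "z = s ?z"
    unfolding s(2) by (subst sum.remove[OF finite_box zeros_box]) (auto simp: monomial_zeros)
  then show ?thesis using s(1) by auto
qed

text \<open>Descending in \<open>j\<close>, take a longest tower with entries at least
  \<open>j\<close> that is adapted for \<open>l > j\<close>. If \<open>y = x ^ (p ^ j)\<close> with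
  \<open>y ^ p \<in> K\<close> were outside the generated ring, \<open>x\<close> with entry
  \<open>j\<close> could be put in front. So \<open>y\<close> is inside, and
  \<open>tower_socle\<close> with \<open>j \<le> f\<close> places it in the ring generated by the
  \<open>p ^ j\<close>-th powers.\<close>

lemma ex_tower_socle:
  assumes e: "frob_image e \<subseteq> K" and bound: "\<And>xs fs. tower K xs fs \<Longrightarrow> length xs \<le> d" and j: "j \<le> e"
  shows "\<exists>xs fs. tower K xs fs \<and> (\<forall>f\<in>set fs. j \<le> f) \<and>
    (\<forall>l\<ge>j. \<forall>y\<in>frob_image l. y ^ CHAR('a) \<in> K \<longrightarrow> y \<in> ring_adjoin K ((\<lambda>x. x ^ (CHAR('a) ^ l)) ` set xs))"
  using j
proof (induction rule: inc_induct)
  case base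
  show ?case
    using frob_image_antimono[where 'a = 'a, of e] e
    by (intro exI[of _ "[]"]) (auto intro!: ring_adjoin.base)
next
  case (step j)
  let ?soc = "\<lambda>l xs. \<forall>y\<in>frob_image l. y ^ CHAR('a) \<in> K \<longrightarrow> y \<in> ring_adjoin K ((\<lambda>x. x ^ (CHAR('a) ^ l)) ` set xs)"
  let ?Q = "\<lambda>(xs, fs). tower K xs fs \<and> (\<forall>f\<in>set fs. j \<le> f) \<and> (\<forall>l\<ge>Suc j. ?soc l xs)"
  have "\<exists>r. ?Q r" using step.IH by (auto intro: Suc_leD)
  then obtain r0 where "?Q r0" ..
  \<comment> \<open>Towers have bounded length, so a longest one with the property exists.\<close>
  moreover have "\<forall>r. ?Q r \<longrightarrow> length (fst r) < Suc d" using bound by (auto simp: less_Suc_eq_le)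
  ultimately have "\<exists>r. ?Q r \<and> (\<forall>r'. ?Q r' \<longrightarrow> length (fst r') \<le> length (fst r))"
    by (rule Lattices_Big.ex_has_greatest_nat)
  then obtain r where r: "?Q r" "\<forall>r'. ?Q r' \<longrightarrow> length (fst r') \<le> length (fst r)"
    by (elim exE conjE)
  obtain xs fs where eq: "r = (xs, fs)" by (cases r)
  have Q: "?Q (xs, fs)" using r(1) unfolding eq .
  have max: "length xs' \<le> length xs" if "?Q (xs', fs')" for xs' fs'
    using r(2)[rule_format, OF that] unfolding eq by (simp only: fst_conv)
  have "?soc j xs"
  proof (intro ballI impI)
    fix y assume y: "y \<in> frob_image j" "y ^ CHAR('a) \<in> K"
    then obtain x where x: "y = x ^ (CHAR('a) ^ j)" by (auto simp: frob_image_def)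
    have yin: "y \<in> ring_adjoin K (set xs)"
    proof (rule ccontr)
      assume n: "y \<notin> ring_adjoin K (set xs)"
      \<comment> \<open>Lengthening the list only enlarges the generated rings, so the property
        already secured for larger \<open>l\<close> persists.\<close>
      have "?soc l (x # xs)" if "?soc l xs" for l
        using that ring_adjoin_mono[of "(\<lambda>x. x ^ (CHAR('a) ^ l)) ` set xs" "(\<lambda>x. x ^ (CHAR('a) ^ l)) ` set (x # xs)" K]
        by auto
      moreover have "x ^ (CHAR('a) ^ Suc j) \<in> K" using y x by (simp add: power_mult[symmetric] mult.commute)
      ultimately have "?Q (x # xs, j # fs)" using Q n x by (simp del: power_Suc) 
      then show False using max[of "x # xs" "j # fs"] by simp
    qed
    have len: "length xs = length fs" using Q list_all2_lengthD[OF tower_list_all2, of K xs fs] by simp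
    have "ring_adjoin K (set (map2 (\<lambda>x f. x ^ (CHAR('a) ^ f)) xs fs)) \<subseteq> ring_adjoin K ((\<lambda>x. x ^ (CHAR('a) ^ j)) ` set xs)"
    proof (rule ring_adjoin_subset[OF subring_adjoin])
      show "set (map2 (\<lambda>x f. x ^ (CHAR('a) ^ f)) xs fs) \<subseteq> ring_adjoin K ((\<lambda>x. x ^ (CHAR('a) ^ j)) ` set xs)"
      proof
        fix u assume "u \<in> set (map2 (\<lambda>x f. x ^ (CHAR('a) ^ f)) xs fs)"
        then obtain x f where xf: "x \<in> set xs" "f \<in> set fs" "u = x ^ (CHAR('a) ^ f)"
          by (auto dest: set_zip_leftD set_zip_rightD)
        then have "j \<le> f" using Q by auto
        then have "u = (x ^ (CHAR('a) ^ j)) ^ (CHAR('a) ^ (f - j))"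
          using xf by (simp add: power_mult[symmetric] power_add[symmetric])
        then show "u \<in> ring_adjoin K ((\<lambda>x. x ^ (CHAR('a) ^ j)) ` set xs)"
          using xf(1) by (simp only:) (intro subring_set_power[OF subring_adjoin] ring_adjoin.incl imageI)
      qed
    qed (auto intro: ring_adjoin.base)
    then show "y \<in> ring_adjoin K ((\<lambda>x. x ^ (CHAR('a) ^ j)) ` set xs)"
      using tower_socle[of xs fs y] Q yin y by auto
  qed
  then have "\<forall>l\<ge>j. ?soc l xs" using Q by (metis (no_types, lifting) case_prodD le_neq_implies_less Suc_le_eq)
  then show ?case using Q by auto
qed

text \<open>Downward induction on \<open>j\<close>. For \<open>z\<close> in
  \<open>frob_image j\<close>, \<open>z ^ p\<close> is a combination of monomials in the
  \<open>x ^ (p ^ (j + 1))\<close>. By \<open>rat\<close> its coefficients can be taken in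
  \<open>K \<inter> frob_image (Suc j)\<close>; they are \<open>d ^ p\<close> with
  \<open>d \<in> frob_image j\<close>, and \<open>soc\<close> puts \<open>d\<close> into the ring
  generated by the \<open>x ^ (p ^ j)\<close>. Injectivity of Frobenius yields \<open>z\<close>
  itself.\<close>

lemma ex_tower_generating:
  assumes e: "frob_image e \<subseteq> K" and bound: "\<And>xs fs. tower K xs fs \<Longrightarrow> length xs \<le> d"
    and rat: "\<And>i I (m :: nat list \<Rightarrow> 'a) v z. 1 \<le> i \<Longrightarrow> finite I \<Longrightarrow> m ` I \<subseteq> K \<Longrightarrow> v ` I \<subseteq> frob_image i \<Longrightarrow>
      z \<in> frob_image i \<Longrightarrow> z = (\<Sum>k\<in>I. m k * v k) \<Longrightarrow>
      \<exists>c. c ` I \<subseteq> K \<inter> frob_image i \<and> z = (\<Sum>k\<in>I. c k * v k)"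
  obtains xs fs where "tower K xs fs" "ring_adjoin K (set xs) = UNIV"
proof -
  obtain xs fs where tower: "tower K xs fs"
    and soc: "\<And>l y. y \<in> frob_image l \<Longrightarrow> y ^ CHAR('a) \<in> K \<Longrightarrow> y \<in> ring_adjoin K ((\<lambda>x. x ^ (CHAR('a) ^ l)) ` set xs)"
    using ex_tower_socle[where j = 0 and d = d, OF e] bound by blast
  have "frob_image j \<subseteq> ring_adjoin K ((\<lambda>x. x ^ (CHAR('a) ^ j)) ` set xs)" if "j \<le> e" for j
    using that
  proof (induction rule: inc_induct)
    case base
    then show ?case using e by (auto intro: ring_adjoin.base)
  next
    case (step j)
    let ?ys = "map (\<lambda>x. x ^ (CHAR('a) ^ Suc j)) xs" and ?ys' = "map (\<lambda>x. x ^ (CHAR('a) ^ j)) xs"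
    \<comment> \<open>Only spanning is used here, so the crude exponent \<open>p ^ e\<close> serves
      for every generator.\<close>
    let ?qs = "map (\<lambda>_. CHAR('a) ^ e) xs"
    let ?N = "ring_adjoin K ((\<lambda>x. x ^ (CHAR('a) ^ j)) ` set xs)"
    have F: "subfield_set (frob_image i :: 'a set)" for i using char by (rule subfield_set_frob_image)
    show ?case
    proof
      fix z :: 'a assume z: "z \<in> frob_image j"
      then have zp: "z ^ CHAR('a) \<in> frob_image (Suc j)" using power_in_frob_image[of z j 1] by simp
      have "y ^ (CHAR('a) ^ e) \<in> K" for y using e by (auto simp: frob_image_def)
      then have "list_all2 (\<lambda>x q. 0 < q \<and> x ^ q \<in> K) ?ys ?qs"
        using char by (simp add: list_all2_conv_all_nth del: power_Suc)
      moreover have "z ^ CHAR('a) \<in> ring_adjoin K (set ?ys)" using step.IH zp by auto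
      ultimately obtain c where c: "range c \<subseteq> K" "z ^ CHAR('a) = (\<Sum>\<alpha>\<in>box ?qs. c \<alpha> * monomial ?ys \<alpha>)"
        using box_span[OF KR] by blast
      have "monomial ?ys \<alpha> \<in> frob_image (Suc j)" for \<alpha>
        by (rule monomial_in[OF subfield_set_subring[OF F]]) (auto simp: frob_image_def)
      then have v: "monomial ?ys ` box ?qs \<subseteq> frob_image (Suc j)" by blast
      have m: "c ` box ?qs \<subseteq> K" using c(1) by blast
      obtain c' where c': "c' ` box ?qs \<subseteq> K \<inter> frob_image (Suc j)"
          "z ^ CHAR('a) = (\<Sum>\<alpha>\<in>box ?qs. c' \<alpha> * monomial ?ys \<alpha>)"
        using rat[OF _ finite_box m v zp c(2)] unfolding One_nat_def by (meson Suc_le_mono le0)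
      have "\<forall>\<alpha>\<in>box ?qs. \<exists>d\<in>frob_image j. d ^ CHAR('a) = c' \<alpha>"
      proof
        fix \<alpha> assume "\<alpha> \<in> box ?qs"
        then obtain u where "c' \<alpha> = u ^ (CHAR('a) ^ Suc j)" using c'(1) unfolding frob_image_def by blast
        then have "(u ^ (CHAR('a) ^ j)) ^ CHAR('a) = c' \<alpha>" by (simp add: power_mult[symmetric] mult.commute)
        then show "\<exists>d\<in>frob_image j. d ^ CHAR('a) = c' \<alpha>" by (auto simp: frob_image_def)
      qed
      then obtain d where d: "\<And>\<alpha>. \<alpha> \<in> box ?qs \<Longrightarrow> d \<alpha> \<in> frob_image j \<and> d \<alpha> ^ CHAR('a) = c' \<alpha>"
        by metis
      have dN: "d \<alpha> \<in> ?N" if "\<alpha> \<in> box ?qs" for \<alpha>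
        using d[OF that] c'(1) that by (intro soc) auto
      have "monomial ?ys \<alpha> = monomial ?ys' \<alpha> ^ CHAR('a)" for \<alpha>
        by (simp add: monomial_map_power power_mult[symmetric] mult.commute)
      then have "z ^ CHAR('a) = (\<Sum>\<alpha>\<in>box ?qs. (d \<alpha> * monomial ?ys' \<alpha>) ^ CHAR('a))"
        unfolding c'(2) using d by (intro sum.cong) (auto simp: power_mult_distrib)
      also have "\<dots> = (\<Sum>\<alpha>\<in>box ?qs. d \<alpha> * monomial ?ys' \<alpha>) ^ CHAR('a)"
        by (rule sym) (use frobenius_sum[OF char, of _ _ 1] in \<open>simp only: power_one_right\<close>)
      finally have "z = (\<Sum>\<alpha>\<in>box ?qs. d \<alpha> * monomial ?ys' \<alpha>)"
        using frobenius_inj[OF char, of z 1] by simp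
      moreover have "monomial ?ys' \<alpha> \<in> ?N" for \<alpha>
        by (rule monomial_in[OF subring_adjoin]) (auto intro: ring_adjoin.incl)
      ultimately show "z \<in> ?N"
        by (simp only:) (intro subring_set_sum[OF subring_adjoin] subring_set_mult[OF subring_adjoin] dN)
    qed
  qed
  from this[of 0] show ?thesis using tower that by auto
qed

end

section \<open>A length bound for towers\<close>

lemma Span_subset_ring_adjoin:
  fixes K :: "'a::field set"
  assumes K: "subfield K (ring_of_type_algebra :: 'a ring)"
  shows "ring.Span (ring_of_type_algebra :: 'a ring) K us \<subseteq> ring_adjoin K (set us)"
proof -
  let ?R = "ring_of_type_algebra :: 'a ring"
  interpret R: field ?R by (rule field_from_type_algebra)
  note ops = type_algebra_ops
  have K0: "0 \<in> K" using R.subring_props(2)[OF K] by (simp add: ops)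
  show ?thesis
  proof (induction us)
    case Nil
    then show ?case using K0 by (auto simp: ops intro: ring_adjoin.base)
  next
    case (Cons u us)
    have "ring_adjoin K (set us) \<subseteq> ring_adjoin K (set (u # us))" by (rule ring_adjoin_mono) auto
    then have "k * u + v \<in> ring_adjoin K (set (u # us))" if "k \<in> K" "v \<in> R.Span K us" for k v
      using that Cons by (intro ring_adjoin.add ring_adjoin.mult) (auto intro: ring_adjoin.intros)
    then show ?case by (auto simp: R.line_extension_mem_iff ops)
  qed
qed

text \<open>If \<open>x\<close> were in the linear span of the tail, its positive powers would lie
  in the ring generated by the tail, against the tower condition; so the members are linearly
  independent.\<close>

lemma tower_length_le:
  fixes K :: "'a::field set"
  assumes K: "subfield K (ring_of_type_algebra :: 'a ring)" and char: "CHAR('a) > 0"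
    and dim: "ring.dimension (ring_of_type_algebra :: 'a ring) n K UNIV" and tower: "tower K xs fs"
  shows "length xs \<le> n"
proof -
  let ?R = "ring_of_type_algebra :: 'a ring"
  interpret R: field ?R by (rule field_from_type_algebra)
  have "R.independent K xs"
    using tower
  proof (induction xs fs rule: list_induct2')
    case (4 x xs f fs)
    have "x \<notin> ring_adjoin K (set xs)"
    proof
      assume x: "x \<in> ring_adjoin K (set xs)"
      have "x ^ Suc n \<in> ring_adjoin K (set xs)" for n
        by (induction n) (use x in \<open>auto intro: ring_adjoin.mult\<close>)
      then have "x ^ (CHAR('a) ^ f) \<in> ring_adjoin K (set xs)"
        using char by (metis Suc_pred zero_less_power)
      then show False using 4 by simp
    qed
    then show ?case using 4 Span_subset_ring_adjoin[OF K, of xs] by (auto simp: type_algebra_ops intro!: R.li_Cons)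
  qed auto
  then show ?thesis
    using R.independent_length_le_dimension[OF K dim] by simp
qed

section \<open>The multiplication map of the tensor product\<close>

lemma lookup_map_times:
  fixes c :: "'a::field" shows "Poly_Mapping.lookup (Poly_Mapping.map ((*) c) f) t = c * Poly_Mapping.lookup f t"
  by (simp add: map.rep_eq when_def)

lemma sum_single_eq:
  assumes "finite S" "Poly_Mapping.keys f \<subseteq> S"
  shows "(\<Sum>t\<in>S. Poly_Mapping.single t (Poly_Mapping.lookup f t)) = f"
  by (rule poly_mapping_eqI)
    (use assms in \<open>auto simp: lookup_sum lookup_single when_def sum.delta in_keys_iff\<close>)

lemma listset_iff: "ts \<in> listset Ms \<longleftrightarrow> length ts = length Ms \<and> (\<forall>j<length Ms. ts ! j \<in> Ms ! j)"
proof -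
  have "ts \<in> listset Ms \<longleftrightarrow> list_all2 (\<in>) ts Ms"
    by (induction Ms arbitrary: ts) (auto simp: set_Cons_def list_all2_Cons2)
  then show ?thesis by (auto simp: list_all2_conv_all_nth)
qed

lemma tensor_relations_uminus:
  assumes "subring_set K" "f \<in> tensor_relations K Ms" shows "- f \<in> tensor_relations K Ms"
proof -
  have "- f = Poly_Mapping.map ((*) (- 1)) f" by (rule poly_mapping_eqI) (simp add: lookup_map_times)
  then show ?thesis
    using assms by (simp add: tensor_relations.scale subring_set_uminus subring_set_one)
qed

lemma tensor_relations_diff:
  assumes "subring_set K" "f \<in> tensor_relations K Ms" "g \<in> tensor_relations K Ms"
  shows "f - g \<in> tensor_relations K Ms"
  using tensor_relations.add[OF assms(2) tensor_relations_uminus[OF assms(1,3)]] by simp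

lemma free_module_diff:
  assumes "subring_set K" "f \<in> free_module K T" "g \<in> free_module K T"
  shows "f - g \<in> free_module K T"
  using assms keys_diff[of f g]
  by (auto simp: free_module_def lookup_minus intro!: subring_set_diff)

lemma free_module_zero: "subring_set K \<Longrightarrow> 0 \<in> free_module K T"
  by (auto simp: free_module_def intro: subring_set_zero)

lemma free_module_single: "subring_set K \<Longrightarrow> c \<in> K \<Longrightarrow> t \<in> T \<Longrightarrow> Poly_Mapping.single t c \<in> free_module K T"
  by (auto simp: free_module_def lookup_single when_def subring_set_zero)

lemma free_module_add:
  assumes "subring_set K" "f \<in> free_module K T" "g \<in> free_module K T"
  shows "f + g \<in> free_module K T"
  using assms keys_add[of f g]
  by (auto simp: free_module_def lookup_add intro!: subring_set_add)

lemma free_module_sum: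
  "subring_set K \<Longrightarrow> (\<And>i. i \<in> I \<Longrightarrow> f i \<in> free_module K T) \<Longrightarrow> sum f I \<in> free_module K T"
  by (induction I rule: infinite_finite_induct) (auto intro: free_module_zero free_module_add)

lemma mult_eval_sum: "mult_eval (sum f I) = (\<Sum>i\<in>I. mult_eval (f i))"
  by (induction I rule: infinite_finite_induct) (simp_all add: mult_eval_add, simp_all add: mult_eval_def)

lemma mult_eval_zero [simp]: "mult_eval 0 = 0"
  by (simp add: mult_eval_def)

text \<open>Two classes agree when their difference is a relation, so bijectivity becomes a kernel
  and a surjectivity condition on the free module, and the quotient disappears from the
  argument.\<close>

lemma bij_tensor_mult_iff:
  fixes K :: "'a::field set"
  assumes K: "subring_set K"
  shows "bij_betw tensor_mult (tensor_product K Ms) UNIV \<longleftrightarrow>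
    (\<forall>f\<in>free_module K (listset Ms). mult_eval f = 0 \<longrightarrow> f \<in> tensor_relations K Ms) \<and>
    mult_eval ` free_module K (listset Ms) = UNIV"
proof -
  let ?F = "free_module K (listset Ms)" and ?R = "tensor_relations K Ms"
  define E where "E = {(f, g). f \<in> ?F \<and> g \<in> ?F \<and> f - g \<in> ?R}"
  have tp: "tensor_product K Ms = (\<lambda>f. E `` {f}) ` ?F"
    unfolding tensor_product_def E_def quotient_def by blast
  have self: "f \<in> E `` {f}" if "f \<in> ?F" for f
    using that tensor_relations.zero[of K Ms] by (simp add: E_def)
  have val: "tensor_mult (E `` {f}) = mult_eval f" if "f \<in> ?F" for f
  proof -
    have "mult_eval ` (E `` {f}) = {mult_eval f}"
      using self[OF that] by (auto simp: E_def dest: mult_eval_cong)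
    then show ?thesis by (simp add: tensor_mult_def)
  qed
  have cls: "E `` {f} = E `` {g} \<longleftrightarrow> f - g \<in> ?R" if "f \<in> ?F" "g \<in> ?F" for f g
  proof
    assume "E `` {f} = E `` {g}"
    then have "g \<in> E `` {f}" using self[OF that(2)] by simp
    then show "f - g \<in> ?R" by (simp add: E_def)
  next
    assume fg: "f - g \<in> ?R"
    have "f - h \<in> ?R \<longleftrightarrow> g - h \<in> ?R" for h
      using tensor_relations.add[OF fg, of "g - h"] tensor_relations_diff[OF K _ fg, of "f - h"] by auto
    then show "E `` {f} = E `` {g}" using that by (auto simp: E_def)
  qed
  have "bij_betw tensor_mult (tensor_product K Ms) UNIV \<longleftrightarrow>
      (\<forall>f\<in>?F. \<forall>g\<in>?F. mult_eval f = mult_eval g \<longrightarrow> f - g \<in> ?R) \<and> mult_eval ` ?F = UNIV"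
    by (simp add: bij_betw_def inj_on_def tp val cls image_image)
  also have "(\<forall>f\<in>?F. \<forall>g\<in>?F. mult_eval f = mult_eval g \<longrightarrow> f - g \<in> ?R) \<longleftrightarrow>
      (\<forall>f\<in>?F. mult_eval f = 0 \<longrightarrow> f \<in> ?R)"
  proof safe
    fix f assume "\<forall>f\<in>?F. \<forall>g\<in>?F. mult_eval f = mult_eval g \<longrightarrow> f - g \<in> ?R" "f \<in> ?F" "mult_eval f = 0"
    then have "f - 0 \<in> ?R" using free_module_zero[OF K] mult_eval_zero by metis
    then show "f \<in> ?R" by simp
  next
    fix f g assume "\<forall>f\<in>?F. mult_eval f = 0 \<longrightarrow> f \<in> ?R" "f \<in> ?F" "g \<in> ?F" "mult_eval f = mult_eval g"
    then show "f - g \<in> ?R" by (simp add: free_module_diff[OF K] mult_eval_diff)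
  qed
  finally show ?thesis .
qed

text \<open>Repeated \<open>slot_add\<close> and \<open>slot_scale\<close>; this rewrites a tuple
  slot by slot into tuples of powers.\<close>

lemma slot_expand:
  fixes m :: nat
  assumes K: "subring_set K" and ts: "ts \<in> listset Ms" and i: "i < length Ms"
    and M: "\<And>a b. a \<in> Ms ! i \<Longrightarrow> b \<in> Ms ! i \<Longrightarrow> a + b \<in> Ms ! i" "\<And>c a. c \<in> K \<Longrightarrow> a \<in> Ms ! i \<Longrightarrow> c * a \<in> Ms ! i"
      "0 \<in> Ms ! i"
    and u: "\<And>a. u a \<in> Ms ! i" and c: "\<And>a. c a \<in> K"
  shows "Poly_Mapping.single (ts[i := \<Sum>a<m. c a * u a]) 1
    - (\<Sum>a<m. Poly_Mapping.single (ts[i := u a]) (c a)) \<in> tensor_relations K Ms"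
proof (induction m)
  case 0
  \<comment> \<open>For the empty sum, \<open>slot_scale\<close> with scalar \<open>0\<close> shows
    that a tuple with entry \<open>0\<close> is a relation.\<close>
  show ?case using tensor_relations.slot_scale[OF ts i M(3) subring_set_zero[OF K]] by simp
next
  case (Suc m)
  let ?s = "\<Sum>a<m. c a * u a"
  have "?s \<in> Ms ! i" by (induction m) (auto intro: M u c)
  then have 1: "Poly_Mapping.single (ts[i := ?s + c m * u m]) 1 - Poly_Mapping.single (ts[i := ?s]) 1
      - Poly_Mapping.single (ts[i := c m * u m]) 1 \<in> tensor_relations K Ms"
    by (intro tensor_relations.slot_add ts i M u c)
  have 2: "Poly_Mapping.single (ts[i := c m * u m]) 1 - Poly_Mapping.single (ts[i := u m]) (c m)
      \<in> tensor_relations K Ms"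
    by (intro tensor_relations.slot_scale ts i u c)
  from tensor_relations.add[OF tensor_relations.add[OF 1 Suc.IH] 2] show ?case
    by (simp add: algebra_simps)
qed

text \<open>The linear form on the free module induced by \<phi>; \<open>mult_eval\<close> is the
  case of \<open>prod_list\<close>. For multilinear \<phi> it vanishes on the relations and can
  therefore exclude elements from them.\<close>

definition multilinear_eval :: "('a::field list \<Rightarrow> 'a) \<Rightarrow> ('a list \<Rightarrow>\<^sub>0 'a) \<Rightarrow> 'a" where
  "multilinear_eval \<phi> f = (\<Sum>ts\<in>Poly_Mapping.keys f. Poly_Mapping.lookup f ts * \<phi> ts)"

lemma multilinear_eval_superset:
  assumes "finite S" "Poly_Mapping.keys f \<subseteq> S"
  shows "multilinear_eval \<phi> f = (\<Sum>ts\<in>S. Poly_Mapping.lookup f ts * \<phi> ts)"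
  unfolding multilinear_eval_def
  by (rule sum.mono_neutral_left) (use assms in \<open>auto simp: in_keys_iff\<close>)

lemma multilinear_eval_add: "multilinear_eval \<phi> (f + g) = multilinear_eval \<phi> f + multilinear_eval \<phi> g"
proof -
  have "Poly_Mapping.keys (f + g) \<subseteq> Poly_Mapping.keys f \<union> Poly_Mapping.keys g" by (rule keys_add)
  then show ?thesis
    by (simp add: multilinear_eval_superset[of "Poly_Mapping.keys f \<union> Poly_Mapping.keys g"] lookup_add sum.distrib distrib_right)
qed

lemma multilinear_eval_diff: "multilinear_eval \<phi> (f - g) = multilinear_eval \<phi> f - multilinear_eval \<phi> g"
  using multilinear_eval_add[of \<phi> "f - g" g] by simp

lemma multilinear_eval_sum: "multilinear_eval \<phi> (sum f I) = (\<Sum>i\<in>I. multilinear_eval \<phi> (f i))"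
  by (induction I rule: infinite_finite_induct) (simp_all add: multilinear_eval_add, simp_all add: multilinear_eval_def)

lemma multilinear_eval_single [simp]: "multilinear_eval \<phi> (Poly_Mapping.single ts c) = c * \<phi> ts"
  by (simp add: multilinear_eval_def)

lemma multilinear_eval_scale: "multilinear_eval \<phi> (Poly_Mapping.map ((*) c) f) = c * multilinear_eval \<phi> f"
proof -
  have "Poly_Mapping.keys (Poly_Mapping.map ((*) c) f) \<subseteq> Poly_Mapping.keys f"
    by (auto simp: in_keys_iff lookup_map_times)
  then show ?thesis
    by (simp add: multilinear_eval_superset[of "Poly_Mapping.keys f"] lookup_map_times sum_distrib_left mult.assoc)
qed

lemma multilinear_eval_relations:
  assumes add: "\<And>ts i a b. ts \<in> listset Ms \<Longrightarrow> i < length Ms \<Longrightarrow> a \<in> Ms ! i \<Longrightarrow> b \<in> Ms ! i \<Longrightarrow>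
      \<phi> (ts[i := a + b]) = \<phi> (ts[i := a]) + \<phi> (ts[i := b])"
    and scale: "\<And>ts i a c. ts \<in> listset Ms \<Longrightarrow> i < length Ms \<Longrightarrow> a \<in> Ms ! i \<Longrightarrow> c \<in> K \<Longrightarrow>
      \<phi> (ts[i := c * a]) = c * \<phi> (ts[i := a])"
    and f: "f \<in> tensor_relations K Ms"
  shows "multilinear_eval \<phi> f = 0"
  using f
  by induction (simp_all add: multilinear_eval_add multilinear_eval_diff multilinear_eval_scale add scale,
      simp_all add: multilinear_eval_def)

section \<open>Monomial bases and modularity\<close>

definition monomial_basis :: "'a::field set \<Rightarrow> 'a list \<Rightarrow> nat list \<Rightarrow> bool" where
  "monomial_basis K xs qs \<longleftrightarrow> list_all2 (\<lambda>x q. 0 < q \<and> x ^ q \<in> K) xs qs \<and> box_independent K xs qs \<and>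
    ring_adjoin K (set xs) = UNIV"

abbreviation power_tuple :: "'a::field list \<Rightarrow> nat list \<Rightarrow> 'a list" where
  "power_tuple xs \<alpha> \<equiv> map2 (^) xs \<alpha>"

lemma prod_power_tuple: "length xs = length \<alpha> \<Longrightarrow> prod_list (power_tuple xs \<alpha>) = monomial xs \<alpha>"
  by (induction xs \<alpha> rule: list_induct2) auto

lemma box_iff: "\<alpha> \<in> box qs \<longleftrightarrow> length \<alpha> = length qs \<and> (\<forall>j<length qs. \<alpha> ! j < qs ! j)"
  by (simp add: listset_iff)

lemma inj_on_monomial:
  fixes K :: "'a::field set"
  assumes K: "subring_set K" and ind: "box_independent K xs qs"
  shows "inj_on (monomial xs) (box qs)"
proof (rule inj_onI, rule ccontr)
  fix \<alpha> \<beta> assume ab: "\<alpha> \<in> box qs" "\<beta> \<in> box qs" "monomial xs \<alpha> = monomial xs \<beta>" "\<alpha> \<noteq> \<beta>"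
  let ?c = "\<lambda>\<gamma>. (if \<gamma> = \<alpha> then 1 else 0 :: 'a) - (if \<gamma> = \<beta> then 1 else 0)"
  have "(\<Sum>\<gamma>\<in>box qs. ?c \<gamma> * monomial xs \<gamma>) = monomial xs \<alpha> - monomial xs \<beta>"
    using ab finite_box[of qs] by (simp add: left_diff_distrib sum_subtractf if_distrib[of "\<lambda>c. c * _"] cong: if_cong)
  moreover have "?c ` box qs \<subseteq> K"
    using K by (auto intro!: subring_set_closed)
  ultimately have "?c \<alpha> = 0"
    using ind[unfolded box_independent_def, rule_format, of ?c \<alpha>] ab by simp
  then show False using ab by simp
qed

context insep_extension
begin

text \<open>\<open>generate_field\<close> also admits inverses, but the ring on the right is already
  a field by pure inseparability.\<close>

lemma adjoin_eq: "adjoin K x = ring_adjoin K {x}"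
proof
  let ?R = "ring_of_type_algebra :: 'a ring"
  interpret R: field ?R by (rule field_from_type_algebra)
  note ops = type_algebra_ops and neg = type_algebra_a_inv and inv = type_algebra_m_inv
  note sub = subfield_adjoin[of "{x}"]
  note Rs = subfield_set_subring[OF sub]
  show "adjoin K x \<subseteq> ring_adjoin K {x}"
  proof
    fix y assume "y \<in> adjoin K x"
    then show "y \<in> ring_adjoin K {x}"
      unfolding adjoin_def
    proof (induction rule: generate_field.induct)
      case one
      then show ?case by (simp add: ops subring_set_one[OF Rs])
    next
      case (a_inv h)
      then show ?case by (simp add: neg subring_set_uminus[OF Rs])
    next
      case (m_inv h)
      then show ?case by (simp add: ops inv subfield_set_inverse[OF sub])
    qed (auto simp: ops intro: ring_adjoin.intros)
  qed
  have add: "u + v \<in> adjoin K x" if "u \<in> adjoin K x" "v \<in> adjoin K x" for u v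
    using generate_field.eng_add[of u ?R "insert x K" v] that by (simp add: adjoin_def ops)
  have mult: "u * v \<in> adjoin K x" if "u \<in> adjoin K x" "v \<in> adjoin K x" for u v
    using generate_field.eng_mult[of u ?R "insert x K" v] that by (simp add: adjoin_def ops)
  show "ring_adjoin K {x} \<subseteq> adjoin K x"
  proof
    fix y assume "y \<in> ring_adjoin K {x}"
    then show "y \<in> adjoin K x"
      by induction (auto intro: add mult, auto simp: adjoin_def intro: generate_field.incl)
  qed
qed

lemma adjoin_eq_powers:
  "x ^ q \<in> K \<Longrightarrow> 0 < q \<Longrightarrow> adjoin K x = {\<Sum>a<q. c a * x ^ a | c. range c \<subseteq> K}"
  unfolding adjoin_eq by (rule ring_adjoin_simple[OF KR])

lemma subring_adjoin': "subring_set (adjoin K x)" and base_adjoin: "K \<subseteq> adjoin K x" and gen_adjoin: "x \<in> adjoin K x"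
  by (auto simp: adjoin_eq subring_adjoin intro: ring_adjoin.intros)

lemma power_tuple_in: "length xs = length \<alpha> \<Longrightarrow> power_tuple xs \<alpha> \<in> listset (map (adjoin K) xs)"
  by (auto simp: listset_iff intro!: subring_set_power[OF subring_adjoin'] gen_adjoin)

text \<open>Surjectivity is the spanning property. For injectivity, tuples are rewritten modulo
  relations into tuples of powers from the box; an element of the kernel becomes a combination of
  these, whose image is a vanishing combination of independent monomials.\<close>

lemma monomial_basis_imp_modular:
  assumes basis: "monomial_basis K xs qs"
  shows "modular K"
proof -
  let ?Ms = "map (adjoin K) xs"
  let ?F = "free_module K (listset ?Ms)" and ?R = "tensor_relations K ?Ms"
  have q: "list_all2 (\<lambda>x q. 0 < q \<and> x ^ q \<in> K) xs qs" and ind: "box_independent K xs qs"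
    and gen: "ring_adjoin K (set xs) = UNIV"
    using basis by (auto simp: monomial_basis_def)
  have len: "length xs = length qs" using q by (rule list_all2_lengthD)
  have qk: "0 < qs ! k" "(xs ! k) ^ (qs ! k) \<in> K" if "k < length xs" for k
    using list_all2_nthD[OF q that] by auto
  have tup: "prod_list (power_tuple xs \<alpha>) = monomial xs \<alpha>" "power_tuple xs \<alpha> \<in> listset ?Ms"
    if "\<alpha> \<in> box qs" for \<alpha>
    using that len by (simp_all add: box_iff prod_power_tuple power_tuple_in)
  have surj: "mult_eval ` ?F = UNIV"
  proof -
    have "y \<in> mult_eval ` ?F" for y
    proof -
      obtain c where c: "range c \<subseteq> K" "y = (\<Sum>\<alpha>\<in>box qs. c \<alpha> * monomial xs \<alpha>)"
        using box_span[OF KR q, of y] gen by auto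
      let ?f = "\<Sum>\<alpha>\<in>box qs. Poly_Mapping.single (power_tuple xs \<alpha>) (c \<alpha>)"
      have "?f \<in> ?F" using c by (intro free_module_sum free_module_single KR tup) auto
      moreover have "mult_eval ?f = y" unfolding c(2) mult_eval_sum by (intro sum.cong) (auto simp: tup)
      ultimately show ?thesis by blast
    qed
    then show ?thesis by auto
  qed
  let ?G = "power_tuple xs ` box qs"
  define Q where "Q = {f. \<exists>g. Poly_Mapping.keys g \<subseteq> ?G \<and> range (Poly_Mapping.lookup g) \<subseteq> K \<and> f - g \<in> ?R}"
  have Q_add: "f + f' \<in> Q" if ff': "f \<in> Q" "f' \<in> Q" for f f'
  proof -
    obtain g g' where g: "Poly_Mapping.keys g \<subseteq> ?G" "range (Poly_Mapping.lookup g) \<subseteq> K" "f - g \<in> ?R"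
      "Poly_Mapping.keys g' \<subseteq> ?G" "range (Poly_Mapping.lookup g') \<subseteq> K" "f' - g' \<in> ?R"
      using ff' unfolding Q_def by blast
    have "Poly_Mapping.keys (g + g') \<subseteq> ?G" using keys_add[of g g'] g by blast
    moreover have "range (Poly_Mapping.lookup (g + g')) \<subseteq> K"
      using g by (auto simp: lookup_add intro!: subring_set_add[OF KR])
    moreover have "f + f' - (g + g') \<in> ?R"
      using tensor_relations.add[OF g(3,6)] by (simp add: algebra_simps)
    ultimately show ?thesis unfolding Q_def by blast
  qed
  have Q_scale: "Poly_Mapping.map ((*) c) f \<in> Q" if c: "c \<in> K" and f: "f \<in> Q" for c f
  proof -
    obtain g where g: "Poly_Mapping.keys g \<subseteq> ?G" "range (Poly_Mapping.lookup g) \<subseteq> K" "f - g \<in> ?R"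
      using f by (auto simp: Q_def)
    let ?g = "Poly_Mapping.map ((*) c) g"
    have "Poly_Mapping.keys ?g \<subseteq> ?G" using g by (auto simp: in_keys_iff lookup_map_times)
    moreover have "range (Poly_Mapping.lookup ?g) \<subseteq> K"
      using g c by (auto simp: lookup_map_times intro!: subring_set_mult[OF KR])
    moreover have "Poly_Mapping.map ((*) c) (f - g) = Poly_Mapping.map ((*) c) f - ?g"
      by (rule poly_mapping_eqI) (simp add: lookup_map_times lookup_minus algebra_simps)
    then have "Poly_Mapping.map ((*) c) f - ?g \<in> ?R"
      using tensor_relations.scale[OF c g(3)] by simp
    ultimately show ?thesis unfolding Q_def by blast
  qed
  have Q_R: "f \<in> Q" if "f \<in> ?R" for f
    unfolding Q_def using that by (intro CollectI exI[of _ 0]) (auto intro: subring_set_zero[OF KR])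
  have Q_sum: "sum f I \<in> Q" if "\<And>i. i \<in> I \<Longrightarrow> f i \<in> Q" for f :: "'b \<Rightarrow> _" and I
    using that by (induction I rule: infinite_finite_induct) (auto intro: Q_add Q_R tensor_relations.zero)
  have single_scale: "Poly_Mapping.single t c = Poly_Mapping.map ((*) c) (Poly_Mapping.single t 1)"
    for t :: "'a list" and c :: 'a
    by (rule poly_mapping_eqI) (simp add: lookup_map_times lookup_single when_def)
  \<comment> \<open>\<open>k\<close> counts the leading slots not yet rewritten; from slot
    \<open>k\<close> on the entries are powers. The condition is void at
    \<open>k = length xs\<close>, and at \<open>k = 0\<close> the tuple is a power tuple.\<close>
  have single: "Poly_Mapping.single ts 1 \<in> Q"
    if "k \<le> length xs" "ts \<in> listset ?Ms" "\<forall>j. k \<le> j \<longrightarrow> j < length xs \<longrightarrow> (\<exists>a<qs ! j. ts ! j = xs ! j ^ a)" for k ts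
    using that
  proof (induction k arbitrary: ts)
    case 0
    then have "\<forall>j. \<exists>a. j < length xs \<longrightarrow> a < qs ! j \<and> ts ! j = xs ! j ^ a" by auto
    then obtain a where a: "\<And>j. j < length xs \<Longrightarrow> a j < qs ! j \<and> ts ! j = xs ! j ^ a j" by metis
    let ?\<alpha> = "map a [0..<length xs]"
    have "?\<alpha> \<in> box qs" using a len by (simp add: box_iff)
    moreover have "ts = power_tuple xs ?\<alpha>"
      using a 0 by (intro nth_equalityI) (auto simp: listset_iff)
    ultimately have "ts \<in> ?G" by blast
    then show ?case
      unfolding Q_def
      by (intro CollectI exI[of _ "Poly_Mapping.single ts 1"])
        (auto simp: lookup_single when_def tensor_relations.zero subring_set_zero[OF KR] subring_set_one[OF KR])
  next
    case (Suc k)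
    have k: "k < length xs" using Suc.prems by simp
    have "ts ! k \<in> adjoin K (xs ! k)" using Suc.prems k by (auto simp: listset_iff)
    then obtain c where c: "range c \<subseteq> K" "ts ! k = (\<Sum>a<qs ! k. c a * xs ! k ^ a)"
      using adjoin_eq_powers[OF qk(2,1)[OF k]] by auto
    have "Poly_Mapping.single (ts[k := \<Sum>a<qs ! k. c a * xs ! k ^ a]) 1
        - (\<Sum>a<qs ! k. Poly_Mapping.single (ts[k := xs ! k ^ a]) (c a)) \<in> ?R"
      by (rule slot_expand[OF KR Suc.prems(2)])
        (use k c subring_adjoin' base_adjoin gen_adjoin in
          \<open>auto intro!: subring_set_closed dest: subsetD[OF base_adjoin]\<close>)
    then have rel: "Poly_Mapping.single ts 1 - (\<Sum>a<qs ! k. Poly_Mapping.single (ts[k := xs ! k ^ a]) (c a)) \<in> ?R"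
      by (simp add: c(2)[symmetric])
    have "Poly_Mapping.single (ts[k := xs ! k ^ a]) 1 \<in> Q" if "a < qs ! k" for a
    proof (rule Suc.IH)
      show "ts[k := xs ! k ^ a] \<in> listset ?Ms"
        using Suc.prems k by (auto simp: listset_iff nth_list_update intro!: subring_set_power[OF subring_adjoin'] gen_adjoin)
      show "\<forall>j. k \<le> j \<longrightarrow> j < length xs \<longrightarrow> (\<exists>b<qs ! j. ts[k := xs ! k ^ a] ! j = xs ! j ^ b)"
      proof (intro allI impI)
        fix j assume j: "k \<le> j" "j < length xs"
        have "length ts = length xs" using Suc.prems by (simp add: listset_iff)
        then show "\<exists>b<qs ! j. ts[k := xs ! k ^ a] ! j = xs ! j ^ b"
          using Suc.prems(3) j that by (cases "j = k") auto
      qed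
    qed (use k in simp)
    then have "(\<Sum>a<qs ! k. Poly_Mapping.single (ts[k := xs ! k ^ a]) (c a)) \<in> Q"
      using c(1) by (intro Q_sum) (subst single_scale, rule Q_scale, auto)
    from Q_add[OF Q_R[OF rel] this] show ?case by simp
  qed
  have ker: "f \<in> ?R" if f: "f \<in> ?F" "mult_eval f = 0" for f
  proof -
    have "(\<Sum>t\<in>Poly_Mapping.keys f. Poly_Mapping.single t (Poly_Mapping.lookup f t)) \<in> Q"
    proof (rule Q_sum)
      fix t assume "t \<in> Poly_Mapping.keys f"
      then have "Poly_Mapping.single t 1 \<in> Q"
        using f by (intro single[of "length xs"]) (auto simp: free_module_def)
      then show "Poly_Mapping.single t (Poly_Mapping.lookup f t) \<in> Q"
        using f by (subst single_scale, intro Q_scale) (auto simp: free_module_def)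
    qed
    then have "f \<in> Q" by (simp add: sum_single_eq)
    then obtain g where g: "Poly_Mapping.keys g \<subseteq> ?G" "range (Poly_Mapping.lookup g) \<subseteq> K" "f - g \<in> ?R" by (auto simp: Q_def)
    have inj: "inj_on (power_tuple xs) (box qs)"
    proof (rule inj_onI)
      fix \<alpha> \<beta> assume "\<alpha> \<in> box qs" "\<beta> \<in> box qs" "power_tuple xs \<alpha> = power_tuple xs \<beta>"
      then show "\<alpha> = \<beta>" using inj_on_monomial[OF KR ind] tup(1) by (metis inj_onD)
    qed
    have "0 = mult_eval g" using mult_eval_cong[OF g(3)] f by simp
    also have "\<dots> = (\<Sum>t\<in>?G. Poly_Mapping.lookup g t * prod_list t)"
      using g(1) finite_box by (intro mult_eval_superset) auto
    also have "\<dots> = (\<Sum>\<alpha>\<in>box qs. Poly_Mapping.lookup g (power_tuple xs \<alpha>) * monomial xs \<alpha>)"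
      using inj by (subst sum.reindex) (auto simp: tup intro!: sum.cong)
    finally have "\<forall>\<alpha>\<in>box qs. Poly_Mapping.lookup g (power_tuple xs \<alpha>) = 0"
      using ind[unfolded box_independent_def, rule_format, of "\<lambda>\<alpha>. Poly_Mapping.lookup g (power_tuple xs \<alpha>)"] g(2) by auto
    then have "Poly_Mapping.lookup g t = 0" for t
      using g(1) by (cases "t \<in> Poly_Mapping.keys g") (auto simp: in_keys_iff)
    then have "g = 0" by (intro poly_mapping_eqI) simp
    then show ?thesis using g(3) by simp
  qed
  have "bij_betw tensor_mult (tensor_product K ?Ms) UNIV"
    unfolding bij_tensor_mult_iff[OF KR] using ker surj by blast
  then show ?thesis unfolding modular_def by blast
qed

text \<open>\<open>q x\<close> is the degree of \<open>x\<close> over \<open>K\<close>, so the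
  powers below \<open>q x\<close> are a basis of \<open>adjoin K x\<close>, with coordinates
  \<open>co x\<close>. Products of coordinates, the \<open>\<phi> \<beta>\<close>, are multilinear
  and dual to the power tuples. A vanishing combination of monomials comes from a relation by
  injectivity, and \<open>\<phi> \<beta>\<close> reads off that each coefficient is zero.\<close>

lemma modular_imp_monomial_basis:
  assumes "modular K"
  obtains xs es where "monomial_basis K xs (map (\<lambda>e. CHAR('a) ^ e) es)"
proof -
  obtain xs where bij: "bij_betw tensor_mult (tensor_product K (map (adjoin K) xs)) UNIV"
    using assms unfolding modular_def by blast
  let ?Ms = "map (adjoin K) xs"
  let ?F = "free_module K (listset ?Ms)" and ?R = "tensor_relations K ?Ms"
  have ker: "\<And>f. f \<in> ?F \<Longrightarrow> mult_eval f = 0 \<Longrightarrow> f \<in> ?R" and surj: "mult_eval ` ?F = UNIV"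
    using bij unfolding bij_tensor_mult_iff[OF KR] by blast+
  define q where "q x = CHAR('a) ^ (LEAST e. x ^ (CHAR('a) ^ e) \<in> K)" for x
  let ?qs = "map q xs"
  have q: "0 < q x" "x ^ q x \<in> K" for x
    using insep char LeastI_ex[of "\<lambda>e. x ^ (CHAR('a) ^ e) \<in> K"]
    by (auto simp: q_def purely_inseparable_def)
  \<comment> \<open>If the least exponent is \<open>0\<close>, then \<open>q x = 1\<close> and the
    relation reads \<open>c 0 = 0\<close>; otherwise minimality gives the hypothesis of
    \<open>powers_independent\<close> for the exponent one less.\<close>
  have ind: "c a = 0"
    if c: "\<And>a. a < q x \<Longrightarrow> c a \<in> K" and zero: "(\<Sum>a<q x. c a * x ^ a) = 0" and a: "a < q x" for c x a
  proof (cases "LEAST e. x ^ (CHAR('a) ^ e) \<in> K")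
    case 0
    then show ?thesis using zero a by (simp add: q_def)
  next
    case (Suc f)
    then have "x ^ (CHAR('a) ^ f) \<notin> K" using not_less_Least[of f "\<lambda>e. x ^ (CHAR('a) ^ e) \<in> K"] by simp
    then show ?thesis
      using powers_independent[OF K char, of x f c a] c zero a q(2)[of x] unfolding q_def Suc by blast
  qed
  define co where "co x y = (SOME c. range c \<subseteq> K \<and> y = (\<Sum>a<q x. c a * x ^ a))" for x y
  have co: "range (co x y) \<subseteq> K \<and> y = (\<Sum>a<q x. co x y a * x ^ a)" if y: "y \<in> adjoin K x" for x y
  proof -
    have "\<exists>c. range c \<subseteq> K \<and> y = (\<Sum>a<q x. c a * x ^ a)"
      using y unfolding adjoin_eq_powers[OF q(2,1)[of x]] by auto
    then show ?thesis unfolding co_def by (rule someI_ex)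
  qed
  have co_eq: "co x (\<Sum>a<q x. c a * x ^ a) b = c b" if c: "range c \<subseteq> K" and b: "b < q x" for c x b
  proof -
    let ?y = "\<Sum>a<q x. c a * x ^ a"
    have "?y \<in> adjoin K x" unfolding adjoin_eq_powers[OF q(2,1)[of x]] using c by blast
    note d = co[OF this]
    have "co x ?y b - c b = 0"
    proof (rule ind[OF _ _ b])
      show "(\<Sum>a<q x. (co x ?y a - c a) * x ^ a) = 0"
        using d by (simp add: left_diff_distrib sum_subtractf)
    qed (use c d in \<open>auto intro!: subring_set_diff[OF KR]\<close>)
    then show ?thesis by simp
  qed
  have co_add: "co x (y + z) b = co x y b + co x z b"
    if yz: "y \<in> adjoin K x" "z \<in> adjoin K x" and b: "b < q x" for x y z b
  proof -
    have y: "range (co x y) \<subseteq> K" "y = (\<Sum>a<q x. co x y a * x ^ a)"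
      and z: "range (co x z) \<subseteq> K" "z = (\<Sum>a<q x. co x z a * x ^ a)"
      using co[OF yz(1)] co[OF yz(2)] by blast+
    have "y + z = (\<Sum>a<q x. co x y a * x ^ a) + (\<Sum>a<q x. co x z a * x ^ a)" using y(2) z(2) by (rule arg_cong2)
    also have "\<dots> = (\<Sum>a<q x. (co x y a + co x z a) * x ^ a)" by (simp add: sum.distrib distrib_right)
    finally have e: "y + z = (\<Sum>a<q x. (co x y a + co x z a) * x ^ a)" .
    show ?thesis
      by (subst e, rule co_eq) (use y z b in \<open>auto intro!: subring_set_add[OF KR]\<close>)
  qed
  have co_scale: "co x (k * y) b = k * co x y b"
    if y: "y \<in> adjoin K x" and k: "k \<in> K" and b: "b < q x" for x y k b
  proof -
    have y: "range (co x y) \<subseteq> K" "y = (\<Sum>a<q x. co x y a * x ^ a)" using co[OF y] by blast+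
    have "k * y = k * (\<Sum>a<q x. co x y a * x ^ a)" using y(2) by (rule arg_cong)
    also have "\<dots> = (\<Sum>a<q x. (k * co x y a) * x ^ a)" by (simp add: sum_distrib_left mult.assoc)
    finally have e: "k * y = (\<Sum>a<q x. (k * co x y a) * x ^ a)" .
    show ?thesis
      by (subst e, rule co_eq) (use y k b in \<open>auto intro!: subring_set_mult[OF KR]\<close>)
  qed
  have co_power: "co x (x ^ a) b = (if a = b then 1 else 0)" if ab: "a < q x" "b < q x" for x a b
  proof -
    have e: "x ^ a = (\<Sum>i<q x. (if i = a then 1 else 0) * x ^ i)"
      using ab by (subst sum.remove[of _ a]) auto
    have "co x (x ^ a) b = (if b = a then 1 else 0)"
      by (subst e, rule co_eq) (use ab in \<open>auto intro: subring_set_closed[OF KR]\<close>)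
    then show ?thesis by auto
  qed
  define \<phi> where "\<phi> \<beta> ts = (\<Prod>k<length xs. co (xs ! k) (ts ! k) (\<beta> ! k))" for \<beta> ts
  have \<phi>_update: "\<phi> \<beta> (ts[i := a]) = co (xs ! i) a (\<beta> ! i) * (\<Prod>k\<in>{..<length xs} - {i}. co (xs ! k) (ts ! k) (\<beta> ! k))"
    if "ts \<in> listset ?Ms" "i < length xs" for \<beta> ts i a
    using that unfolding \<phi>_def by (subst prod.remove[of _ i]) (auto simp: listset_iff intro!: prod.cong)
  have \<phi>_rel: "multilinear_eval (\<phi> \<beta>) f = 0" if "f \<in> ?R" and \<beta>: "\<beta> \<in> box ?qs" for f \<beta>
  proof -
    have "\<beta> ! i < q (xs ! i)" if "i < length xs" for i
      using \<beta> that unfolding box_iff by simp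
    then show ?thesis
      using \<open>f \<in> ?R\<close> by (intro multilinear_eval_relations[of ?Ms "\<phi> \<beta>" K f])
        (auto simp: \<phi>_update co_add co_scale distrib_right mult.assoc)
  qed
  have \<phi>_power: "\<phi> \<beta> (power_tuple xs \<alpha>) = (if \<alpha> = \<beta> then 1 else 0)"
    if "\<alpha> \<in> box ?qs" "\<beta> \<in> box ?qs" for \<alpha> \<beta>
  proof -
    have len: "length \<alpha> = length xs" "length \<beta> = length xs"
      and less: "\<And>k. k < length xs \<Longrightarrow> \<alpha> ! k < q (xs ! k) \<and> \<beta> ! k < q (xs ! k)"
      using that unfolding box_iff by simp_all
    have "\<phi> \<beta> (power_tuple xs \<alpha>) = (\<Prod>k<length xs. if \<alpha> ! k = \<beta> ! k then 1 else 0)"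
      unfolding \<phi>_def using len less by (intro prod.cong) (auto simp: co_power)
    also have "\<dots> = (if \<alpha> = \<beta> then 1 else 0)"
    proof (cases "\<alpha> = \<beta>")
      case False
      then obtain k where "k < length xs" "\<alpha> ! k \<noteq> \<beta> ! k"
        using len by (auto simp: list_eq_iff_nth_eq)
      then show ?thesis using False by auto
    qed simp
    finally show ?thesis .
  qed
  have len_box: "length xs = length \<alpha>" if "\<alpha> \<in> box ?qs" for \<alpha>
    using that unfolding box_iff by simp
  have "box_independent K xs ?qs"
    unfolding box_independent_def
  proof (intro allI impI ballI)
    fix c \<beta>
    assume c: "c ` box ?qs \<subseteq> K" and zero: "(\<Sum>\<alpha>\<in>box ?qs. c \<alpha> * monomial xs \<alpha>) = 0" and \<beta>: "\<beta> \<in> box ?qs"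
    let ?f = "\<Sum>\<alpha>\<in>box ?qs. Poly_Mapping.single (power_tuple xs \<alpha>) (c \<alpha>)"
    have "?f \<in> ?F"
      using c by (intro free_module_sum free_module_single KR power_tuple_in len_box) auto
    moreover have "mult_eval ?f = 0"
      unfolding mult_eval_sum zero[symmetric] by (intro sum.cong) (simp_all add: prod_power_tuple len_box del: map_map)
    ultimately have "multilinear_eval (\<phi> \<beta>) ?f = 0" using ker \<beta> by (intro \<phi>_rel) auto
    moreover have "multilinear_eval (\<phi> \<beta>) ?f = (\<Sum>\<alpha>\<in>box ?qs. c \<alpha> * (if \<alpha> = \<beta> then 1 else 0))"
      unfolding multilinear_eval_sum using \<beta> by (intro sum.cong) (simp_all only: multilinear_eval_single \<phi>_power)
    moreover have "\<dots> = c \<beta>" using \<beta> by (subst sum.remove[OF finite_box \<beta>]) (auto intro: sum.neutral)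
    ultimately show "c \<beta> = 0" by simp
  qed
  moreover have "ring_adjoin K (set xs) = UNIV"
  proof -
    let ?N = "ring_adjoin K (set xs)"
    note N = subring_adjoin[of "set xs"]
    have "prod_list ts \<in> ?N" if "set ts \<subseteq> ?N" for ts
      using that by (induction ts) (auto intro: subring_set_closed[OF N])
    moreover have "set ts \<subseteq> ?N" if "ts \<in> listset ?Ms" for ts
    proof -
      have "ts ! j \<in> ?N" if "j < length xs" for j
        using \<open>ts \<in> listset ?Ms\<close> that ring_adjoin_mono[of "{xs ! j}" "set xs" K]
        by (auto simp: listset_iff adjoin_eq)
      then show ?thesis using that by (auto simp: listset_iff in_set_conv_nth)
    qed
    moreover have "Poly_Mapping.lookup f t \<in> ?N" if "f \<in> ?F" for f t
      using that by (auto simp: free_module_def intro!: ring_adjoin.base)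
    ultimately have "mult_eval f \<in> ?N" if "f \<in> ?F" for f
      using that unfolding mult_eval_def
      by (intro subring_set_sum[OF N] subring_set_mult[OF N]) (auto simp: free_module_def)
    then have "mult_eval ` ?F \<subseteq> ?N" by (rule image_subsetI)
    then show ?thesis unfolding surj by (rule top.extremum_uniqueI)
  qed
  ultimately have "monomial_basis K xs ?qs"
    using q by (simp add: monomial_basis_def list_all2_conv_all_nth)
  moreover have "?qs = map (\<lambda>e. CHAR('a) ^ e) (map (\<lambda>x. LEAST e. x ^ (CHAR('a) ^ e) \<in> K) xs)"
    by (simp add: q_def)
  ultimately show ?thesis using that by metis
qed

end

section \<open>Diagonal operators of a modular extension\<close>

text \<open>In \<open>j * (p ^ e choose j) = p ^ e * (p ^ e - 1 choose j - 1)\<close>, if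
  \<open>p\<close> did not divide the left binomial coefficient, \<open>p ^ e\<close> would divide
  \<open>j\<close>.\<close>

lemma choose_prime_power_eq_0:
  assumes char: "CHAR('a::field) > 0" and j: "0 < j" "j < CHAR('a) ^ e"
  shows "of_nat (CHAR('a) ^ e choose j) = (0 :: 'a)"
proof -
  let ?p = "CHAR('a)"
  have prime: "prime ?p" using char by (rule prime_CHAR_semidom)
  have "?p dvd (?p ^ e choose j)"
  proof (rule ccontr)
    assume "\<not> ?thesis"
    then have "coprime (?p ^ e) (?p ^ e choose j)" using prime by (simp add: prime_imp_coprime)
    moreover obtain r where r: "j = Suc r" using j by (cases j) auto
    obtain s where s: "?p ^ e = Suc s" using j by (cases "?p ^ e") auto
    have "?p ^ e dvd j * (?p ^ e choose j)"
      using Suc_times_binomial_eq[of s r] unfolding r s by (metis dvd_triv_left mult.commute)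
    ultimately have "?p ^ e dvd j" by (simp add: coprime_dvd_mult_left_iff)
    then show False using j by (auto dest: dvd_imp_le)
  qed
  then show ?thesis by (simp add: of_nat_eq_0_iff_char_dvd)
qed

text \<open>In Vandermonde's identity for \<open>p ^ e + b\<close> only the term
  \<open>k = 0\<close> survives in the field when \<open>a < p ^ e\<close>, so the upper entry
  matters only modulo \<open>p ^ e\<close>.\<close>

lemma choose_mod_prime_power:
  assumes char: "CHAR('a::field) > 0" and a: "a < CHAR('a) ^ e"
  shows "(of_nat (b choose a) :: 'a) = of_nat (b mod CHAR('a) ^ e choose a)"
proof -
  let ?q = "CHAR('a) ^ e"
  have shift: "(of_nat (?q + b choose a) :: 'a) = of_nat (b choose a)" for b
  proof -
    have "(of_nat (?q + b choose a) :: 'a) = (\<Sum>k\<le>a. of_nat (?q choose k) * of_nat (b choose (a - k)))"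
      by (simp add: vandermonde[symmetric])
    also have "\<dots> = (\<Sum>k\<le>a. if k = 0 then of_nat (b choose a) else 0)"
      using a by (intro sum.cong) (auto simp: choose_prime_power_eq_0[OF char])
    finally show ?thesis by simp
  qed
  have "(of_nat (?q * d + r choose a) :: 'a) = of_nat (r choose a)" for d r
    by (induction d) (simp_all add: shift add.assoc)
  from this[of "b div ?q" "b mod ?q"] show ?thesis by simp
qed

fun multi_choose :: "nat list \<Rightarrow> nat list \<Rightarrow> nat" where
  "multi_choose (b # bs) (a # as) = (b choose a) * multi_choose bs as"
| "multi_choose _ _ = 1"

lemma multi_choose_self: "multi_choose \<alpha> \<alpha> = 1"
  by (induction \<alpha>) auto

text \<open>A nonzero product of binomials forces \<alpha> \<le> \<beta> entrywise; this is the
  triangularity behind \<open>approximate_diff_op\<close>.\<close>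

lemma multi_choose_nonzero_imp_eq:
  assumes "length \<beta> = length \<alpha>" "multi_choose \<beta> \<alpha> \<noteq> 0" "sum_list \<beta> \<le> sum_list \<alpha>"
  shows "\<beta> = \<alpha>"
proof -
  have le: "sum_list \<alpha> \<le> sum_list \<beta>" if "length \<beta> = length \<alpha>" "multi_choose \<beta> \<alpha> \<noteq> 0" for \<alpha> \<beta>
    using that by (induction \<beta> \<alpha> rule: list_induct2) (auto simp: not_less[symmetric] binomial_eq_0 intro!: add_mono)
  show ?thesis using assms
  proof (induction \<beta> \<alpha> rule: list_induct2)
    case (Cons b \<beta> a \<alpha>)
    then have "a \<le> b" by (metis binomial_eq_0 mult_eq_0_iff multi_choose.simps(1) not_less)
    moreover have "sum_list \<alpha> \<le> sum_list \<beta>" using le[of \<beta> \<alpha>] Cons by auto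
    ultimately show ?case using Cons by auto
  qed simp
qed

lemma multi_choose_update_Suc:
  assumes "length \<beta> = length \<alpha>" "k < length \<alpha>"
  shows "multi_choose (\<beta>[k := Suc (\<beta> ! k)]) \<alpha> =
    multi_choose \<beta> \<alpha> + (if \<alpha> ! k = 0 then 0 else multi_choose \<beta> (\<alpha>[k := \<alpha> ! k - 1]))"
  using assms
proof (induction \<beta> \<alpha> arbitrary: k rule: list_induct2)
  case (Cons b \<beta> a \<alpha>)
  show ?case
  proof (cases k)
    case 0
    then show ?thesis by (cases a) (auto simp: algebra_simps)
  next
    case (Suc k')
    then show ?thesis using Cons.IH[of k'] Cons.prems by (auto simp: algebra_simps)
  qed
qed simp

lemma monomial_update_Suc:
  "length \<beta> = length xs \<Longrightarrow> k < length xs \<Longrightarrow> monomial xs (\<beta>[k := Suc (\<beta> ! k)]) = xs ! k * monomial xs \<beta>"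
proof (induction \<beta> xs arbitrary: k rule: list_induct2)
  case (Cons b \<beta> x xs)
  then show ?case by (cases k) (auto simp: mult_ac)
qed simp

lemma box_decrement:
  assumes "\<alpha> \<in> box qs" shows "\<alpha>[k := \<alpha> ! k - 1] \<in> box qs"
proof -
  have "\<alpha>[k := \<alpha> ! k - 1] ! j \<le> \<alpha> ! j" if "j < length \<alpha>" for j
    using that by (cases "k = j") auto
  then show ?thesis using assms unfolding box_iff by (auto intro: le_less_trans)
qed

definition reduce :: "nat list \<Rightarrow> nat list \<Rightarrow> nat list" where
  "reduce qs \<beta> = map2 (mod) \<beta> qs"

lemma reduce_Cons [simp]: "reduce (q # qs) (b # \<beta>) = (b mod q) # reduce qs \<beta>"
  and reduce_Nil [simp]: "reduce [] [] = []"
  by (simp_all add: reduce_def)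

lemma reduce_in_box:
  "length \<beta> = length qs \<Longrightarrow> (\<And>q. q \<in> set qs \<Longrightarrow> 0 < q) \<Longrightarrow> reduce qs \<beta> \<in> box qs"
  by (induction \<beta> qs rule: list_induct2) (auto simp: set_Cons_def)

lemma sum_list_reduce: "length \<beta> = length qs \<Longrightarrow> sum_list (reduce qs \<beta>) \<le> sum_list \<beta>"
  by (induction \<beta> qs rule: list_induct2) (auto intro: add_mono)

lemma multi_choose_reduce:
  assumes char: "CHAR('a::field) > 0" and "length \<beta> = length es" "\<alpha> \<in> box (map (\<lambda>e. CHAR('a) ^ e) es)"
  shows "(of_nat (multi_choose \<beta> \<alpha>) :: 'a) = of_nat (multi_choose (reduce (map (\<lambda>e. CHAR('a) ^ e) es) \<beta>) \<alpha>)"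
  using assms(2,3)
proof (induction \<beta> es arbitrary: \<alpha> rule: list_induct2)
  case (Cons b \<beta> e es)
  then obtain a \<alpha>' where "\<alpha> = a # \<alpha>'" "a < CHAR('a) ^ e" "\<alpha>' \<in> box (map (\<lambda>e. CHAR('a) ^ e) es)"
    by (auto simp: set_Cons_def)
  then show ?case using Cons.IH[of \<alpha>'] choose_mod_prime_power[OF char, of a e b] by simp
qed simp

lemma monomial_reduce:
  assumes K: "subring_set K" and q: "list_all2 (\<lambda>x q. 0 < q \<and> x ^ q \<in> K) xs qs"
    and "length \<beta> = length xs"
  shows "\<exists>c\<in>K. monomial xs \<beta> = c * monomial xs (reduce qs \<beta>)"
  using q assms(3)
proof (induction arbitrary: \<beta> rule: list_all2_induct)
  case Nil
  then show ?case using subring_set_one[OF K] by auto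
next
  case (Cons x xs q qs)
  then obtain b \<beta>' where b: "\<beta> = b # \<beta>'" "length \<beta>' = length xs" by (cases \<beta>) auto
  then obtain c where c: "c \<in> K" "monomial xs \<beta>' = c * monomial xs (reduce qs \<beta>')" using Cons.IH by blast
  have "x ^ b = (x ^ q) ^ (b div q) * x ^ (b mod q)"
    by (simp add: power_mult[symmetric] power_add[symmetric])
  then have "monomial (x # xs) \<beta> = ((x ^ q) ^ (b div q) * c) * monomial (x # xs) (reduce (q # qs) \<beta>)"
    using b c by (simp add: mult_ac)
  moreover have "(x ^ q) ^ (b div q) * c \<in> K"
    using Cons.hyps c by (auto intro: subring_set_mult[OF K subring_set_power[OF K]])
  ultimately show ?case by blast
qed

text \<open>In \<open>D (x * m) = [D, x] m + x * D m\<close>, for a generator \<open>x\<close> and a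
  monomial \<open>m\<close>, induction on the order handles the commutator and induction on the
  degree the other term. Exponents are not confined to the box, because multiplication by a
  generator leads out of it.\<close>

lemma vanish_on_monomials:
  assumes "order_less m D"
    and "\<And>\<beta>. length \<beta> = length xs \<Longrightarrow> sum_list \<beta> < m \<Longrightarrow> D (monomial xs \<beta>) = 0"
    and "length \<beta> = length xs"
  shows "D (monomial xs \<beta>) = 0"
  using assms
proof (induction m arbitrary: D \<beta>)
  case (Suc m)
  have comm: "op_commutator D (xs ! k) (monomial xs \<beta>) = 0" if k: "k < length xs" and \<beta>: "length \<beta> = length xs" for k \<beta>
  proof (rule Suc.IH[OF _ _ \<beta>])
    fix \<beta> assume \<beta>: "length \<beta> = length xs" "sum_list \<beta> < m"
    then have "D (monomial xs (\<beta>[k := Suc (\<beta> ! k)])) = 0" "D (monomial xs \<beta>) = 0"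
      using k by (auto intro!: Suc.prems(2) simp: sum_list_update)
    then show "op_commutator D (xs ! k) (monomial xs \<beta>) = 0"
      using \<beta> k by (simp add: op_commutator_def monomial_update_Suc)
  qed (use Suc.prems(1) in simp)
  show ?case
    using Suc.prems(3)
  proof (induction "sum_list \<beta>" arbitrary: \<beta>)
    case 0
    then show ?case using Suc.prems(2)[of \<beta>] by (metis zero_less_Suc)
  next
    case (Suc s)
    then have "\<not> (\<forall>n\<in>set \<beta>. n = 0)" using sum_list_eq_0_iff[of \<beta>] by (metis nat.distinct(1))
    then obtain k where k: "k < length \<beta>" "\<beta> ! k \<noteq> 0" by (auto simp: in_set_conv_nth)
    let ?\<beta> = "\<beta>[k := \<beta> ! k - 1]"
    have \<beta>: "\<beta> = ?\<beta>[k := Suc (?\<beta> ! k)]" using k by simp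
    have "s = sum_list ?\<beta>"
      using Suc.hyps(2) k elem_le_sum_list[of k \<beta>] by (simp add: sum_list_update)
    then have "D (monomial xs ?\<beta>) = 0" using Suc.prems by (intro Suc.hyps) auto
    moreover have "monomial xs \<beta> = xs ! k * monomial xs ?\<beta>"
      using Suc.prems k by (subst \<beta>, subst monomial_update_Suc) auto
    ultimately show ?case
      using comm[of k ?\<beta>] k Suc.prems by (simp add: op_commutator_def)
  qed
qed simp

section \<open>The diagonal operators and their span\<close>

locale modular_extension = insep_extension K for K :: "'a::field set" +
  fixes xs :: "'a list" and es :: "nat list"
  assumes basis: "monomial_basis K xs (map (\<lambda>e. CHAR('a) ^ e) es)"
begin

definition qs :: "nat list" where "qs = map (\<lambda>e. CHAR('a) ^ e) es"

lemma q: "list_all2 (\<lambda>x q. 0 < q \<and> x ^ q \<in> K) xs qs"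
  and independent: "box_independent K xs qs" and generating: "ring_adjoin K (set xs) = UNIV"
  using basis by (auto simp: monomial_basis_def qs_def)

lemma length_qs: "length xs = length qs"
  using q by (rule list_all2_lengthD)

lemma length_box: "\<alpha> \<in> box qs \<Longrightarrow> length \<alpha> = length xs"
  by (simp add: box_iff length_qs)

lemma pos_qs: "r \<in> set qs \<Longrightarrow> 0 < r"
  using char by (auto simp: qs_def)

definition coeff :: "'a \<Rightarrow> nat list \<Rightarrow> 'a" where
  "coeff y = (SOME c. range c \<subseteq> K \<and> y = (\<Sum>\<alpha>\<in>box qs. c \<alpha> * monomial xs \<alpha>))"

lemma coeff: "range (coeff y) \<subseteq> K" "(\<Sum>\<alpha>\<in>box qs. coeff y \<alpha> * monomial xs \<alpha>) = y"
proof -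
  have "\<exists>c. range c \<subseteq> K \<and> y = (\<Sum>\<alpha>\<in>box qs. c \<alpha> * monomial xs \<alpha>)"
    using box_span[OF KR q, of y] generating by auto
  then have "range (coeff y) \<subseteq> K \<and> y = (\<Sum>\<alpha>\<in>box qs. coeff y \<alpha> * monomial xs \<alpha>)"
    unfolding coeff_def by (rule someI_ex)
  then show "range (coeff y) \<subseteq> K" "(\<Sum>\<alpha>\<in>box qs. coeff y \<alpha> * monomial xs \<alpha>) = y" by auto
qed

lemma coeff_eq:
  assumes c: "\<And>\<alpha>. \<alpha> \<in> box qs \<Longrightarrow> c \<alpha> \<in> K" and \<alpha>: "\<alpha> \<in> box qs"
  shows "coeff (\<Sum>\<alpha>\<in>box qs. c \<alpha> * monomial xs \<alpha>) \<alpha> = c \<alpha>"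
proof -
  let ?y = "\<Sum>\<alpha>\<in>box qs. c \<alpha> * monomial xs \<alpha>"
  have "(\<Sum>\<alpha>\<in>box qs. (coeff ?y \<alpha> - c \<alpha>) * monomial xs \<alpha>) = 0"
    by (simp add: left_diff_distrib sum_subtractf coeff)
  moreover have "(\<lambda>\<alpha>. coeff ?y \<alpha> - c \<alpha>) ` box qs \<subseteq> K"
    using c coeff(1)[of ?y] by (auto intro!: subring_set_diff[OF KR])
  ultimately have "coeff ?y \<alpha> - c \<alpha> = 0"
    using independent[unfolded box_independent_def, rule_format, of "\<lambda>\<alpha>. coeff ?y \<alpha> - c \<alpha>"] \<alpha> by blast
  then show ?thesis by simp
qed

lemma linear_eqI:
  assumes D: "linear_over K D" and E: "linear_over K E"
    and eq: "\<And>\<alpha>. \<alpha> \<in> box qs \<Longrightarrow> D (monomial xs \<alpha>) = E (monomial xs \<alpha>)"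
  shows "D = E"
proof
  fix y
  have "D (\<Sum>\<alpha>\<in>box qs. coeff y \<alpha> * monomial xs \<alpha>) = E (\<Sum>\<alpha>\<in>box qs. coeff y \<alpha> * monomial xs \<alpha>)"
    unfolding linear_over_sum[OF D] linear_over_sum[OF E]
    using coeff(1)[of y] eq by (intro sum.cong) (auto simp: linear_over_scale[OF D] linear_over_scale[OF E] range_subsetD)
  then show "D y = E y" by (simp add: coeff)
qed

text \<open>The divided derivative of index \<alpha> followed by multiplication with the monomial of
  \<alpha>. This factor turns monomials into eigenvectors, on which the invariance of the Frobenius
  images rests.\<close>

definition diag_op :: "nat list \<Rightarrow> 'a \<Rightarrow> 'a" where
  "diag_op \<alpha> y = (\<Sum>\<beta>\<in>box qs. coeff y \<beta> * of_nat (multi_choose \<beta> \<alpha>) * monomial xs \<beta>)"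

lemma linear_diag_op: "linear_over K (diag_op \<alpha>)"
proof -
  have "coeff (y + z) \<beta> = coeff y \<beta> + coeff z \<beta>" if \<beta>: "\<beta> \<in> box qs" for y z \<beta>
  proof -
    have "y + z = (\<Sum>\<beta>\<in>box qs. coeff y \<beta> * monomial xs \<beta>) + (\<Sum>\<beta>\<in>box qs. coeff z \<beta> * monomial xs \<beta>)"
      by (simp only: coeff)
    then have e: "y + z = (\<Sum>\<beta>\<in>box qs. (coeff y \<beta> + coeff z \<beta>) * monomial xs \<beta>)"
      by (simp add: sum.distrib distrib_right)
    show ?thesis
      by (subst e, rule coeff_eq)
        (use \<beta> range_subsetD[OF coeff(1)] in \<open>auto intro!: subring_set_add[OF KR]\<close>)
  qed
  moreover have "coeff (k * y) \<beta> = k * coeff y \<beta>" if \<beta>: "\<beta> \<in> box qs" and k: "k \<in> K" for y k \<beta>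
  proof -
    have "k * y = k * (\<Sum>\<beta>\<in>box qs. coeff y \<beta> * monomial xs \<beta>)"
      by (simp only: coeff)
    then have e: "k * y = (\<Sum>\<beta>\<in>box qs. (k * coeff y \<beta>) * monomial xs \<beta>)"
      by (simp add: sum_distrib_left mult.assoc)
    show ?thesis
      by (subst e, rule coeff_eq)
        (use \<beta> k range_subsetD[OF coeff(1)] in \<open>auto intro!: subring_set_mult[OF KR]\<close>)
  qed
  ultimately show ?thesis
    by (auto simp: linear_over_def diag_op_def sum.distrib[symmetric] sum_distrib_left algebra_simps intro!: sum.cong)
qed

text \<open>Outside the box the exponents are reduced modulo \<open>qs\<close> at the price of a
  factor in \<open>K\<close>; the eigenvalue is unchanged because \<alpha> lies in the box and the
  entries of \<open>qs\<close> are powers of \<open>p\<close>.\<close>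

lemma diag_op_monomial:
  assumes \<alpha>: "\<alpha> \<in> box qs" and \<beta>: "length \<beta> = length xs"
  shows "diag_op \<alpha> (monomial xs \<beta>) = of_nat (multi_choose \<beta> \<alpha>) * monomial xs \<beta>"
proof -
  let ?\<beta> = "reduce qs \<beta>"
  obtain c where c: "c \<in> K" "monomial xs \<beta> = c * monomial xs ?\<beta>"
    using monomial_reduce[OF KR q \<beta>] by blast
  have box: "?\<beta> \<in> box qs" using \<beta> length_qs pos_qs by (intro reduce_in_box) auto
  have "length \<beta> = length es" using \<beta> length_qs by (simp add: qs_def)
  then have red: "(of_nat (multi_choose \<beta> \<alpha>) :: 'a) = of_nat (multi_choose ?\<beta> \<alpha>)"
    using multi_choose_reduce[OF char, of \<beta> es \<alpha>] \<alpha> by (simp add: qs_def del: map_map)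
  have e: "monomial xs \<beta> = (\<Sum>\<gamma>\<in>box qs. (if \<gamma> = ?\<beta> then c else 0) * monomial xs \<gamma>)"
    unfolding c(2) using box by (subst sum.remove[OF finite_box box]) auto
  have "coeff (monomial xs \<beta>) \<gamma> = (if \<gamma> = ?\<beta> then c else 0)" if "\<gamma> \<in> box qs" for \<gamma>
    by (subst e, rule coeff_eq) (use that c subring_set_zero[OF KR] in auto)
  then have "diag_op \<alpha> (monomial xs \<beta>) =
      (\<Sum>\<gamma>\<in>box qs. (if \<gamma> = ?\<beta> then c else 0) * of_nat (multi_choose \<gamma> \<alpha>) * monomial xs \<gamma>)"
    unfolding diag_op_def by (intro sum.cong) auto
  also have "\<dots> = c * of_nat (multi_choose ?\<beta> \<alpha>) * monomial xs ?\<beta>"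
    using box by (subst sum.remove[OF finite_box box]) auto
  finally show ?thesis unfolding red c(2) by (simp add: mult_ac)
qed

lemma linear_commutator: "linear_over K D \<Longrightarrow> linear_over K (op_commutator D b)"
  by (auto simp: linear_over_def op_commutator_def algebra_simps)

text \<open>Pascal's rule in slot \<open>k\<close>, compared on basis monomials. The product with
  \<open>xs ! k\<close> may leave the box, which \<open>diag_op_monomial\<close> permits.\<close>

lemma diag_op_commutator:
  assumes \<alpha>: "\<alpha> \<in> box qs" and k: "k < length xs"
  shows "op_commutator (diag_op \<alpha>) (xs ! k) =
    (\<lambda>y. if \<alpha> ! k = 0 then 0 else xs ! k * diag_op (\<alpha>[k := \<alpha> ! k - 1]) y)" (is "_ = ?E")
proof (rule linear_eqI)
  show "linear_over K (op_commutator (diag_op \<alpha>) (xs ! k))"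
    by (rule linear_commutator[OF linear_diag_op])
  show "linear_over K ?E"
    using linear_diag_op[of "\<alpha>[k := \<alpha> ! k - 1]"] by (auto simp: linear_over_def algebra_simps)
  fix \<beta> assume "\<beta> \<in> box qs"
  then have \<beta>: "length \<beta> = length xs" by (rule length_box)
  have \<alpha>': "\<alpha>[k := \<alpha> ! k - 1] \<in> box qs"
    using \<alpha> by (rule box_decrement)
  have "diag_op \<alpha> (xs ! k * monomial xs \<beta>) =
      of_nat (multi_choose (\<beta>[k := Suc (\<beta> ! k)]) \<alpha>) * (xs ! k * monomial xs \<beta>)"
    using diag_op_monomial[OF \<alpha>, of "\<beta>[k := Suc (\<beta> ! k)]"] \<beta> k by (simp add: monomial_update_Suc)
  then show "op_commutator (diag_op \<alpha>) (xs ! k) (monomial xs \<beta>) = ?E (monomial xs \<beta>)"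
    using length_box[OF \<alpha>] \<beta> k
    by (simp add: op_commutator_def diag_op_monomial[OF \<alpha>] diag_op_monomial[OF \<alpha>', unfolded One_nat_def] multi_choose_update_Suc algebra_simps)
qed

text \<open>A commutator with a generator either vanishes or lowers the degree of \<alpha> by one,
  and \<open>order_less_gen\<close> passes from generators to all of \<open>L\<close>.\<close>

lemma order_diag_op: "\<alpha> \<in> box qs \<Longrightarrow> order_less (Suc (sum_list \<alpha>)) (diag_op \<alpha>)"
proof (induction "sum_list \<alpha>" arbitrary: \<alpha> rule: less_induct)
  case less
  have "order_less (sum_list \<alpha>) (op_commutator (diag_op \<alpha>) x)" if x: "x \<in> set xs" for x
  proof -
    obtain k where k: "k < length xs" "x = xs ! k" using x by (auto simp: in_set_conv_nth)
    show ?thesis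
    proof (cases "\<alpha> ! k = 0")
      case True
      then show ?thesis unfolding k(2) diag_op_commutator[OF less.prems k(1)] by (simp add: order_less_zero)
    next
      case False
      let ?\<alpha> = "\<alpha>[k := \<alpha> ! k - 1]"
      have k': "k < length \<alpha>" using length_box[OF less.prems] k by simp
      have sum: "sum_list \<alpha> = Suc (sum_list ?\<alpha>)"
        using k' False elem_le_sum_list[of k \<alpha>] by (simp add: sum_list_update)
      moreover have "?\<alpha> \<in> box qs"
        using less.prems by (rule box_decrement)
      ultimately have "order_less (Suc (sum_list ?\<alpha>)) (diag_op ?\<alpha>)" by (intro less.hyps) auto
      then have "order_less (sum_list \<alpha>) (\<lambda>y. xs ! k * diag_op ?\<alpha> y)"
        unfolding sum by (rule order_less_scale)
      then show ?thesis unfolding k(2) diag_op_commutator[OF less.prems k(1)] using False by simp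
    qed
  qed
  then have "order_less (sum_list \<alpha>) (op_commutator (diag_op \<alpha>) b)" for b
    using order_less_gen[OF linear_diag_op, of "set xs" "sum_list \<alpha>" \<alpha> b] generating by auto
  then show ?case by simp
qed

text \<open>Frobenius turns the expansion of \<open>z\<close> into one of \<open>y\<close> with
  coefficients in \<open>K\<close> and exponents multiplied by \<open>p ^ j\<close>. Each term is
  scaled by an integer, and integers are their own \<open>p ^ j\<close>-th powers in the
  field.\<close>

lemma diag_op_frob:
  assumes \<alpha>: "\<alpha> \<in> box qs" and y: "y \<in> frob_image j"
  shows "diag_op \<alpha> y \<in> frob_image j"
proof -
  obtain z where z: "y = z ^ (CHAR('a) ^ j)" using y by (auto simp: frob_image_def)
  let ?n = "\<lambda>\<beta>. multi_choose (map ((*) (CHAR('a) ^ j)) \<beta>) \<alpha>"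
  have "y = (\<Sum>\<beta>\<in>box qs. coeff z \<beta> * monomial xs \<beta>) ^ (CHAR('a) ^ j)" by (simp add: z coeff)
  also have "\<dots> = (\<Sum>\<beta>\<in>box qs. coeff z \<beta> ^ (CHAR('a) ^ j) * monomial xs (map ((*) (CHAR('a) ^ j)) \<beta>))"
    by (simp add: frobenius_sum[OF char] power_mult_distrib monomial_power)
  finally have "diag_op \<alpha> y = (\<Sum>\<beta>\<in>box qs. diag_op \<alpha> (coeff z \<beta> ^ (CHAR('a) ^ j) * monomial xs (map ((*) (CHAR('a) ^ j)) \<beta>)))"
    by (simp add: linear_over_sum[OF linear_diag_op])
  also have "\<dots> = (\<Sum>\<beta>\<in>box qs. (coeff z \<beta> * of_nat (?n \<beta>) * monomial xs \<beta>) ^ (CHAR('a) ^ j))"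
  proof (rule sum.cong[OF refl])
    fix \<beta> assume "\<beta> \<in> box qs"
    then have "length (map ((*) (CHAR('a) ^ j)) \<beta>) = length xs" by (simp add: length_box)
    moreover have "coeff z \<beta> ^ (CHAR('a) ^ j) \<in> K"
      using coeff(1)[of z] by (intro subring_set_power[OF KR]) auto
    ultimately show "diag_op \<alpha> (coeff z \<beta> ^ (CHAR('a) ^ j) * monomial xs (map ((*) (CHAR('a) ^ j)) \<beta>))
        = (coeff z \<beta> * of_nat (?n \<beta>) * monomial xs \<beta>) ^ (CHAR('a) ^ j)"
      by (simp add: linear_over_scale[OF linear_diag_op] diag_op_monomial[OF \<alpha>] power_mult_distrib
          frobenius_of_nat[OF char] monomial_power mult.assoc)
  qed
  also have "\<dots> = (\<Sum>\<beta>\<in>box qs. coeff z \<beta> * of_nat (?n \<beta>) * monomial xs \<beta>) ^ (CHAR('a) ^ j)"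
    by (simp add: frobenius_sum[OF char])
  finally show ?thesis by (auto simp: frob_image_def)
qed

lemma diag_op_in_frob_diff_ops:
  assumes "\<alpha> \<in> box qs" "sum_list \<alpha> \<le> CHAR('a) ^ i"
  shows "diag_op \<alpha> \<in> frob_diff_ops K i"
  using order_less_mono[OF order_diag_op[OF assms(1)], of "Suc (CHAR('a) ^ i)"] assms diag_op_frob[OF assms(1)]
  by (auto simp: frob_diff_ops_def diff_ops_iff linear_diag_op simp del: order_less.simps)

lemma monomial_nonzero:
  assumes \<alpha>: "\<alpha> \<in> box qs" shows "monomial xs \<alpha> \<noteq> 0"
proof
  assume "monomial xs \<alpha> = 0"
  then have "(\<Sum>\<beta>\<in>box qs. (if \<beta> = \<alpha> then 1 else 0) * monomial xs \<beta>) = 0"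
    by (subst sum.remove[OF finite_box \<alpha>]) (auto intro!: sum.neutral)
  moreover have "(\<lambda>\<beta>. if \<beta> = \<alpha> then 1 else 0) ` box qs \<subseteq> K"
    by (auto intro: subring_set_zero[OF KR] subring_set_one[OF KR])
  ultimately show False
    using independent[unfolded box_independent_def, rule_format, of "\<lambda>\<beta>. if \<beta> = \<alpha> then 1 else 0" \<alpha>] \<alpha> by simp
qed

text \<open>Interpolation degree by degree. For \<alpha> of degree \<open>m\<close>,
  \<open>diag_op \<alpha>\<close> fixes its own monomial and vanishes on every other box monomial of
  degree at most \<open>m\<close>, so values in degree \<open>m\<close> are corrected without
  disturbing lower degrees.\<close>

lemma approximate_diff_op:
  assumes "m \<le> Suc (CHAR('a) ^ i)"
  shows "\<exists>E\<in>op.span (frob_diff_ops K i). \<forall>\<beta>\<in>box qs. sum_list \<beta> < m \<longrightarrow> D (monomial xs \<beta>) = E (monomial xs \<beta>)"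
  using assms
proof (induction m)
  case 0
  then show ?case using op.span_zero by blast
next
  case (Suc m)
  then obtain E where E: "E \<in> op.span (frob_diff_ops K i)"
    "\<And>\<beta>. \<beta> \<in> box qs \<Longrightarrow> sum_list \<beta> < m \<Longrightarrow> D (monomial xs \<beta>) = E (monomial xs \<beta>)" by auto
  let ?S = "{\<alpha> \<in> box qs. sum_list \<alpha> = m}"
  \<comment> \<open>Coefficients from \<open>L\<close> are allowed in the span, so the defect can be
    divided by the monomial, which is nonzero.\<close>
  define c where "c \<alpha> = (D (monomial xs \<alpha>) - E (monomial xs \<alpha>)) / monomial xs \<alpha>" for \<alpha>
  define F where "F = E + (\<Sum>\<alpha>\<in>?S. op_scale (c \<alpha>) (diag_op \<alpha>))"
  have fin: "finite ?S" using finite_box by simp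
  have "F \<in> op.span (frob_diff_ops K i)"
    unfolding F_def using Suc.prems
    by (intro op.span_add E op.span_sum op.span_scale op.span_base diag_op_in_frob_diff_ops) auto
  moreover have "D (monomial xs \<beta>) = F (monomial xs \<beta>)" if \<beta>: "\<beta> \<in> box qs" "sum_list \<beta> < Suc m" for \<beta>
  proof -
    have sum_apply: "(\<Sum>\<alpha>\<in>S. f \<alpha>) x = (\<Sum>\<alpha>\<in>S. f \<alpha> x)" for f :: "nat list \<Rightarrow> 'a \<Rightarrow> 'a" and S x
      by (induction S rule: infinite_finite_induct) auto
    have "F (monomial xs \<beta>) = E (monomial xs \<beta>) + (\<Sum>\<alpha>\<in>?S. c \<alpha> * (of_nat (multi_choose \<beta> \<alpha>) * monomial xs \<beta>))"
      unfolding F_def plus_fun_apply sum_apply using \<beta>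
      by (auto simp: op_scale_def diag_op_monomial length_box)
    also have "(\<Sum>\<alpha>\<in>?S. c \<alpha> * (of_nat (multi_choose \<beta> \<alpha>) * monomial xs \<beta>)) =
        (\<Sum>\<alpha>\<in>?S. if \<alpha> = \<beta> then c \<beta> * monomial xs \<beta> else 0)"
    proof (rule sum.cong[OF refl])
      fix \<alpha> assume "\<alpha> \<in> ?S"
      then have "multi_choose \<beta> \<alpha> = (if \<alpha> = \<beta> then 1 else 0)"
        using multi_choose_nonzero_imp_eq[of \<beta> \<alpha>] \<beta> length_box by (auto simp: multi_choose_self)
      then show "c \<alpha> * (of_nat (multi_choose \<beta> \<alpha>) * monomial xs \<beta>) = (if \<alpha> = \<beta> then c \<beta> * monomial xs \<beta> else 0)"
        by simp
    qed
    also have "E (monomial xs \<beta>) + \<dots> = D (monomial xs \<beta>)"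
      using E(2)[of \<beta>] \<beta> fin monomial_nonzero[OF \<beta>(1)] by (cases "sum_list \<beta> = m") (auto simp: c_def)
    finally show ?thesis ..
  qed
  ultimately show ?case by blast
qed

lemma span_frob_diff_ops: "op.span (frob_diff_ops K i) = diff_ops K (CHAR('a) ^ i)"
proof
  show "op.span (frob_diff_ops K i) \<subseteq> diff_ops K (CHAR('a) ^ i)" by (rule span_frob_diff_ops_subset)
  show "diff_ops K (CHAR('a) ^ i) \<subseteq> op.span (frob_diff_ops K i)"
  proof
    fix D assume D: "D \<in> diff_ops K (CHAR('a) ^ i)"
    obtain E where E: "E \<in> op.span (frob_diff_ops K i)"
      "\<And>\<beta>. \<beta> \<in> box qs \<Longrightarrow> sum_list \<beta> < Suc (CHAR('a) ^ i) \<Longrightarrow> D (monomial xs \<beta>) = E (monomial xs \<beta>)"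
      using approximate_diff_op[of "Suc (CHAR('a) ^ i)" i D] by auto
    have "E \<in> diff_ops K (CHAR('a) ^ i)" using E(1) span_frob_diff_ops_subset by blast
    then have DE: "D - E \<in> diff_ops K (CHAR('a) ^ i)"
      using D by (intro op.subspace_diff subspace_diff_ops)
    then have lin: "linear_over K (D - E)" and ord: "order_less (Suc (CHAR('a) ^ i)) (D - E)"
      unfolding diff_ops_iff by blast+
    \<comment> \<open>\<open>vanish_on_monomials\<close> asks for all exponents of small degree, but
      \<open>E\<close> was matched on the box only; reduction does not raise the degree, and
      \<open>K\<close>-linearity takes care of the factor.\<close>
    have small: "(D - E) (monomial xs \<beta>) = 0" if len: "length \<beta> = length xs" and sum: "sum_list \<beta> < Suc (CHAR('a) ^ i)" for \<beta>
    proof -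
      let ?\<beta> = "reduce qs \<beta>"
      obtain c where c: "c \<in> K" "monomial xs \<beta> = c * monomial xs ?\<beta>"
        using monomial_reduce[OF KR q len] by blast
      have "?\<beta> \<in> box qs" using len length_qs pos_qs by (intro reduce_in_box) auto
      moreover have "sum_list ?\<beta> < Suc (CHAR('a) ^ i)"
        using sum_list_reduce[of \<beta> qs] len sum length_qs by simp
      ultimately have "(D - E) (monomial xs ?\<beta>) = 0" using E(2) by simp
      then show ?thesis unfolding c(2) using linear_over_scale[OF lin c(1)] by simp
    qed
    have "(D - E) (monomial xs \<beta>) = 0" if "length \<beta> = length xs" for \<beta>
      by (rule vanish_on_monomials[OF ord small that])
    then have "D (monomial xs \<alpha>) = E (monomial xs \<alpha>)" if "\<alpha> \<in> box qs" for \<alpha>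
      using length_box[OF that] by simp
    then have "D = E"
      using D \<open>E \<in> diff_ops K _\<close> by (intro linear_eqI) (auto simp: diff_ops_iff)
    then show "D \<in> op.span (frob_diff_ops K i)" using E(1) by simp
  qed
qed

end

section \<open>Finiteness and the two directions of the equivalence\<close>

lemma finite_generating_set:
  fixes K :: "'a::field set"
  assumes K: "subfield K (ring_of_type_algebra :: 'a ring)"
    and dim: "ring.dimension (ring_of_type_algebra :: 'a ring) n K UNIV"
  obtains B where "finite B" "ring_adjoin K B = UNIV"
proof -
  let ?R = "ring_of_type_algebra :: 'a ring"
  interpret R: field ?R by (rule field_from_type_algebra)
  obtain us where us: "R.Span K us = UNIV"
    using R.exists_base[OF K dim] by auto
  have "ring_adjoin K (set us) = UNIV"
    using Span_subset_ring_adjoin[OF K, of us] us by auto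
  then show ?thesis using that by blast
qed

lemma subfield_imp_subfield_set:
  assumes "subfield K (ring_of_type_algebra :: 'a::field ring)"
  shows "subfield_set K"
proof -
  let ?R = "ring_of_type_algebra :: 'a ring"
  interpret R: field ?R by (rule field_from_type_algebra)
  note ops = type_algebra_ops and neg = type_algebra_a_inv and inv = type_algebra_m_inv
  note props = R.subring_props[OF assms]
  have zero: "0 \<in> K" and one: "1 \<in> K" using props(2,3) by (simp_all add: ops)
  have add: "x + y \<in> K" and mult: "x * y \<in> K" if "x \<in> K" "y \<in> K" for x y
    using props(6,7)[of x y] that by (simp_all add: ops)
  have um: "- x \<in> K" if "x \<in> K" for x using props(5)[of x] that by (simp add: neg)
  have iv: "inverse x \<in> K" if "x \<in> K" for x
    using R.subfield_m_inv(1)[OF assms, of x] that zero by (cases "x = 0") (auto simp: ops inv)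
  have "x - y \<in> K" if "x \<in> K" "y \<in> K" for x y using add[OF that(1) um[OF that(2)]] by simp
  then show ?thesis using one mult iv by (simp add: subfield_set_def subring_set_def)
qed

context insep_extension
begin

text \<open>Finitely many generators have a common exponent, and Frobenius, being a ring
  homomorphism, spreads it to \<open>L\<close>. This gives the \<open>LEAST\<close> in
  \<open>insep_exponent\<close> a meaning.\<close>

lemma ex_frob_image_subset:
  assumes "finite B" "ring_adjoin K B = UNIV"
  shows "\<exists>e. frob_image e \<subseteq> K"
proof -
  have up: "x ^ (CHAR('a) ^ m) \<in> K" if "x ^ (CHAR('a) ^ n) \<in> K" "n \<le> m" for x n m
  proof -
    have "x ^ (CHAR('a) ^ m) = (x ^ (CHAR('a) ^ n)) ^ (CHAR('a) ^ (m - n))"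
      using that by (simp add: power_mult[symmetric] power_add[symmetric])
    then show ?thesis using that subring_set_power[OF KR] by simp
  qed
  obtain n where n: "\<And>x. x ^ (CHAR('a) ^ n x) \<in> K"
    using insep unfolding purely_inseparable_def by metis
  define e where "e = (\<Sum>b\<in>B. n b)"
  have b: "b ^ (CHAR('a) ^ e) \<in> K" if "b \<in> B" for b
    using assms(1) that by (intro up[OF n]) (auto simp: e_def intro: member_le_sum)
  have "x ^ (CHAR('a) ^ e) \<in> K" for x
  proof -
    have "x \<in> ring_adjoin K B" using assms(2) by simp
    then show ?thesis
      by induction (use b in \<open>auto simp: frobenius_add[OF char] power_mult_distrib
          intro: subring_set_power[OF KR] subring_set_add[OF KR] subring_set_mult[OF KR]\<close>)
  qed
  then show ?thesis by (auto simp: frob_image_def)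
qed

text \<open>The premise inside \<open>span\<close> accounts for \<open>e \<le> 1\<close>, where no
  spanning condition is available: there \<open>frob_image i \<subseteq> K\<close> for all
  \<open>i \<ge> 1\<close>.\<close>

lemma modular_if_span:
  assumes B: "finite B" "ring_adjoin K B = UNIV" and e: "frob_image e \<subseteq> K"
    and bound: "\<And>xs fs. tower K xs fs \<Longrightarrow> length xs \<le> d"
    and span: "1 \<le> e - 1 \<Longrightarrow> op.span (frob_diff_ops K (e - 1)) = diff_ops K (CHAR('a) ^ (e - 1))"
  shows "modular K"
proof -
  have rat: "\<exists>c. c ` I \<subseteq> K \<inter> frob_image i \<and> z = (\<Sum>k\<in>I. c k * v k)"
    if "1 \<le> i" "finite I" "m ` I \<subseteq> K" "v ` I \<subseteq> frob_image i" "z \<in> frob_image i" "z = (\<Sum>k\<in>I. m k * v k)"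
    for i I z and m v :: "nat list \<Rightarrow> 'a"
  proof (rule rational_combination[OF _ that(2-6)])
    fix m' y' :: "nat list option \<Rightarrow> 'a" and J
    assume "finite J" "m' ` J \<subseteq> K" "y' ` J \<subseteq> frob_image i" "(\<Sum>k\<in>J. y' k * m' k) = 0" "\<exists>k\<in>J. y' k \<noteq> 0"
    then show "\<exists>d. d ` J \<subseteq> K \<inter> frob_image i \<and> (\<Sum>k\<in>J. d k * m' k) = 0 \<and> (\<exists>k\<in>J. d k \<noteq> 0)"
      by - (rule rational_relation[OF B e _ that(1)], erule span, assumption+)
  qed
  obtain xs fs where tower: "tower K xs fs" and gen: "ring_adjoin K (set xs) = UNIV"
    using ex_tower_generating[OF e bound rat] .
  have "list_all2 (\<lambda>x q. 0 < q \<and> x ^ q \<in> K) xs (map (\<lambda>f. CHAR('a) ^ Suc f) fs)"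
    using tower_list_all2[OF tower] char by (simp add: list_all2_map2)
  then have "monomial_basis K xs (map (\<lambda>f. CHAR('a) ^ Suc f) fs)"
    using tower_independent[OF tower] gen by (simp add: monomial_basis_def del: power_Suc)
  then show ?thesis by (rule monomial_basis_imp_modular)
qed

lemma span_if_modular:
  assumes "modular K"
  shows "op.span (frob_diff_ops K i) = diff_ops K (CHAR('a) ^ i)"
proof -
  obtain xs es where "monomial_basis K xs (map (\<lambda>e. CHAR('a) ^ e) es)"
    using modular_imp_monomial_basis[OF assms] .
  then interpret modular_extension K xs es by unfold_locales
  show ?thesis by (rule span_frob_diff_ops)
qed

end

theorem theorem7:
  fixes K :: "'a::field set" and e :: nat
  assumes "CHAR('a) > 0"
    and "subfield K (ring_of_type_algebra :: 'a ring)"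
    and "ring.finite_dimension (ring_of_type_algebra :: 'a ring) K UNIV"
    and "purely_inseparable K"
    and "e = insep_exponent K"
  shows "modular K \<longleftrightarrow>
    (\<forall>i. 0 < i \<and> i \<le> e - 1 \<longrightarrow>
       module.span op_scale (frob_diff_ops K i) = diff_ops K (CHAR('a) ^ i))"
proof -
  interpret R: field "ring_of_type_algebra :: 'a ring" by (rule field_from_type_algebra)
  interpret insep_extension K
    using assms subfield_imp_subfield_set by unfold_locales auto
  obtain n where n: "R.dimension n K UNIV" using assms(3) by (rule R.finite_dimensionE')
  obtain B where B: "finite B" "ring_adjoin K B = UNIV"
    using finite_generating_set[OF assms(2) n] .
  have e: "frob_image e \<subseteq> K"
    unfolding assms(5) insep_exponent_def using ex_frob_image_subset[OF B] by (rule LeastI_ex)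
  have bound: "length xs \<le> n" if "tower K xs fs" for xs fs
    using tower_length_le[OF assms(2,1) n that] .
  show ?thesis
  proof
    assume "modular K"
    then show "\<forall>i. 0 < i \<and> i \<le> e - 1 \<longrightarrow> module.span op_scale (frob_diff_ops K i) = diff_ops K (CHAR('a) ^ i)"
      by (simp add: span_if_modular)
  next
    assume "\<forall>i. 0 < i \<and> i \<le> e - 1 \<longrightarrow> module.span op_scale (frob_diff_ops K i) = diff_ops K (CHAR('a) ^ i)"
    then show "modular K"
      by (intro modular_if_span[OF B e bound]) auto
  qed
qed

end
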